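(* Let $T\in(0,+\infty)$ be fixed and let the data $U,G,G_1,f,\eta,\sigma$ satisfy assumptions (B1) and (B2) listed in the context. For any $(t_0,x_0)\in[0,T)\times G$, the value function $$V(t_0,x_0)=\inf_{u(\cdot)\in\mathcal{U}_{t_0,T}}\Big\{\sigma(x(T;t_0,x_0,u(\cdot)))+\int_{t_0}^T\eta(t,x(t;t_0,x_0,u(\cdot)),u(t))\,dt\Big\}$$ can be represented as the minimum of $$\sigma(x^*(T))+\int_{t_0}^T\eta(t,x^*(t),u^*(t))\,dt$$ over the solutions of the characteristic Cauchy problems $$\left\{\begin{aligned}&\dot{x^*}(t)=f(t,x^*(t),u^*(t)),\\&\dot{p^*}(t)=-\mathrm{D}_xH(t,x^*(t),u^*(t),p^*(t)),\\&u^*(t)\in U^*(t,x^*(t),p^*(t)),\qquad t\in[t_0,T],\\&x^*(t_0)=x_0,\quad p^*(t_0)=p_0,\end{aligned}\right.\qquad(\ast)$$ for all possible values $p^*(t_0)=p_0\in\mathbb{R}^n$. If, moreover, $\eta\equiv0$ and $$U^*(t,x,p)=U^*(t,x,\alpha p)\quad\forall\alpha>0\ \ \forall(t,x,p)\in[0,T]\times G\times\mathbb{R}^n,$$ then it is enough to consider a bounded set of parameter values, i.e., for any $(t_0,x_0)\in[0,T)\times G$, $V(t_0,x_0)$ is the minimum of $\sigma(x^*(T))$ over the solutions of the Cauchy problems $(\ast)$ for all $$p_0\in\{p\in\mathbb{R}^n:\|p\|=1\ \text{or}\ p=0\}.$$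
   Context: Control system: $\dot x(t)=f(t,x(t),u(t))$, $t\in[t_0,T]$, $x(t_0)=x_0\in G$, with $t_0\in[0,T)$ and $u(\cdot)\in\mathcal{U}_{t_0,T}$, where $\mathcal{U}_{t_0,T}$ is the class of measurable functions on $[t_0,T]$ with values in $U$; $x(\cdot;t_0,x_0,u(\cdot))$ denotes the corresponding solution. Define, for $(t,x,u,p)\in[0,T]\times G\times U\times\mathbb{R}^n$, $$H(t,x,u,p)=\langle p,f(t,x,u)\rangle+\eta(t,x,u),\qquad U^*(t,x,p)=\mathrm{Arg}\min_{u\in U}H(t,x,u,p)$$ ($U^*(t,x,p)$ is the set of global minimizers of $H(t,x,\cdot,p)$ on $U$, possibly empty). A solution of $(\ast)$ consists of absolutely continuous $x^*,p^*$ on $[t_0,T]$ and a measurable $u^*:[t_0,T]\to U$, with the differential equations and the inclusion for $u^*$ understood for almost every $t$. $\|\cdot\|$ denotes Euclidean norms (and the induced matrix norms), $\mathrm{D}_x$ the derivative with respect to $x$, $\mathrm{D}\sigma$ the derivative of $\sigma$, and $\bar G$ the closure of $G$. Assumption (B1): 1) $U\subseteq\mathbb{R}^m$ is closed. 2) $G$ and $G_1$ are open domains in $\mathbb{R}^n$ and $\bar G\subseteq G_1$. 3) $f:[0,T]\times G_1\times U\to\mathbb{R}^n$, $\eta:[0,T]\times G_1\times U\to\mathbb{R}$ and $\sigma:G_1\to\mathbb{R}$ are continuous. 4) $G$ is strongly invariant: for $(t_0,x_0)\in[0,T)\times G$ and $u(\cdot)\in\mathcal{U}_{t_0,T}$,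 any corresponding state trajectory $x(\cdot;t_0,x_0,u(\cdot))$ defined on a subinterval of $[t_0,T]$ stays inside $G$ and cannot reach the boundary $\partial G$. 5) There exist $a\in G$ and constants $A_1,A_2>0$ such that $\|f(t,a,u)\|\le A_1$, $|\eta(t,a,u)|\le A_2$ for all $(t,u)\in[0,T]\times U$. 6) If $U$ is unbounded, there exist $C_1>0$ and a modulus of continuity $\omega_1:[0,+\infty)\to[0,+\infty)$ such that $\|f(t,x',u')-f(t,x'',u'')\|\le C_1\|x'-x''\|+\omega_1(\|u'-u''\|)$ for all $t\in[0,T]$, $x',x''\in\bar G$, $u',u''\in U$. 7) If $U$ is bounded, there exists $C_1>0$ such that $\|f(t,x',u)-f(t,x'',u)\|\le C_1\|x'-x''\|$ for all $t\in[0,T]$, $x',x''\in\bar G$, $u\in U$. 8) If $U$ is unbounded, there exist $C_2,C_3>0$ and a modulus of continuity $\omega_2:[0,+\infty)\to[0,+\infty)$ such that $|\eta(t,x',u')-\eta(t,x'',u'')|\le C_2\|x'-x''\|+\omega_2(\|u'-u''\|)$ and $|\sigma(x')-\sigma(x'')|\le C_3\|x'-x''\|$ for all $t\in[0,T]$, $x',x''\in\bar G$, $u',u''\in U$. 9) If $U$ is bounded, then for any compact $K\subseteq\bar G$ there exist $C_{2,K},C_{3,K}>0$ such that $|\eta(t,x',u)-\eta(t,x'',u)|\le C_{2,K}\|x'-x''\|$ and $|\sigma(x')-\sigma(x'')|\le C_{3,K}\|x'-x''\|$ for all $t\in[0,T]$, $x',x''\in K$, $u\in U$. 10) The set $\{(f(t,x,u),\eta(t,x,u)):u\in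 U\}\subseteq\mathbb{R}^{n+1}$ is convex and closed for all $(t,x)\in[0,T]\times G_1$. 11) The infimum defining $V(t_0,x_0)$ is finite for every $(t_0,x_0)\in[0,T)\times G$. Assumption (B2): 1) $f,\eta,\sigma$ are continuously differentiable with respect to $x\in G_1$ for all $(t,u)\in[0,T]\times U$. 2) If $U$ is unbounded, there exist moduli of continuity $\omega_3,\omega_4,\omega_5:[0,+\infty)\to[0,+\infty)$ such that $\|\mathrm{D}_xf(t,x',u')-\mathrm{D}_xf(t,x'',u'')\|\le\omega_3(\|x'-x''\|+\|u'-u''\|)$, $\|\mathrm{D}_x\eta(t,x',u')-\mathrm{D}_x\eta(t,x'',u'')\|\le\omega_4(\|x'-x''\|+\|u'-u''\|)$, $\|\mathrm{D}\sigma(x')-\mathrm{D}\sigma(x'')\|\le\omega_5(\|x'-x''\|)$ for all $t\in[0,T]$, $x',x''\in\bar G$, $u',u''\in U$. 3) If $U$ is bounded, then for any compact $K\subseteq\bar G$ there exist moduli of continuity $\omega_{3,K},\omega_{4,K},\omega_{5,K}:[0,+\infty)\to[0,+\infty)$ such that the three inequalities of item 2), with $\omega_i$ replaced by $\omega_{i,K}$, hold for all $t\in[0,T]$, $x',x''\in K$, $u',u''\in U$. *)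

theory Defs
  imports "HOL-Analysis.Analysis"
begin

section \<open>Analytic preliminaries\<close>

text \<open>
  Absolute continuity in the usual sense, over finite families of closed subintervals with
  pairwise disjoint interiors; an interval \<open>k\<close> of the family is \<open>{Inf k..Sup k}\<close>.
\<close>

definition abs_continuous_on :: "real set \<Rightarrow> (real \<Rightarrow> 'a::real_normed_vector) \<Rightarrow> bool" where
  "abs_continuous_on I x \<longleftrightarrow>
     (\<forall>\<epsilon>>0. \<exists>\<delta>>0. \<forall>d. d division_of \<Union>d \<and> \<Union>d \<subseteq> I \<and> (\<Sum>k\<in>d. Sup k - Inf k) < \<delta>
        \<longrightarrow> (\<Sum>k\<in>d. norm (x (Sup k) - x (Inf k))) < \<epsilon>)"

text \<open>
  Only the values on \<open>[0,\<infinity>)\<close> matter. Monotonicity and continuity away from \<open>0\<close>, which some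
  authors include, are not imposed; as moduli occur only in hypotheses, this is the most
  general reading.
\<close>

definition modulus_of_continuity :: "(real \<Rightarrow> real) \<Rightarrow> bool" where
  "modulus_of_continuity \<omega> \<longleftrightarrow> (\<forall>s\<ge>0. \<omega> s \<ge> 0) \<and> \<omega> 0 = 0 \<and> (\<omega> \<longlongrightarrow> 0) (at_right 0)"

text \<open>
  The derivative as a bounded linear map, so that \<^term>\<open>norm\<close> is the induced operator norm;
  meaningful only at points of differentiability.
\<close>

definition fderiv ::
  "('a::real_normed_vector \<Rightarrow> 'b::real_normed_vector) \<Rightarrow> 'a \<Rightarrow> 'a \<Rightarrow>\<^sub>L 'b" where
  "fderiv g x = Blinfun (frechet_derivative g (at x))"

definition continuously_differentiable_on ::
  "('a::real_normed_vector \<Rightarrow> 'b::real_normed_vector) \<Rightarrow> 'a set \<Rightarrow> bool" where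
  "continuously_differentiable_on g S \<longleftrightarrow>
     (\<forall>x\<in>S. g differentiable (at x)) \<and> continuous_on S (fderiv g)"

definition gradient :: "('a::real_inner \<Rightarrow> real) \<Rightarrow> 'a \<Rightarrow> 'a" where
  "gradient g x = (THE D. GDERIV g x :> D)"

definition open_domain :: "'a::topological_space set \<Rightarrow> bool" where
  "open_domain S \<longleftrightarrow> open S \<and> connected S \<and> S \<noteq> {}"

definition is_minimum :: "'a::order \<Rightarrow> 'a set \<Rightarrow> bool" where
  "is_minimum m S \<longleftrightarrow> m \<in> S \<and> (\<forall>s\<in>S. m \<le> s)"


section \<open>The optimal control problem\<close>

text \<open>
  Controls and trajectories are total functions on \<^typ>\<open>real\<close>, of which only the restriction
  to the time interval in question is ever used.
\<close>

definition controls :: "(real^'m) set \<Rightarrow> real \<Rightarrow> real \<Rightarrow> (real \<Rightarrow> real^'m) set" where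
  "controls U t0 T =
     {u. u \<in> borel_measurable (lebesgue_on {t0..T}) \<and> (\<forall>t\<in>{t0..T}. u t \<in> U)}"

definition state_trajectory ::
  "(real \<Rightarrow> real^'n \<Rightarrow> real^'m \<Rightarrow> real^'n) \<Rightarrow> (real^'n) set \<Rightarrow> real \<Rightarrow> real \<Rightarrow> real^'n
     \<Rightarrow> (real \<Rightarrow> real^'m) \<Rightarrow> (real \<Rightarrow> real^'n) \<Rightarrow> bool" where
  "state_trajectory f D t0 t1 x0 u x \<longleftrightarrow>
     abs_continuous_on {t0..t1} x \<and> (\<forall>t\<in>{t0..t1}. x t \<in> D) \<and> x t0 = x0 \<and>
     (AE t in lebesgue_on {t0..t1}.
        (x has_vector_derivative f t (x t) (u t)) (at t within {t0..t1}))"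

text \<open>
  Trajectories are admitted with values anywhere in \<open>G1\<close>, the domain of \<open>f\<close>. Since
  \<open>closure G \<subseteq> G1\<close>, one that reached the boundary of \<open>G\<close> at time \<open>t1\<close> would be a
  trajectory on \<open>[t0,t1]\<close>, and is therefore excluded.
\<close>

definition strongly_invariant ::
  "real \<Rightarrow> (real^'m) set \<Rightarrow> (real^'n) set \<Rightarrow> (real^'n) set
     \<Rightarrow> (real \<Rightarrow> real^'n \<Rightarrow> real^'m \<Rightarrow> real^'n) \<Rightarrow> bool" where
  "strongly_invariant T U G G1 f \<longleftrightarrow>
     (\<forall>t0\<in>{0..<T}. \<forall>x0\<in>G. \<forall>u\<in>controls U t0 T. \<forall>t1\<in>{t0..T}. \<forall>x.
        state_trajectory f G1 t0 t1 x0 u x \<longrightarrow> (\<forall>t\<in>{t0..t1}. x t \<in> G))"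

definition cost ::
  "real \<Rightarrow> (real \<Rightarrow> real^'n \<Rightarrow> real^'m \<Rightarrow> real) \<Rightarrow> (real^'n \<Rightarrow> real) \<Rightarrow> real
     \<Rightarrow> (real \<Rightarrow> real^'m) \<Rightarrow> (real \<Rightarrow> real^'n) \<Rightarrow> real" where
  "cost T \<eta> \<sigma> t0 u x = \<sigma> (x T) + (\<integral>t. \<eta> t (x t) (u t) \<partial>lebesgue_on {t0..T})"

text \<open>
  The infimum over controls \<open>u\<close>, taken over the pairs of \<open>u\<close> and a trajectory \<open>x\<close> on the
  whole of \<open>[t0,T]\<close> (under the standing assumptions \<open>x\<close> exists and is unique for every \<open>u\<close>).
  It is taken in \<^typ>\<open>ereal\<close>, so that its finiteness can be stated as a hypothesis.
\<close>

definition value_function ::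
  "real \<Rightarrow> (real^'m) set \<Rightarrow> (real^'n) set \<Rightarrow> (real \<Rightarrow> real^'n \<Rightarrow> real^'m \<Rightarrow> real^'n)
     \<Rightarrow> (real \<Rightarrow> real^'n \<Rightarrow> real^'m \<Rightarrow> real) \<Rightarrow> (real^'n \<Rightarrow> real) \<Rightarrow> real \<Rightarrow> real^'n \<Rightarrow> ereal" where
  "value_function T U G1 f \<eta> \<sigma> t0 x0 =
     Inf {ereal (cost T \<eta> \<sigma> t0 u x) | u x.
            u \<in> controls U t0 T \<and> state_trajectory f G1 t0 T x0 u x}"


section \<open>Standing assumptions\<close>

definition assumption_B1 ::
  "real \<Rightarrow> (real^'m) set \<Rightarrow> (real^'n) set \<Rightarrow> (real^'n) set
     \<Rightarrow> (real \<Rightarrow> real^'n \<Rightarrow> real^'m \<Rightarrow> real^'n) \<Rightarrow> (real \<Rightarrow> real^'n \<Rightarrow> real^'m \<Rightarrow> real)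
     \<Rightarrow> (real^'n \<Rightarrow> real) \<Rightarrow> bool" where
  "assumption_B1 T U G G1 f \<eta> \<sigma> \<longleftrightarrow>
     closed U \<and>
     (open_domain G \<and> open_domain G1 \<and> closure G \<subseteq> G1) \<and>
     (continuous_on ({0..T} \<times> G1 \<times> U) (\<lambda>(t, x, u). f t x u) \<and>
      continuous_on ({0..T} \<times> G1 \<times> U) (\<lambda>(t, x, u). \<eta> t x u) \<and>
      continuous_on G1 \<sigma>) \<and>
     strongly_invariant T U G G1 f \<and>
     (\<exists>a\<in>G. \<exists>A1>0. \<exists>A2>0. \<forall>t\<in>{0..T}. \<forall>u\<in>U. norm (f t a u) \<le> A1 \<and> \<bar>\<eta> t a u\<bar> \<le> A2) \<and>
     (\<not> bounded U \<longrightarrow>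
        (\<exists>C1>0. \<exists>\<omega>1. modulus_of_continuity \<omega>1 \<and>
          (\<forall>t\<in>{0..T}. \<forall>x'\<in>closure G. \<forall>x''\<in>closure G. \<forall>u'\<in>U. \<forall>u''\<in>U.
             norm (f t x' u' - f t x'' u'') \<le> C1 * norm (x' - x'') + \<omega>1 (norm (u' - u''))))) \<and>
     (bounded U \<longrightarrow>
        (\<exists>C1>0. \<forall>t\<in>{0..T}. \<forall>x'\<in>closure G. \<forall>x''\<in>closure G. \<forall>u\<in>U.
             norm (f t x' u - f t x'' u) \<le> C1 * norm (x' - x''))) \<and>
     (\<not> bounded U \<longrightarrow>
        (\<exists>C2>0. \<exists>C3>0. \<exists>\<omega>2. modulus_of_continuity \<omega>2 \<and>
          (\<forall>t\<in>{0..T}. \<forall>x'\<in>closure G. \<forall>x''\<in>closure G. \<forall>u'\<in>U. \<forall>u''\<in>U.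
             \<bar>\<eta> t x' u' - \<eta> t x'' u''\<bar> \<le> C2 * norm (x' - x'') + \<omega>2 (norm (u' - u'')) \<and>
             \<bar>\<sigma> x' - \<sigma> x''\<bar> \<le> C3 * norm (x' - x'')))) \<and>
     (bounded U \<longrightarrow>
        (\<forall>K. compact K \<and> K \<subseteq> closure G \<longrightarrow>
          (\<exists>C2>0. \<exists>C3>0. \<forall>t\<in>{0..T}. \<forall>x'\<in>K. \<forall>x''\<in>K. \<forall>u\<in>U.
             \<bar>\<eta> t x' u - \<eta> t x'' u\<bar> \<le> C2 * norm (x' - x'') \<and>
             \<bar>\<sigma> x' - \<sigma> x''\<bar> \<le> C3 * norm (x' - x'')))) \<and>
     (\<forall>t\<in>{0..T}. \<forall>x\<in>G1.
        convex ((\<lambda>u. (f t x u, \<eta> t x u)) ` U) \<and> closed ((\<lambda>u. (f t x u, \<eta> t x u)) ` U)) \<and>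
     (\<forall>t0\<in>{0..<T}. \<forall>x0\<in>G. \<bar>value_function T U G1 f \<eta> \<sigma> t0 x0\<bar> \<noteq> \<infinity>)"

definition assumption_B2 ::
  "real \<Rightarrow> (real^'m) set \<Rightarrow> (real^'n) set \<Rightarrow> (real^'n) set
     \<Rightarrow> (real \<Rightarrow> real^'n \<Rightarrow> real^'m \<Rightarrow> real^'n) \<Rightarrow> (real \<Rightarrow> real^'n \<Rightarrow> real^'m \<Rightarrow> real)
     \<Rightarrow> (real^'n \<Rightarrow> real) \<Rightarrow> bool" where
  "assumption_B2 T U G G1 f \<eta> \<sigma> \<longleftrightarrow>
     (\<forall>t\<in>{0..T}. \<forall>u\<in>U.
        continuously_differentiable_on (\<lambda>x. f t x u) G1 \<and>
        continuously_differentiable_on (\<lambda>x. \<eta> t x u) G1) \<and>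
     continuously_differentiable_on \<sigma> G1 \<and>
     (\<not> bounded U \<longrightarrow>
        (\<exists>\<omega>3 \<omega>4 \<omega>5. modulus_of_continuity \<omega>3 \<and> modulus_of_continuity \<omega>4 \<and>
          modulus_of_continuity \<omega>5 \<and>
          (\<forall>t\<in>{0..T}. \<forall>x'\<in>closure G. \<forall>x''\<in>closure G. \<forall>u'\<in>U. \<forall>u''\<in>U.
             norm (fderiv (\<lambda>x. f t x u') x' - fderiv (\<lambda>x. f t x u'') x'')
               \<le> \<omega>3 (norm (x' - x'') + norm (u' - u'')) \<and>
             norm (fderiv (\<lambda>x. \<eta> t x u') x' - fderiv (\<lambda>x. \<eta> t x u'') x'')
               \<le> \<omega>4 (norm (x' - x'') + norm (u' - u'')) \<and>
             norm (fderiv \<sigma> x' - fderiv \<sigma> x'') \<le> \<omega>5 (norm (x' - x''))))) \<and>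
     (bounded U \<longrightarrow>
        (\<forall>K. compact K \<and> K \<subseteq> closure G \<longrightarrow>
          (\<exists>\<omega>3 \<omega>4 \<omega>5. modulus_of_continuity \<omega>3 \<and> modulus_of_continuity \<omega>4 \<and>
            modulus_of_continuity \<omega>5 \<and>
            (\<forall>t\<in>{0..T}. \<forall>x'\<in>K. \<forall>x''\<in>K. \<forall>u'\<in>U. \<forall>u''\<in>U.
               norm (fderiv (\<lambda>x. f t x u') x' - fderiv (\<lambda>x. f t x u'') x'')
                 \<le> \<omega>3 (norm (x' - x'') + norm (u' - u'')) \<and>
               norm (fderiv (\<lambda>x. \<eta> t x u') x' - fderiv (\<lambda>x. \<eta> t x u'') x'')
                 \<le> \<omega>4 (norm (x' - x'') + norm (u' - u'')) \<and>
               norm (fderiv \<sigma> x' - fderiv \<sigma> x'') \<le> \<omega>5 (norm (x' - x''))))))"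


section \<open>The characteristic system\<close>

definition hamiltonian ::
  "(real \<Rightarrow> real^'n \<Rightarrow> real^'m \<Rightarrow> real^'n) \<Rightarrow> (real \<Rightarrow> real^'n \<Rightarrow> real^'m \<Rightarrow> real)
     \<Rightarrow> real \<Rightarrow> real^'n \<Rightarrow> real^'m \<Rightarrow> real^'n \<Rightarrow> real" where
  "hamiltonian f \<eta> t x u p = inner p (f t x u) + \<eta> t x u"

definition minimizers ::
  "(real^'m) set \<Rightarrow> (real \<Rightarrow> real^'n \<Rightarrow> real^'m \<Rightarrow> real^'n)
     \<Rightarrow> (real \<Rightarrow> real^'n \<Rightarrow> real^'m \<Rightarrow> real) \<Rightarrow> real \<Rightarrow> real^'n \<Rightarrow> real^'n \<Rightarrow> (real^'m) set" where
  "minimizers U f \<eta> t x p = {u. is_arg_min (\<lambda>v. hamiltonian f \<eta> t x v p) (\<lambda>v. v \<in> U) u}"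

definition characteristic_solution ::
  "real \<Rightarrow> (real^'m) set \<Rightarrow> (real^'n) set \<Rightarrow> (real \<Rightarrow> real^'n \<Rightarrow> real^'m \<Rightarrow> real^'n)
     \<Rightarrow> (real \<Rightarrow> real^'n \<Rightarrow> real^'m \<Rightarrow> real) \<Rightarrow> real \<Rightarrow> real^'n \<Rightarrow> real^'n
     \<Rightarrow> (real \<Rightarrow> real^'n) \<Rightarrow> (real \<Rightarrow> real^'n) \<Rightarrow> (real \<Rightarrow> real^'m) \<Rightarrow> bool" where
  "characteristic_solution T U G f \<eta> t0 x0 p0 x p u \<longleftrightarrow>
     u \<in> controls U t0 T \<and>
     state_trajectory f G t0 T x0 u x \<and>
     abs_continuous_on {t0..T} p \<and> p t0 = p0 \<and>
     (AE t in lebesgue_on {t0..T}.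
        (p has_vector_derivative - gradient (\<lambda>y. hamiltonian f \<eta> t y (u t) (p t)) (x t))
          (at t within {t0..T})) \<and>
     (AE t in lebesgue_on {t0..T}. u t \<in> minimizers U f \<eta> t (x t) (p t))"

end

theory Submission
  imports Defs "HOL-Complex_Analysis.Great_Picard"
begin

text \<open>
  The set \<open>F t x = {(f t x u, \<eta> t x u) | u. u \<in> U}\<close> is compact and convex. A minimising sequence of
  trajectories, with the running cost as an additional state, is uniformly Lipschitz, so it has a
  uniform limit by Arzela-Ascoli. Integrating support functions shows that the velocity of the limit
  lies in \<open>F t (x t)\<close> almost everywhere, and a measurable selection turns it into an optimal control
  \<open>u\<close>.

  Let \<open>p\<close> solve the adjoint equation along the optimal process with \<open>p T = D\<sigma> (x T)\<close>. For a further
  control \<open>v\<close>, the solution of \<open>X' = (1 - l) f t X u + l f t X v\<close> is, by convexity of \<open>F t X\<close> and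
  measurable selection, again an admissible trajectory, with running cost
  \<open>(1 - l) \<eta> t X u + l \<eta> t X v\<close>. Comparing costs and letting \<open>l\<close> tend to \<open>0\<close> gives that the integral
  of \<open>H t x v p - H t x u p\<close> is nonnegative for every \<open>v\<close>, without needle variations. Taking \<open>v\<close>
  equal to a constant where that lowers \<open>H\<close>, and constants from a countable dense subset of \<open>U\<close>,
  yields the minimum condition. If \<open>\<eta> = 0\<close>, the adjoint equation is linear and \<open>p\<close> may be rescaled.
\<close>

section \<open>Absolutely continuous functions and indefinite integrals\<close>

text \<open>Compactness is needed for the velocities, not for \<open>U\<close>: the bounds at the
  single point \<open>a\<close> are uniform in the control, and the Lipschitz estimates spread them
  to every compact set of states. All estimates are therefore uniform in the control, and Gronwall
  keeps every trajectory from \<open>x0\<close> in one compact set. Trajectories are specified by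
  derivatives almost everywhere, whereas limits and estimates are taken on integrals; the first
  section passes between the two. Adding the running cost to the state lets one and the same control
  realise both components of a limiting velocity, so that the limiting cost is exactly the cost of
  the limiting process. The optimal control is merely measurable, and a needle variation would need
  Lebesgue points of integrands that contain it. A convexified velocity changes by
  \<open>O(l)\<close> at every time instead of by \<open>O(1)\<close> on a short interval, so the
  state moves by \<open>O(l)\<close>, and a pointwise expansion of the Hamiltonian together with
  dominated convergence suffices.\<close>

lemma AE_lebesgue_on_iff_negligible:
  assumes "S \<in> sets lebesgue"
  shows "(AE t in lebesgue_on S. P t) \<longleftrightarrow> negligible {t\<in>S. \<not> P t}"
proof -
  have "(AE t in lebesgue_on S. P t) \<longleftrightarrow> (AE t in lebesgue. t \<in> S \<longrightarrow> P t)"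
    using assms by (simp add: AE_restrict_space_iff)
  also have "\<dots> \<longleftrightarrow> (\<exists>N. negligible N \<and> {t\<in>S. \<not> P t} \<subseteq> N)"
    unfolding eventually_ae_filter negligible_iff_null_sets by auto
  also have "\<dots> \<longleftrightarrow> negligible {t\<in>S. \<not> P t}"
    using negligible_subset by blast
  finally show ?thesis .
qed

lemma abs_continuous_on_lipschitz:
  fixes x :: "real \<Rightarrow> 'a::real_normed_vector"
  assumes lip: "\<And>s t. s \<in> I \<Longrightarrow> t \<in> I \<Longrightarrow> norm (x t - x s) \<le> L * \<bar>t - s\<bar>"
  shows "abs_continuous_on I x"
  unfolding abs_continuous_on_def
proof (intro allI impI)
  fix e :: real assume "e > 0"
  \<comment> \<open>\<open>L\<close> is not assumed nonnegative, so a positive constant replaces it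
    before dividing.\<close>
  let ?L = "\<bar>L\<bar> + 1"
  show "\<exists>\<delta>>0. \<forall>d. d division_of \<Union> d \<and> \<Union> d \<subseteq> I \<and> (\<Sum>k\<in>d. Sup k - Inf k) < \<delta>
        \<longrightarrow> (\<Sum>k\<in>d. norm (x (Sup k) - x (Inf k))) < e"
  proof (intro exI[of _ "e / ?L"] conjI allI impI)
    show "e / ?L > 0" using \<open>e > 0\<close> by (simp add: add_nonneg_pos)
    fix d assume d: "d division_of \<Union> d \<and> \<Union> d \<subseteq> I \<and> (\<Sum>k\<in>d. Sup k - Inf k) < e / ?L"
    have "norm (x (Sup k) - x (Inf k)) \<le> ?L * (Sup k - Inf k)" if "k \<in> d" for k
    proof -
      have "k \<noteq> {}" "\<exists>u v. k = {u..v}" using d that division_ofD(3,4) by (blast, metis box_real(2))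
      then obtain u v where k: "k = {u..v}" "u \<le> v" by auto
      have "{u..v} \<subseteq> I" using d that k by auto
      then have "u \<in> I" "v \<in> I" using k by auto
      then have "norm (x v - x u) \<le> L * (v - u)" using lip[of u v] k(2) by simp
      also have "\<dots> \<le> ?L * (v - u)" using k by (intro mult_right_mono) auto
      finally show ?thesis using k by simp
    qed
    then have "(\<Sum>k\<in>d. norm (x (Sup k) - x (Inf k))) \<le> (\<Sum>k\<in>d. ?L * (Sup k - Inf k))"
      by (rule sum_mono)
    also have "\<dots> = ?L * (\<Sum>k\<in>d. Sup k - Inf k)" by (simp add: sum_distrib_left)
    also have "\<dots> < e"
    proof -
      have "(\<Sum>k\<in>d. Sup k - Inf k) * ?L < e"
        using d by (subst pos_less_divide_eq[symmetric]) (auto simp: add_nonneg_pos)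
      then show ?thesis by (simp add: mult.commute)
    qed
    finally show "(\<Sum>k\<in>d. norm (x (Sup k) - x (Inf k))) < e" .
  qed
qed

text \<open>Integrating the constant 1 over the division adds up the lengths exactly: shared
  endpoints are null.\<close>

lemma sum_content_division_le:
  fixes d :: "real set set"
  assumes "d division_of \<Union>d" "\<Union>d \<subseteq> U" "U \<in> lmeasurable"
  shows "(\<Sum>k\<in>d. Sup k - Inf k) \<le> measure lebesgue U"
proof -
  have eq: "measure lborel k = Sup k - Inf k" if "k \<in> d" for k
  proof -
    have "k \<noteq> {}" "\<exists>u v. k = {u..v}" using assms(1) that division_ofD(3,4) by (blast, metis box_real(2))
    then show ?thesis by auto
  qed
  have has1: "((\<lambda>_. 1::real) has_integral (\<Sum>k\<in>d. measure lborel k)) (\<Union>d)"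
  proof (rule has_integral_combine_division[OF assms(1)])
    fix k assume "k \<in> d"
    then obtain u v where "k = cbox u v" using assms(1) division_ofD(4) by blast
    then show "((\<lambda>_. 1::real) has_integral measure lborel k) k"
      using has_integral_const[of "1::real" u v] by simp
  qed
  then have "\<Union>d \<in> lmeasurable"
    by (metis has_integral_integrable lmeasurable_iff_integrable_on)
  moreover from this has1 have "measure lebesgue (\<Union>d) = (\<Sum>k\<in>d. measure lborel k)"
    by (simp add: lmeasure_integral integral_unique)
  moreover have "measure lebesgue (\<Union>d) \<le> measure lebesgue U"
    using assms calculation by (intro measure_mono_fmeasurable) auto
  ultimately show ?thesis using eq by simp
qed

text \<open>A gauge that keeps the intervals tagged in the exceptional null set inside an open set
  of small measure turns their contribution into one controlled by absolute continuity.\<close>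

lemma abs_continuous_on_has_integral:
  fixes x g :: "real \<Rightarrow> 'a::euclidean_space"
  assumes "a \<le> b" and ac: "abs_continuous_on {a..b} x"
    and deriv: "AE t in lebesgue_on {a..b}. (x has_vector_derivative g t) (at t within {a..b})"
  shows "(g has_integral (x b - x a)) {a..b}"
proof -
  define N where "N = {t\<in>{a..b}. \<not> (x has_vector_derivative g t) (at t within {a..b})}"
  \<comment> \<open>On the exceptional set \<open>g\<close> is arbitrary. Setting it to 0 there
    removes its products with interval lengths, so that only increments of \<open>x\<close> remain
    at those tags.\<close>
  define g0 where "g0 = (\<lambda>t. if t \<in> N then 0 else g t)"
  have negN: "negligible N"
    using deriv by (simp add: N_def AE_lebesgue_on_iff_negligible)
  have "(g0 has_integral (x b - x a)) {a..b}"
    unfolding has_integral_real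
  proof (intro allI impI)
    fix e0 :: real assume "e0 > 0"
    \<comment> \<open>One half of \<open>e0\<close> is reserved for the tags in \<open>N\<close>,
      the other for the regular ones; the summand 1 covers the case \<open>a = b\<close>.\<close>
    define e where "e = e0 / (2 * (b - a + 1))"
    have "e > 0" using \<open>e0 > 0\<close> \<open>a \<le> b\<close> by (simp add: e_def)
    have e: "e * (b - a) < e0 / 2"
      using \<open>e0 > 0\<close> \<open>a \<le> b\<close> by (simp add: e_def field_simps)
    obtain \<delta> where "\<delta> > 0" and \<delta>: "\<And>d. d division_of \<Union>d \<Longrightarrow> \<Union>d \<subseteq> {a..b} \<Longrightarrow>
        (\<Sum>k\<in>d. Sup k - Inf k) < \<delta> \<Longrightarrow> (\<Sum>k\<in>d. norm (x (Sup k) - x (Inf k))) < e0 / 2"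
      using ac[unfolded abs_continuous_on_def, rule_format, of "e0 / 2"] \<open>e0 > 0\<close> by auto
    obtain U where U: "open U" "N \<subseteq> U" "U - N \<in> lmeasurable" "emeasure lebesgue (U - N) < ennreal \<delta>"
      using sets_lebesgue_outer_open[of N \<delta>] negN \<open>\<delta> > 0\<close> negligible_imp_sets by metis
    have UL: "U \<in> lmeasurable"
      using U negN by (metis Diff_partition Un_Diff_cancel Un_absorb1 fmeasurable.Un negligible_imp_measurable)
    have "measure lebesgue U = measure lebesgue (U - N)"
      using U negN UL by (simp add: measure_Diff_null_set negligible_iff_null_sets fmeasurableD)
    also have "\<dots> < \<delta>"
      using U by (metis emeasure_eq_measure2 ennreal_less_iff measure_nonneg)
    finally have mU: "measure lebesgue U < \<delta>" .
    have "\<forall>t. \<exists>r>0. (t \<in> N \<longrightarrow> ball t r \<subseteq> U) \<and>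
         (t \<in> {a..b} - N \<longrightarrow> (\<forall>y\<in>{a..b}. norm (y-t) < r \<longrightarrow> norm (x y - x t - (y-t) *\<^sub>R g t) \<le> e * norm (y-t)))"
    proof
      fix t show "\<exists>r>0. (t \<in> N \<longrightarrow> ball t r \<subseteq> U) \<and>
         (t \<in> {a..b} - N \<longrightarrow> (\<forall>y\<in>{a..b}. norm (y-t) < r \<longrightarrow> norm (x y - x t - (y-t) *\<^sub>R g t) \<le> e * norm (y-t)))"
      proof (cases "t \<in> {a..b} - N")
        case True
        then have "(x has_vector_derivative g t) (at t within {a..b})" by (auto simp: N_def)
        then show ?thesis using True \<open>e > 0\<close>
          unfolding has_vector_derivative_def has_derivative_within_alt by auto
      next
        case False
        show ?thesis
        proof (cases "t \<in> N")
          case True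
          then obtain r where "r > 0" "ball t r \<subseteq> U" using U openE by blast
          then show ?thesis using True by blast
        next
          case F: False then show ?thesis using False by (intro exI[of _ 1]) auto
        qed
      qed
    qed
    then obtain r where r: "\<And>t. r t > 0" "\<And>t. t \<in> N \<Longrightarrow> ball t (r t) \<subseteq> U"
      "\<And>t y. t \<in> {a..b} - N \<Longrightarrow> y \<in> {a..b} \<Longrightarrow> norm (y-t) < r t \<Longrightarrow>
         norm (x y - x t - (y-t) *\<^sub>R g t) \<le> e * norm (y-t)"
      by metis
    show "\<exists>\<gamma>. gauge \<gamma> \<and> (\<forall>\<D>. \<D> tagged_division_of {a..b} \<and> \<gamma> fine \<D> \<longrightarrow>
        norm (sum (\<lambda>(x,k). measure lborel k *\<^sub>R g0 x) \<D> - (x b - x a)) < e0)"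
    proof (intro exI[of _ "\<lambda>t. ball t (r t)"] conjI allI impI)
      show "gauge (\<lambda>t. ball t (r t))" using r(1) gauge_ball_dependent by blast
      fix p assume p: "p tagged_division_of {a..b} \<and> (\<lambda>t. ball t (r t)) fine p"
      have finp: "finite p" using p by auto
      define p1 where "p1 = {z\<in>p. fst z \<in> N}"
      define p2 where "p2 = {z\<in>p. fst z \<notin> N}"
      have split: "p = p1 \<union> p2" "p1 \<inter> p2 = {}" by (auto simp: p1_def p2_def)
      have fin: "finite p1" "finite p2" using finp by (auto simp: p1_def p2_def)
      have K: "\<exists>u v. K = {u..v} \<and> u \<le> t \<and> t \<le> v \<and> a \<le> u \<and> v \<le> b \<and> {u..v} \<subseteq> ball t (r t)"
        if tK: "(t, K) \<in> p" for t K
      proof -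
        have pt: "p tagged_division_of {a..b}" and "K \<subseteq> ball t (r t)"
          using p tK by (auto dest: fineD)
        moreover obtain u v where uv: "K = {u..v}"
          using tagged_division_ofD(4)[OF pt tK] by (metis box_real(2))
        moreover have tK: "t \<in> K" "K \<subseteq> {a..b}"
          using tagged_division_ofD(2,3)[OF pt tK] by blast+
        ultimately show ?thesis
          by (intro exI[of _ u] exI[of _ v]) (simp add: atLeastatMost_subset_iff)
      qed
      have "(\<Sum>(t,K)\<in>p. x (Sup K) - x (Inf K)) = x b - x a"
        using p \<open>a \<le> b\<close> by (intro additive_tagged_division_1) auto
      then have "sum (\<lambda>(x,k). measure lborel k *\<^sub>R g0 x) p - (x b - x a)
        = (\<Sum>(t,K)\<in>p. measure lborel K *\<^sub>R g0 t - (x (Sup K) - x (Inf K)))"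
        by (simp add: sum_subtractf split_def)
      then have "norm (sum (\<lambda>(x,k). measure lborel k *\<^sub>R g0 x) p - (x b - x a))
         \<le> (\<Sum>(t,K)\<in>p. norm (measure lborel K *\<^sub>R g0 t - (x (Sup K) - x (Inf K))))"
        by (simp add: split_def norm_sum)
      also have "\<dots> = (\<Sum>(t,K)\<in>p1. norm (measure lborel K *\<^sub>R g0 t - (x (Sup K) - x (Inf K))))
        + (\<Sum>(t,K)\<in>p2. norm (measure lborel K *\<^sub>R g0 t - (x (Sup K) - x (Inf K))))"
        unfolding split(1) by (rule sum.union_disjoint[OF fin split(2)])
      also have "(\<Sum>(t,K)\<in>p1. norm (measure lborel K *\<^sub>R g0 t - (x (Sup K) - x (Inf K)))) < e0 / 2"
      proof -
        let ?d = "snd ` p1"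
        have tp: "p1 tagged_partial_division_of {a..b}"
        proof (rule tagged_partial_division_subset)
          show "p tagged_partial_division_of {a..b}" using p unfolding tagged_division_of_def by (rule conjunct1[OF conjunct1])
          show "p1 \<subseteq> p" unfolding p1_def by (rule Collect_restrict)
        qed
        have dd: "?d division_of \<Union>?d" by (rule partial_division_of_tagged_division[OF tp])
        \<comment> \<open>The rewriting from tagged intervals to plain ones asks for a function that
          vanishes on degenerate boxes. These include the empty one, for which \<open>Sup\<close>
          and \<open>Inf\<close> carry no information.\<close>
        let ?h = "\<lambda>K. if K = {} then 0 else norm (x (Sup K) - x (Inf K))"
        have "(\<Sum>(t,K)\<in>p1. norm (measure lborel K *\<^sub>R g0 t - (x (Sup K) - x (Inf K))))
          = (\<Sum>(t,K)\<in>p1. ?h K)"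
        proof (rule sum.cong[OF refl], clarify)
          fix t K assume tK: "(t, K) \<in> p1"
          have "K \<noteq> {}" using tagged_partial_division_ofD(2)[OF tp tK] by blast
          moreover have "g0 t = 0" using tK by (simp add: p1_def g0_def)
          ultimately
          show "norm (measure lborel K *\<^sub>R g0 t - (x (Sup K) - x (Inf K))) = ?h K"
            by (simp add: norm_minus_commute)
        qed
        also have "\<dots> = (\<Sum>K\<in>?d. ?h K)"
        proof (rule sum.over_tagged_division_lemma[OF tagged_partial_division_of_Union_self[OF tp]])
          fix u v :: real assume "box u v = {}"
          then have "v \<le> u" by auto
          then show "?h (cbox u v) = 0"
            by (cases "v = u") auto
        qed
        also have "\<dots> = (\<Sum>K\<in>?d. norm (x (Sup K) - x (Inf K)))"
          using division_ofD(3)[OF dd] by (intro sum.cong) auto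
        also have "\<dots> < e0 / 2"
        proof (rule \<delta>[OF dd])
          show "\<Union>?d \<subseteq> {a..b}"
          proof (rule Union_least)
            fix K assume "K \<in> ?d"
            then obtain t where "(t, K) \<in> p1" by force
            then show "K \<subseteq> {a..b}" by (rule tagged_partial_division_ofD(3)[OF tp])
          qed
          have "\<Union>?d \<subseteq> U"
          proof
            fix y assume "y \<in> \<Union>?d"
            then obtain t K where "(t, K) \<in> p" "t \<in> N" "y \<in> K" by (auto simp: p1_def)
            then show "y \<in> U" using K[of t K] r(2)[of t] by blast
          qed
          then have "(\<Sum>k\<in>?d. Sup k - Inf k) \<le> measure lebesgue U"
            by (rule sum_content_division_le[OF dd _ UL])
          then show "(\<Sum>k\<in>?d. Sup k - Inf k) < \<delta>" using mU by linarith
        qed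
        finally show ?thesis .
      qed
      also have "(\<Sum>(t,K)\<in>p2. norm (measure lborel K *\<^sub>R g0 t - (x (Sup K) - x (Inf K)))) \<le> (\<Sum>(t,K)\<in>p2. e * measure lborel K)"
      proof (rule sum_mono, clarify)
        fix t K assume tK: "(t, K) \<in> p2"
        then obtain u v where uv: "K = {u..v}" "u \<le> t" "t \<le> v" "a \<le> u" "v \<le> b" "{u..v} \<subseteq> ball t (r t)"
          using K[of t K] by (auto simp: p2_def)
        have t: "t \<in> {a..b} - N" "g0 t = g t" using tK uv by (auto simp: p2_def g0_def)
        have "u \<in> {u..v}" "v \<in> {u..v}" using uv(2,3) by auto
        then have in_ball: "u \<in> ball t (r t)" "v \<in> ball t (r t)" using uv(6) by blast+
        \<comment> \<open>Since the tag lies between \<open>u\<close> and \<open>v\<close>, the two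
          one-sided errors are measured over lengths that add up to the length of the
          interval.\<close>
        have "norm (measure lborel K *\<^sub>R g0 t - (x (Sup K) - x (Inf K))) = 
          norm ((x u - x t - (u - t) *\<^sub>R g t) - (x v - x t - (v - t) *\<^sub>R g t))"
          using uv t by (simp add: algebra_simps)
        also have "\<dots> \<le> norm (x u - x t - (u - t) *\<^sub>R g t) + norm (x v - x t - (v - t) *\<^sub>R g t)"
          by (rule norm_triangle_ineq4)
        also have "\<dots> \<le> e * norm (u - t) + e * norm (v - t)"
          using in_ball uv t by (intro add_mono r(3)) (auto simp: dist_norm norm_minus_commute)
        also have "\<dots> = e * measure lborel K" using uv by (simp add: algebra_simps)
        finally show "norm (measure lborel K *\<^sub>R g0 t - (x (Sup K) - x (Inf K))) \<le> e * measure lborel K" .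
      qed
      also have "(\<Sum>(t,K)\<in>p2. e * measure lborel K) \<le> (\<Sum>(t,K)\<in>p. e * measure lborel K)"
        using finp \<open>e > 0\<close> by (intro sum_mono2) (auto simp: p2_def split_def)
      also have "\<dots> = e * (b - a)"
        using additive_content_tagged_division[of p a b] p \<open>a \<le> b\<close>
        by (simp add: split_def sum_distrib_left[symmetric])
      finally show "norm (sum (\<lambda>(x,k). measure lborel k *\<^sub>R g0 x) p - (x b - x a)) < e0"
        using e by linarith
    qed
  qed
  from has_integral_spike[OF negN _ this, of g] show ?thesis
    by (auto simp: g0_def)
qed

lemma has_integral_primitive_diff:
  fixes g :: "real \<Rightarrow> 'a::euclidean_space"
  assumes g: "g integrable_on {a..b}" and st: "a \<le> s" "s \<le> t" "t \<le> b"
  shows "(g has_integral (integral {a..t} g - integral {a..s} g)) {s..t}"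
proof -
  have "integral {a..s} g + integral {s..t} g = integral {a..t} g"
    using st by (intro Henstock_Kurzweil_Integration.integral_combine integrable_on_subinterval[OF g]) auto
  moreover have "g integrable_on {s..t}" using st by (intro integrable_on_subinterval[OF g]) auto
  ultimately show ?thesis by (metis add_diff_cancel_left' integrable_integral)
qed

section \<open>Differentiation of indefinite integrals almost everywhere\<close>

text \<open>For fixed \<open>e\<close>, each point of \<open>B e\<close> is an end of arbitrarily
  short intervals on which the increment of the integral misses the linear prediction by more than
  \<open>e\<close> times the length. Vitali's theorem selects disjoint ones covering almost all of
  \<open>B e\<close>, and Henstock's lemma makes the sum of the errors, hence the total length,
  arbitrarily small.\<close>

lemma integral_has_vector_derivative_AE:
  fixes g :: "real \<Rightarrow> 'a::euclidean_space"
  assumes g: "g integrable_on {a..b}"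
  shows "AE t in lebesgue_on {a..b}.
    ((\<lambda>t. integral {a..t} g) has_vector_derivative g t) (at t within {a..b})"
proof -
  define G where "G = (\<lambda>t. integral {a..t} g)"
  define D where "D = (\<lambda>t y. norm (G y - G t - (y - t) *\<^sub>R g t))"
  define B where "B = (\<lambda>e. {t\<in>{a..b}. \<forall>d>0. \<exists>y\<in>{a..b}. y \<noteq> t \<and> \<bar>y - t\<bar> < d \<and> D t y > e * \<bar>y - t\<bar>})"
  \<comment> \<open>The error at \<open>t\<close> is Henstock's error for the interval between
    \<open>t\<close> and \<open>y\<close> tagged at its end \<open>t\<close>, whichever side
    \<open>y\<close> lies on.\<close>
  have D_eq: "D t y = norm ((max t y - min t y) *\<^sub>R g t - integral {min t y..max t y} g)"
    if "t \<in> {a..b}" "y \<in> {a..b}" for t y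
  proof -
    have G: "G v - G u = integral {u..v} g" if "a \<le> u" "u \<le> v" "v \<le> b" for u v
      unfolding G_def by (rule integral_unique[OF has_integral_primitive_diff[OF g that], symmetric])
    then show ?thesis
    proof (cases "t \<le> y")
      case True
      then have "integral {t..y} g = G y - G t" using G[of t y] that by auto
      then show ?thesis using True by (simp add: D_def norm_minus_commute)
    next
      case False
      then have "integral {y..t} g = G t - G y" using G[of y t] that by auto
      then have "(t - y) *\<^sub>R g t - integral {y..t} g = G y - G t - (y - t) *\<^sub>R g t" 
        by (simp add: algebra_simps)
      then show ?thesis using False by (simp add: D_def min_absorb2 max_absorb1)
    qed
  qed
  have negB: "negligible (B e)" if "e > 0" for e
    unfolding negligible_outer_le
  proof (intro allI impI)
    fix h :: real assume "h > 0"
    \<comment> \<open>Each selected interval has error above \<open>e\<close> times its length, so a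
      total error below \<open>e * h\<close> forces a total length below \<open>h\<close>.\<close>
    then have "e * h > 0" using \<open>e > 0\<close> by simp
    then obtain \<gamma> where "gauge \<gamma>" and \<gamma>: "\<And>p. p tagged_partial_division_of {a..b} \<Longrightarrow> \<gamma> fine p \<Longrightarrow>
             sum (\<lambda>(x,k). norm (measure lborel k *\<^sub>R g x - integral k g)) p < e * h"
      using Henstock_lemma[of g a b "e * h"] g by auto
    \<comment> \<open>Intervals are indexed by their tag and their other end. Fineness is part of
      the membership condition, so every finite disjoint subfamily is admissible in Henstock's
      lemma.\<close>
    define K where "K = {(t, y). t \<in> {a..b} \<and> y \<in> {a..b} \<and> y \<noteq> t \<and> D t y > e * \<bar>y - t\<bar> \<and>
        {min t y..max t y} \<subseteq> \<gamma> t}"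
    define c where "c = (\<lambda>(t, y). (t + y) / (2::real))"
    define r where "r = (\<lambda>(t, y). \<bar>y - t\<bar> / (2::real))"
    have cb: "cball (c (t, y)) (r (t, y)) = {min t y..max t y}" for t y
    proof (cases "t \<le> y")
      case True
      then show ?thesis by (simp add: c_def r_def cball_eq_atLeastAtMost add_divide_distrib diff_divide_distrib)
    next
      case False
      then show ?thesis by (simp add: c_def r_def cball_eq_atLeastAtMost add_divide_distrib diff_divide_distrib
            min_absorb2 max_absorb1)
    qed
    have "\<exists>C. countable C \<and> C \<subseteq> K \<and>
        pairwise (\<lambda>i j. disjnt (cball (c i) (r i)) (cball (c j) (r j))) C \<and>
        negligible (B e - (\<Union>i\<in>C. cball (c i) (r i)))"
    proof (rule Vitali_covering_theorem_cballs[of K r "B e" c])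
      show "0 < r i" if "i \<in> K" for i using that by (auto simp: K_def r_def)
      fix t d :: real assume t: "t \<in> B e" and "d > 0"
      have "open (\<gamma> t)" "t \<in> \<gamma> t" using \<open>gauge \<gamma>\<close> by (auto simp: gauge_def)
      then obtain d' where "d' > 0" and d': "ball t d' \<subseteq> \<gamma> t" using openE by blast
      have "\<forall>d>0. \<exists>y\<in>{a..b}. y \<noteq> t \<and> \<bar>y - t\<bar> < d \<and> D t y > e * \<bar>y - t\<bar>"
        using t unfolding B_def by blast
      moreover have "min d d' > 0" using \<open>d > 0\<close> \<open>d' > 0\<close> by simp
      ultimately obtain y where y: "y \<in> {a..b}" "y \<noteq> t" "\<bar>y - t\<bar> < min d d'" "D t y > e * \<bar>y - t\<bar>"
        by blast
      have "{min t y..max t y} \<subseteq> ball t d'" using y by (auto simp: dist_real_def)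
      then have "(t, y) \<in> K" using y t d' by (auto simp: K_def B_def)
      moreover have "t \<in> cball (c (t, y)) (r (t, y))" by (simp add: cb)
      moreover have "r (t, y) < d" using y by (auto simp: r_def)
      ultimately show "\<exists>i. i \<in> K \<and> t \<in> cball (c i) (r i) \<and> r i < d" by blast
    qed blast
    then obtain C where C: "countable C" "C \<subseteq> K"
        "pairwise (\<lambda>i j. disjnt (cball (c i) (r i)) (cball (c j) (r j))) C"
        "negligible (B e - (\<Union>i\<in>C. cball (c i) (r i)))" by blast
    \<comment> \<open>Henstock's lemma concerns finite partial divisions; a bound common to all
      finite subfamilies carries over to the countable union.\<close>
    have bound: "measure lebesgue (\<Union>i\<in>F. cball (c i) (r i)) \<le> h" if F: "F \<subseteq> C" "finite F" for F
    proof -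
      let ?q = "\<lambda>(t, y). (t, {min t y..max t y})"
      have inj: "inj_on ?q F"
      proof (rule inj_onI)
        fix i j :: "real \<times> real" assume "?q i = ?q j"
        then have "fst i = fst j" "{min (fst i) (snd i)..max (fst i) (snd i)} = {min (fst j) (snd j)..max (fst j) (snd j)}"
          unfolding split_def prod.inject by blast+
        moreover have "min (fst i) (snd i) \<le> max (fst i) (snd i)" by simp
        ultimately have "fst i = fst j" "min (fst i) (snd i) = min (fst j) (snd j)" "max (fst i) (snd i) = max (fst j) (snd j)"
          by (metis Icc_eq_Icc)+
        then show "i = j" unfolding prod_eq_iff by linarith
      qed
      have FK: "F \<subseteq> K" using F C by blast
      have disj: "{min t y..max t y} \<inter> {min t' y'..max t' y'} = {}"
        if "(t, y) \<in> F" "(t', y') \<in> F" "(t, y) \<noteq> (t', y')" for t y t' y'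
        using C(3) that F unfolding pairwise_def disjnt_def by (metis cb subsetD)
      have "?q ` F tagged_partial_division_of {a..b}"
      proof (unfold tagged_partial_division_of_def, intro conjI allI impI)
        show "finite (?q ` F)" using F by simp
      next
        fix t k assume "(t, k) \<in> ?q ` F"
        then obtain z where z: "z \<in> F" "(t, k) = ?q z" by blast
        define y where "y = snd z"
        have ty: "(t, y) \<in> F" "k = {min t y..max t y}"
          using z by (simp_all add: y_def split_def)
        then have "(t, y) \<in> K" using FK by auto
        then show "t \<in> k" "k \<subseteq> {a..b}" using ty by (auto simp: K_def)
        show "\<exists>a b. k = cbox a b" using ty by auto
      next
        fix t1 k1 t2 k2 assume *: "(t1, k1) \<in> ?q ` F \<and> (t2, k2) \<in> ?q ` F \<and> (t1, k1) \<noteq> (t2, k2)"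
        then obtain i j where ij: "i \<in> F" "j \<in> F" "(t1, k1) = ?q i" "(t2, k2) = ?q j" by blast
        then have "i \<noteq> j" using * by metis
        then have "k1 \<inter> k2 = {}"
          using disj[of "fst i" "snd i" "fst j" "snd j"] ij unfolding split_def prod.collapse prod.inject
          by metis
        then show "interior k1 \<inter> interior k2 = {}" using interior_subset by blast
      qed
      moreover have "\<gamma> fine (?q ` F)" using FK by (auto simp: fine_def K_def)
      ultimately have "sum (\<lambda>(x,k). norm (measure lborel k *\<^sub>R g x - integral k g)) (?q ` F) < e * h"
        by (rule \<gamma>)
      also have "sum (\<lambda>(x,k). norm (measure lborel k *\<^sub>R g x - integral k g)) (?q ` F)
        = (\<Sum>(t,y)\<in>F. D t y)"
      proof (rule trans[OF sum.reindex[OF inj]], rule sum.cong[OF refl])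
        fix z assume "z \<in> F"
        then obtain t y where z: "z = (t, y)" "(t, y) \<in> K" using FK by (metis prod.collapse subsetD)
        then have "t \<in> {a..b}" "y \<in> {a..b}" by (auto simp: K_def)
        then show "((\<lambda>(x,k). norm (measure lborel k *\<^sub>R g x - integral k g)) \<circ> ?q) z = (case z of (t, y) \<Rightarrow> D t y)"
          by (simp add: z D_eq)
      qed
      finally have "(\<Sum>(t,y)\<in>F. D t y) < e * h" .
      moreover have "(\<Sum>(t,y)\<in>F. e * \<bar>y - t\<bar>) \<le> (\<Sum>(t,y)\<in>F. D t y)"
        using FK by (intro sum_mono) (auto simp: K_def)
      ultimately have "e * (\<Sum>(t,y)\<in>F. \<bar>y - t\<bar>) < e * h"
        by (simp add: split_def sum_distrib_left)
      then have "(\<Sum>(t,y)\<in>F. \<bar>y - t\<bar>) < h" using \<open>e > 0\<close> by simp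
      moreover have "measure lebesgue (\<Union>i\<in>F. cball (c i) (r i)) \<le> (\<Sum>i\<in>F. measure lebesgue (cball (c i) (r i)))"
        by (rule measure_UNION_le) (use F in auto)
      moreover have "(\<Sum>i\<in>F. measure lebesgue (cball (c i) (r i))) = (\<Sum>(t,y)\<in>F. \<bar>y - t\<bar>)"
        by (intro sum.cong) (auto simp: cb)
      ultimately show ?thesis by linarith
    qed
    have "(\<Union>i\<in>C. cball (c i) (r i)) \<in> lmeasurable \<and> measure lebesgue (\<Union>i\<in>C. cball (c i) (r i)) \<le> h"
      using fmeasurable_UN_bound[OF C(1), of "\<lambda>i. cball (c i) (r i)" lebesgue h]
        measure_UN_bound[OF C(1), of "\<lambda>i. cball (c i) (r i)" lebesgue h] bound by auto
    moreover have "measure lebesgue ((\<Union>i\<in>C. cball (c i) (r i)) \<union> (B e - (\<Union>i\<in>C. cball (c i) (r i))))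
       = measure lebesgue (\<Union>i\<in>C. cball (c i) (r i))"
      using calculation C(4) by (intro measure_Un_null_set) (auto simp: negligible_iff_null_sets fmeasurableD)
    moreover have "(\<Union>i\<in>C. cball (c i) (r i)) \<union> (B e - (\<Union>i\<in>C. cball (c i) (r i))) \<in> lmeasurable"
      using calculation(1) negligible_imp_measurable[OF C(4)] by (blast intro: fmeasurable.Un)
    ultimately show "\<exists>T. B e \<subseteq> T \<and> T \<in> lmeasurable \<and> measure lebesgue T \<le> h"
      by (intro exI[of _ "(\<Union>i\<in>C. cball (c i) (r i)) \<union> (B e - (\<Union>i\<in>C. cball (c i) (r i)))"] conjI)
        (blast, assumption, linarith)
  qed
  have "{t\<in>{a..b}. \<not> (G has_vector_derivative g t) (at t within {a..b})} \<subseteq> (\<Union>n. B (1 / real (Suc n)))"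
  proof (rule subsetI, rule ccontr)
    fix t assume t: "t \<in> {t\<in>{a..b}. \<not> (G has_vector_derivative g t) (at t within {a..b})}"
      and nt: "t \<notin> (\<Union>n. B (1 / real (Suc n)))"
    have "(G has_vector_derivative g t) (at t within {a..b})"
      unfolding has_vector_derivative_def has_derivative_within_alt
    proof (intro conjI allI impI)
      fix e :: real assume "e > 0"
      then obtain n where n: "1 / real (Suc n) < e" using nat_approx_posE by blast
      have "t \<notin> B (1 / real (Suc n))" using nt by blast
      then obtain d where "d > 0" and d: "\<And>y. y \<in> {a..b} \<Longrightarrow> y \<noteq> t \<Longrightarrow> \<bar>y - t\<bar> < d \<Longrightarrow> D t y \<le> 1 / real (Suc n) * \<bar>y - t\<bar>"
        using t unfolding B_def mem_Collect_eq by (metis not_less)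
      show "\<exists>d>0. \<forall>y\<in>{a..b}. norm (y - t) < d \<longrightarrow> norm (G y - G t - (y - t) *\<^sub>R g t) \<le> e * norm (y - t)"
      proof (intro exI[of _ d] conjI ballI impI)
        fix y assume y: "y \<in> {a..b}" "norm (y - t) < d"
        show "norm (G y - G t - (y - t) *\<^sub>R g t) \<le> e * norm (y - t)"
        proof (cases "y = t")
          case False
          then have "D t y \<le> 1 / real (Suc n) * \<bar>y - t\<bar>" using d y by auto
          also have "\<dots> \<le> e * \<bar>y - t\<bar>" using n by (intro mult_right_mono) auto
          finally show ?thesis by (simp add: D_def)
        qed simp
      qed (fact \<open>d > 0\<close>)
    qed (simp add: bounded_linear_scaleR_left)
    then show False using t by simp
  qed
  moreover have "negligible (\<Union>n. B (1 / real (Suc n)))"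
    by (intro negligible_countable_Union) (auto intro!: negB)
  ultimately have "negligible {t\<in>{a..b}. \<not> (G has_vector_derivative g t) (at t within {a..b})}"
    using negligible_subset by blast
  then show ?thesis by (simp add: AE_lebesgue_on_iff_negligible G_def)
qed

section \<open>Lipschitz functions as indefinite integrals\<close>

lemma lipschitz_real_eq_integral:
  fixes F :: "real \<Rightarrow> real"
  assumes lip: "\<And>s t. \<bar>F t - F s\<bar> \<le> L * \<bar>t - s\<bar>" and "a \<le> b"
  shows "\<exists>h. \<forall>t\<in>{a..b}. (h has_integral (F t - F a)) {a..t}"
proof -
  have "L \<ge> 0" using lip[of 1 0] by simp
  define \<Phi> where "\<Phi> = (\<lambda>t. F t + (L + 1) * t)"
  have exp: "t - s \<le> \<Phi> t - \<Phi> s" if "s \<le> t" for s t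
    using lip[of t s] that by (auto simp: \<Phi>_def algebra_simps)
  have \<Phi>_lip: "\<bar>\<Phi> t - \<Phi> s\<bar> \<le> (2 * L + 1) * \<bar>t - s\<bar>" for s t
  proof -
    have "\<Phi> t - \<Phi> s = (F t - F s) + (L + 1) * (t - s)" by (simp add: \<Phi>_def algebra_simps)
    then have "\<bar>\<Phi> t - \<Phi> s\<bar> \<le> \<bar>F t - F s\<bar> + \<bar>(L + 1) * (t - s)\<bar>" by linarith
    also have "\<dots> \<le> L * \<bar>t - s\<bar> + (L + 1) * \<bar>t - s\<bar>"
      using lip[of t s] \<open>L \<ge> 0\<close> by (simp add: abs_mult)
    finally show ?thesis by (simp add: algebra_simps)
  qed
  have cont: "continuous_on S \<Phi>" for S
  proof (rule lipschitz_on_continuous_on)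
    show "(2 * L + 1)-lipschitz_on S \<Phi>"
      using \<Phi>_lip \<open>L \<ge> 0\<close> by (auto simp: lipschitz_on_def dist_real_def)
  qed
  have "strict_mono \<Phi>" by (rule strict_monoI) (use exp in \<open>smt (verit)\<close>)
  then have inj: "inj \<Phi>" by (rule strict_mono_imp_inj_on)
  have surj: "\<exists>t. \<Phi> t = y" for y
  proof -
    define R where "R = \<bar>y - \<Phi> 0\<bar>"
    have "\<Phi> (- R) \<le> y" "y \<le> \<Phi> R" using exp[of "-R" 0] exp[of 0 R] by (auto simp: R_def)
    moreover have "-R \<le> R" by (simp add: R_def)
    ultimately show ?thesis using IVT'[of \<Phi> "-R" y R] cont by blast
  qed
  define g where "g = inv \<Phi>"
  have \<Phi>g: "\<Phi> (g y) = y" for y using surj unfolding g_def by (metis f_inv_into_f rangeI)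
  have g\<Phi>: "g (\<Phi> t) = t" for t unfolding g_def using inj by simp
  have g_lip: "\<bar>g y - g z\<bar> \<le> \<bar>y - z\<bar>" for y z
    using exp[of "g y" "g z"] exp[of "g z" "g y"] by (cases "g y \<le> g z") (auto simp: \<Phi>g)
  have "continuous_on UNIV g"
    by (rule lipschitz_on_continuous_on[of 1]) (use g_lip in \<open>auto simp: lipschitz_on_def dist_real_def\<close>)
  then have g_meas[measurable]: "g \<in> borel_measurable borel" by (rule borel_measurable_continuous_onI)
  have vimage: "g -` A = \<Phi> ` A" for A
  proof (intro set_eqI iffI)
    fix y assume "y \<in> g -` A"
    then show "y \<in> \<Phi> ` A" by (metis \<Phi>g imageI vimageD)
  qed (auto simp: g\<Phi>)
  define N where "N = distr lborel borel g"
  have emN: "emeasure N A = emeasure lborel (\<Phi> ` A)" if "A \<in> sets borel" for A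
    using that by (simp add: N_def emeasure_distr vimage)
  have "absolutely_continuous lborel N"
    unfolding absolutely_continuous_def
  proof
    fix A assume A: "A \<in> null_sets (lborel :: real measure)"
    then have bor: "A \<in> sets borel" by auto
    have "negligible A" using A by (simp add: negligible_iff_null_sets null_sets_completionI)
    then have "negligible (\<Phi> ` A)"
    proof (rule negligible_locally_Lipschitz_image[OF order_refl])
      fix x assume "x \<in> A"
      show "\<exists>T B. open T \<and> x \<in> T \<and> (\<forall>y \<in> A \<inter> T. norm(\<Phi> y - \<Phi> x) \<le> B * norm(y - x))"
        using \<Phi>_lip by (intro exI[of _ UNIV] exI[of _ "2 * L + 1"]) auto
    qed
    moreover have "\<Phi> ` A \<in> sets borel" using bor unfolding vimage[symmetric]
      using measurable_sets[OF g_meas bor] by simp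
    ultimately have "emeasure lborel (\<Phi> ` A) = 0"
      by (simp add: negligible_iff_null_sets null_sets_def emeasure_completion)
    then show "A \<in> null_sets N" using bor emN by (auto simp: null_sets_def N_def)
  qed
  then obtain k where k[measurable]: "k \<in> borel_measurable lborel" and dens: "density lborel k = N"
    using sigma_finite_measure.Radon_Nikodym[OF sigma_finite_lborel, of N] by (auto simp: N_def)
  have int: "(\<integral>\<^sup>+x. k x * indicator {a..t} x \<partial>lborel) = ennreal (\<Phi> t - \<Phi> a)" if "a \<le> t" for t
  proof -
    have "\<Phi> ` {a..t} = {\<Phi> a..\<Phi> t}"
    proof
      show "\<Phi> ` {a..t} \<subseteq> {\<Phi> a..\<Phi> t}" using exp by fastforce
      show "{\<Phi> a..\<Phi> t} \<subseteq> \<Phi> ` {a..t}"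
      proof
        fix y assume "y \<in> {\<Phi> a..\<Phi> t}"
        then show "y \<in> \<Phi> ` {a..t}" using IVT'[of \<Phi> a y t] cont that by auto
      qed
    qed
    then have "emeasure N {a..t} = ennreal (\<Phi> t - \<Phi> a)"
      using emN[of "{a..t}"] exp[of a t] that by simp
    then show ?thesis unfolding dens[symmetric] by (subst (asm) emeasure_density) auto
  qed
  \<comment> \<open>The density is extended-real valued. It is finite almost everywhere on
    \<open>{a..b}\<close> because that interval has finite mass, so passing to reals alters it only
    on a null set.\<close>
  define h where "h = (\<lambda>x. enn2real (k x) * indicator {a..b} x)"
  have h_meas: "h \<in> borel_measurable borel" unfolding h_def using k by simp
  have fin: "AE x in lborel. k x * indicator {a..b} x \<noteq> \<infinity>"
    by (rule nn_integral_PInf_AE) (use int[OF \<open>a \<le> b\<close>] in auto)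
  show ?thesis
  proof (intro exI[of _ "\<lambda>x. h x - (L + 1)"] ballI)
    fix t assume t: "t \<in> {a..b}"
    have "(\<integral>\<^sup>+x. ennreal (h x * indicator {a..t} x) \<partial>lborel) = (\<integral>\<^sup>+x. k x * indicator {a..t} x \<partial>lborel)"
      by (rule nn_integral_cong_AE, use fin in eventually_elim)
        (use t in \<open>auto simp: h_def indicator_def ennreal_enn2real_if split: if_splits\<close>)
    also have "\<dots> = ennreal (\<Phi> t - \<Phi> a)" using int t by auto
    finally have "((\<lambda>x. h x * indicator {a..t} x) has_integral (\<Phi> t - \<Phi> a)) UNIV"
      using h_meas exp[of a t] t by (intro nn_integral_has_integral) (auto simp: h_def)
    moreover have "(\<lambda>x. h x * indicator {a..t} x) = (\<lambda>x. if x \<in> {a..t} then h x else 0)"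
      by (auto simp: indicator_def)
    ultimately have "(h has_integral (\<Phi> t - \<Phi> a)) {a..t}"
      by (simp only: has_integral_restrict_UNIV)
    from has_integral_diff[OF this has_integral_const_real[of "L + 1" a t]]
    show "((\<lambda>x. h x - (L + 1)) has_integral (F t - F a)) {a..t}"
      using t by (simp add: \<Phi>_def algebra_simps)
  qed
qed

lemma lipschitz_eq_integral:
  fixes x :: "real \<Rightarrow> 'a::euclidean_space"
  assumes lip: "\<And>s t. s \<in> {a..b} \<Longrightarrow> t \<in> {a..b} \<Longrightarrow> norm (x t - x s) \<le> L * \<bar>t - s\<bar>" and "a \<le> b"
  obtains g where "\<And>t. t \<in> {a..b} \<Longrightarrow> (g has_integral (x t - x a)) {a..t}"
proof -
  \<comment> \<open>Clamping the time extends \<open>x\<close> to the whole line with the same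
    Lipschitz constant, as the scalar result requires.\<close>
  define c where "c = (\<lambda>t. max a (min b t))"
  have c: "c t \<in> {a..b}" "\<bar>c t - c s\<bar> \<le> \<bar>t - s\<bar>" "t \<in> {a..b} \<Longrightarrow> c t = t" for s t
    using \<open>a \<le> b\<close> by (auto simp: c_def)
  have "\<exists>h. \<forall>t\<in>{a..b}. (h has_integral (x (c t) \<bullet> i - x (c a) \<bullet> i)) {a..t}" if "i \<in> Basis" for i
  proof (rule lipschitz_real_eq_integral[OF _ \<open>a \<le> b\<close>, where L = "\<bar>L\<bar>"])
    fix s t
    have "\<bar>x (c t) \<bullet> i - x (c s) \<bullet> i\<bar> \<le> norm (x (c t) - x (c s))"
      using Basis_le_norm[OF that, of "x (c t) - x (c s)"] by (simp add: inner_diff_left)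
    also have "\<dots> \<le> L * \<bar>c t - c s\<bar>" using lip c by auto
    also have "\<dots> \<le> \<bar>L\<bar> * \<bar>t - s\<bar>" using c(2)[of t s] by (intro mult_mono) auto
    finally show "\<bar>x (c t) \<bullet> i - x (c s) \<bullet> i\<bar> \<le> \<bar>L\<bar> * \<bar>t - s\<bar>" .
  qed
  then obtain h where h: "\<And>i t. i \<in> Basis \<Longrightarrow> t \<in> {a..b} \<Longrightarrow> (h i has_integral (x (c t) \<bullet> i - x (c a) \<bullet> i)) {a..t}"
    by metis
  define g where "g = (\<lambda>t. \<Sum>i\<in>Basis. h i t *\<^sub>R i)"
  show thesis
  proof (rule that[of g])
    fix t assume t: "t \<in> {a..b}"
    show "(g has_integral (x t - x a)) {a..t}"
      unfolding has_integral_componentwise_iff[of g]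
    proof
      fix i :: 'a assume i: "i \<in> Basis"
      have "(\<lambda>t. g t \<bullet> i) = h i" using i by (auto simp: g_def)
      then show "((\<lambda>t. g t \<bullet> i) has_integral (x t - x a) \<bullet> i) {a..t}"
        using h[OF i t] c(3) t \<open>a \<le> b\<close> by (simp add: inner_diff_left)
    qed
  qed
qed

section \<open>Gronwall's inequality\<close>

lemma exp_has_integral:
  fixes L :: real
  assumes "L > 0" "a \<le> s"
  shows "((\<lambda>t. exp (L * (t - a))) has_integral (exp (L * (s - a)) - 1) / L) {a..s}"
proof -
  have "((\<lambda>t. exp (L * (t - a))) has_integral (exp (L * (s - a)) / L - exp (L * (a - a)) / L)) {a..s}"
  proof (rule fundamental_theorem_of_calculus[OF \<open>a \<le> s\<close>])
    show "((\<lambda>t. exp (L * (t - a)) / L) has_vector_derivative exp (L * (t - a))) (at t within {a..s})" for t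
      unfolding has_real_derivative_iff_has_vector_derivative[symmetric]
      using \<open>L > 0\<close> by (auto intro!: derivative_eq_intros)
  qed
  then show ?thesis by (simp add: diff_divide_distrib)
qed

text \<open>Comparing \<open>\<phi>\<close> with a multiple of \<open>exp (2 * L * (t - a))\<close> at the maximum of the quotient
  costs only a factor \<open>2\<close>.\<close>

lemma gronwall:
  fixes \<phi> :: "real \<Rightarrow> real"
  assumes cont: "continuous_on {a..b} \<phi>" and "L > 0" and "A \<ge> 0"
    and le: "\<And>t. t \<in> {a..b} \<Longrightarrow> \<phi> t \<le> A + L * integral {a..t} \<phi>"
    and t: "t \<in> {a..b}"
  shows "\<phi> t \<le> 2 * A * exp (2 * L * (t - a))"
proof -
  define w where "w = (\<lambda>t. exp (2 * L * (t - a)))"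
  have "continuous_on {a..b} (\<lambda>t. \<phi> t / w t)"
    unfolding w_def by (intro continuous_intros cont) auto
  then obtain s where s: "s \<in> {a..b}" and max: "\<And>t. t \<in> {a..b} \<Longrightarrow> \<phi> t / w t \<le> \<phi> s / w s"
    using continuous_attains_sup[of "{a..b}" "\<lambda>t. \<phi> t / w t"] t by auto
  define M where "M = \<phi> s / w s"
  have wpos: "w t > 0" for t by (simp add: w_def)
  have \<phi>_le: "\<phi> t \<le> M * w t" if "t \<in> {a..b}" for t
    using max[OF that] wpos[of t] by (simp add: M_def pos_divide_le_eq)
  have "M \<le> 2 * A"
  proof (cases "M \<le> 0")
    case False
    have "(w has_integral (w s - 1) / (2 * L)) {a..s}"
      unfolding w_def using \<open>L > 0\<close> s by (intro exp_has_integral) auto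
    then have wint: "w integrable_on {a..s}" "integral {a..s} w = (w s - 1) / (2 * L)"
      by (auto simp: integral_unique)
    have "\<phi> s \<le> A + L * integral {a..s} \<phi>" by (rule le[OF s])
    also have "integral {a..s} \<phi> \<le> integral {a..s} (\<lambda>t. M * w t)"
    proof (rule integral_le)
      show "\<phi> integrable_on {a..s}"
        by (rule integrable_continuous_interval) (use cont s in \<open>auto elim: continuous_on_subset\<close>)
      show "(\<lambda>t. M * w t) integrable_on {a..s}" using wint by (intro integrable_on_mult_right)
    qed (use \<phi>_le s in auto)
    also have "integral {a..s} (\<lambda>t. M * w t) = M * ((w s - 1) / (2 * L))" using wint by simp
    \<comment> \<open>The rate \<open>2 * L\<close> in \<open>w\<close> is chosen for this line:
      integration divides by \<open>2 * L\<close>, only half of \<open>M * w s\<close> is left on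
      the right, and it can be absorbed.\<close>
    finally have "\<phi> s \<le> A + M * (w s - 1) / 2" using \<open>L > 0\<close> by simp
    moreover have "\<phi> s = M * w s" using wpos[of s] by (simp add: M_def)
    moreover have "M * (w s - 1) = M * w s - M" by (simp add: algebra_simps)
    ultimately have "M * w s \<le> 2 * A - M" by linarith
    moreover have "M * 1 \<le> M * w s" 
      using False s \<open>L > 0\<close> by (intro mult_left_mono) (auto simp: w_def)
    ultimately show ?thesis using \<open>A \<ge> 0\<close> by linarith
  qed (use \<open>A \<ge> 0\<close> in linarith)
  then have "M * w t \<le> 2 * A * w t" using wpos[of t] by (intro mult_right_mono) auto
  with \<phi>_le[OF t] have "\<phi> t \<le> 2 * A * w t" by linarith
  then show ?thesis by (simp add: w_def)
qed

lemma gronwall_norm: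
  fixes y h :: "real \<Rightarrow> 'a::euclidean_space"
  assumes y: "continuous_on {a..b} y" and "L > 0" "A \<ge> 0"
    and h: "\<And>t. t \<in> {a..b} \<Longrightarrow> (h has_integral (y t - y a)) {a..t}"
    and le: "\<And>t. t \<in> {a..b} \<Longrightarrow> norm (h t) \<le> A + L * norm (y t)"
    and t: "t \<in> {a..b}"
  shows "norm (y t) \<le> 2 * (norm (y a) + A * (b - a)) * exp (2 * L * (b - a))"
proof -
  have cont: "continuous_on {a..b} (\<lambda>t. norm (y t))" by (intro continuous_intros y)
  have nonneg: "norm (y a) + A * (b - a) \<ge> 0" using \<open>A \<ge> 0\<close> t by auto
  have "norm (y t) \<le> 2 * (norm (y a) + A * (b - a)) * exp (2 * L * (t - a))"
  proof (rule gronwall[OF cont \<open>L > 0\<close> nonneg _ t])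
    fix t assume t: "t \<in> {a..b}"
    have int: "(\<lambda>s. norm (y s)) integrable_on {a..t}"
      by (rule integrable_continuous_interval) (use cont t in \<open>auto elim: continuous_on_subset\<close>)
    have "norm (y t - y a) \<le> integral {a..t} (\<lambda>s. A + L * norm (y s))"
      unfolding integral_unique[OF h[OF t], symmetric]
      by (intro integral_norm_bound_integral integrable_add integrable_on_mult_right int le)
        (use h[OF t] t in auto)
    also have "\<dots> = A * (t - a) + L * integral {a..t} (\<lambda>s. norm (y s))"
      using t by (subst Henstock_Kurzweil_Integration.integral_add)
        (auto intro!: integrable_on_mult_right int)
    also have "A * (t - a) \<le> A * (b - a)" using \<open>A \<ge> 0\<close> t by (intro mult_left_mono) auto
    finally show "norm (y t) \<le> norm (y a) + A * (b - a) + L * integral {a..t} (\<lambda>s. norm (y s))"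
      using norm_triangle_sub[of "y t" "y a"] by simp
  qed
  also have "\<dots> \<le> 2 * (norm (y a) + A * (b - a)) * exp (2 * L * (b - a))"
    using t \<open>L > 0\<close> nonneg by (intro mult_left_mono) auto
  finally show ?thesis .
qed

section \<open>Bounded measurable integrands and Caratheodory equations\<close>

lemma measurable_compose_continuous_on:
  assumes "continuous_on S F" "S \<in> sets borel" "h \<in> borel_measurable M"
    and "\<And>t. t \<in> space M \<Longrightarrow> h t \<in> S"
  shows "(\<lambda>t. F (h t)) \<in> borel_measurable M"
proof -
  have "h \<in> measurable M (restrict_space borel S)"
    using assms(3,4) by (intro measurable_restrict_space2) auto
  then show ?thesis
    by (rule measurable_compose[OF _ borel_measurable_continuous_on_restrict[OF assms(1)]])
qed

text \<open>Henstock-Kurzweil integrals serve the calculus, Bochner integrals the definition of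
  \<open>cost\<close>; bounded measurable integrands allow switching between them.\<close>

lemma bounded_measurable_integrable:
  fixes g :: "real \<Rightarrow> 'a::euclidean_space"
  assumes "g \<in> borel_measurable (lebesgue_on {a..b})" "\<And>t. t \<in> {a..b} \<Longrightarrow> norm (g t) \<le> M"
  shows "g absolutely_integrable_on {a..b}" "g integrable_on {a..b}" "integrable (lebesgue_on {a..b}) g"
proof -
  show abs: "g absolutely_integrable_on {a..b}"
    using assms by (intro measurable_bounded_by_integrable_imp_absolutely_integrable[of g _ "\<lambda>_. M"]) auto
  then show "g integrable_on {a..b}" by (rule set_lebesgue_integral_eq_integral(1))
  show "integrable (lebesgue_on {a..b}) g"
    using abs by (simp add: absolutely_integrable_imp_integrable)
qed

lemma continuous_on_Icc_bounded:
  fixes y :: "real \<Rightarrow> 'a::real_normed_vector"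
  assumes "continuous_on {a..b} y"
  obtains B where "\<And>t. t \<in> {a..b} \<Longrightarrow> norm (y t) \<le> B"
proof -
  have "bounded (y ` {a..b})"
    by (intro compact_imp_bounded compact_continuous_image[OF assms]) simp
  then show thesis using that unfolding bounded_iff by blast
qed

text \<open>With the weight \<open>w\<close> of rate \<open>2 * L\<close> as in Gronwall's
  inequality, Picard's operator for \<open>x / w\<close> contracts by the factor 1/2 on the whole
  interval, so no short intervals have to be glued together.\<close>

lemma caratheodory_existence:
  fixes g :: "real \<Rightarrow> 'a::euclidean_space \<Rightarrow> 'a"
  assumes "a \<le> b" "L > 0"
    and meas: "\<And>y. continuous_on {a..b} y \<Longrightarrow> (\<lambda>t. g t (y t)) \<in> borel_measurable (lebesgue_on {a..b})"
    and lip: "\<And>t y z. t \<in> {a..b} \<Longrightarrow> norm (g t y - g t z) \<le> L * norm (y - z)"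
    and bound: "\<And>t. t \<in> {a..b} \<Longrightarrow> norm (g t 0) \<le> M"
  obtains x where "continuous_on {a..b} x"
    "\<And>t. t \<in> {a..b} \<Longrightarrow> x t = x0 + integral {a..t} (\<lambda>s. g s (x s))"
proof -
  define w where "w = (\<lambda>t. exp (2 * L * (t - a)))"
  define c where "c = (\<lambda>t. max a (min b t))"
  have wpos: "w t > 0" for t by (simp add: w_def)
  have w_cont: "continuous_on S w" for S by (auto simp: w_def intro!: continuous_intros)
  have c: "c t \<in> {a..b}" "t \<in> {a..b} \<Longrightarrow> c t = t" for t
    using \<open>a \<le> b\<close> by (auto simp: c_def)
  have c_cont: "continuous_on S c" for S by (auto simp: c_def intro!: continuous_intros)
  have int: "(\<lambda>s. g s (y s)) integrable_on {a..b}" if y: "continuous_on {a..b} y" for y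
  proof -
    obtain B where B: "\<And>t. t \<in> {a..b} \<Longrightarrow> norm (y t) \<le> B"
      by (rule continuous_on_Icc_bounded[OF y]) blast
    show ?thesis
    proof (rule bounded_measurable_integrable(2)[OF meas[OF y], where M = "M + L * B"])
      fix t assume t: "t \<in> {a..b}"
      have "norm (g t (y t)) \<le> norm (g t 0) + norm (g t (y t) - g t 0)"
        by (metis add.commute diff_add_cancel norm_triangle_ineq)
      also have "\<dots> \<le> M + L * norm (y t - 0)" by (intro add_mono bound lip t)
      also have "\<dots> \<le> M + L * B" using B[OF t] \<open>L > 0\<close> by simp
      finally show "norm (g t (y t)) \<le> M + L * B" .
    qed
  qed
  \<comment> \<open>The argument \<open>y\<close> stands for \<open>x / w\<close>. Clamping by
    \<open>c\<close> makes the image constant outside \<open>{a..b}\<close>, hence a bounded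
    continuous function on the line, and Banach's theorem applies in the complete space of such
    functions.\<close>
  define P where "P = (\<lambda>(y :: real \<Rightarrow> 'a) t. (1 / w (c t)) *\<^sub>R (x0 + integral {a..c t} (\<lambda>s. g s (w s *\<^sub>R y s))))"
  have bc: "continuous_on S (apply_bcontfun y)" for S and y :: "real \<Rightarrow>\<^sub>C 'a"
    using apply_bcontfun[of y] continuous_on_subset[of UNIV] by (auto simp: bcontfun_def)
  have int_w: "(\<lambda>s. g s (w s *\<^sub>R apply_bcontfun y s)) integrable_on {a..b}" for y
    by (rule int) (intro continuous_intros w_cont bc)
  have P_bcont: "P (apply_bcontfun y) \<in> bcontfun" for y
  proof -
    let ?Q = "\<lambda>t. (1 / w t) *\<^sub>R (x0 + integral {a..t} (\<lambda>s. g s (w s *\<^sub>R apply_bcontfun y s)))"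
    have Q: "continuous_on {a..b} ?Q"
      using wpos by (intro continuous_intros w_cont indefinite_integral_continuous_1[OF int_w]) (auto simp: less_imp_neq[symmetric])
    have "continuous_on UNIV (\<lambda>t. ?Q (c t))"
      by (rule continuous_on_compose2[OF Q c_cont]) (use c in auto)
    moreover have "bounded (range (\<lambda>t. ?Q (c t)))"
      by (rule bounded_subset[OF compact_imp_bounded[OF compact_continuous_image[OF Q compact_Icc]]])
        (use c in auto)
    ultimately show ?thesis unfolding bcontfun_def P_def by simp
  qed
  define \<Psi> where "\<Psi> = (\<lambda>y. Bcontfun (P (apply_bcontfun y)))"
  have \<Psi>: "apply_bcontfun (\<Psi> y) = P (apply_bcontfun y)" for y
    by (simp add: \<Psi>_def Bcontfun_inverse P_bcont)
  have "dist (\<Psi> y) (\<Psi> z) \<le> (1 / 2) * dist y z" for y z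
  proof (rule dist_bound)
    fix t
    let ?t = "c t"
    have sub: "{a..?t} \<subseteq> {a..b}" using c(1)[of t] by auto
    note int' = integrable_on_subinterval[OF int_w sub]
    have wint: "(w has_integral (w ?t - 1) / (2 * L)) {a..?t}"
      unfolding w_def using \<open>L > 0\<close> c(1)[of t] by (intro exp_has_integral) auto
    have "dist (\<Psi> y t) (\<Psi> z t) = norm ((1 / w ?t) *\<^sub>R
        (integral {a..?t} (\<lambda>s. g s (w s *\<^sub>R y s)) - integral {a..?t} (\<lambda>s. g s (w s *\<^sub>R z s))))"
      by (simp add: \<Psi> P_def dist_norm scaleR_diff_right[symmetric])
    also have "\<dots> = norm (integral {a..?t} (\<lambda>s. g s (w s *\<^sub>R y s) - g s (w s *\<^sub>R z s))) / w ?t"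
      using wpos[of ?t] by (simp add: Henstock_Kurzweil_Integration.integral_diff[OF int' int'])
    finally have eq: "dist (\<Psi> y t) (\<Psi> z t) = norm (integral {a..?t} (\<lambda>s. g s (w s *\<^sub>R y s) - g s (w s *\<^sub>R z s))) / w ?t" .
    have "norm (integral {a..?t} (\<lambda>s. g s (w s *\<^sub>R y s) - g s (w s *\<^sub>R z s)))
        \<le> integral {a..?t} (\<lambda>s. (L * dist y z) * w s)"
    proof (rule integral_norm_bound_integral)
      show "(\<lambda>s. g s (w s *\<^sub>R y s) - g s (w s *\<^sub>R z s)) integrable_on {a..?t}"
        by (intro integrable_diff int')
      show "(\<lambda>s. (L * dist y z) * w s) integrable_on {a..?t}"
        using wint by (intro integrable_on_mult_right) auto
      fix s assume "s \<in> {a..?t}"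
      then have "norm (g s (w s *\<^sub>R y s) - g s (w s *\<^sub>R z s)) \<le> L * norm (w s *\<^sub>R y s - w s *\<^sub>R z s)"
        using sub by (intro lip) auto
      also have "\<dots> = L * (w s * dist (y s) (z s))"
        using wpos[of s] by (simp add: scaleR_diff_right[symmetric] dist_norm)
      also have "\<dots> \<le> L * (w s * dist y z)"
        using \<open>L > 0\<close> wpos[of s] dist_bounded[of y s z] by simp
      finally show "norm (g s (w s *\<^sub>R y s) - g s (w s *\<^sub>R z s)) \<le> (L * dist y z) * w s"
        by (simp add: ac_simps)
    qed
    also have "integral {a..?t} (\<lambda>s. (L * dist y z) * w s) = (L * dist y z) * ((w ?t - 1) / (2 * L))"
      using wint by (simp add: integral_unique)
    also have "\<dots> \<le> (L * dist y z) * (w ?t / (2 * L))"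
      using \<open>L > 0\<close> by (intro mult_left_mono divide_right_mono) auto
    also have "\<dots> = (1 / 2) * dist y z * w ?t" using \<open>L > 0\<close> by simp
    finally show "dist (\<Psi> y t) (\<Psi> z t) \<le> (1 / 2) * dist y z"
      using wpos[of ?t] unfolding eq by (simp only: pos_divide_le_eq)
  qed
  then obtain y where y: "\<Psi> y = y"
    using banach_fix_type[of "1 / 2" \<Psi>] by auto
  define x where "x = (\<lambda>t. w t *\<^sub>R apply_bcontfun y t)"
  show thesis
  proof (rule that[of x])
    show "continuous_on {a..b} x" unfolding x_def by (intro continuous_intros w_cont bc)
    fix t assume "t \<in> {a..b}"
    have "apply_bcontfun y t = P (apply_bcontfun y) t" using \<Psi>[of y] y by simp
    then have "w t *\<^sub>R apply_bcontfun y t = x0 + integral {a..t} (\<lambda>s. g s (w s *\<^sub>R apply_bcontfun y s))"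
      using c(2)[OF \<open>t \<in> {a..b}\<close>] wpos[of t] by (simp add: P_def)
    then show "x t = x0 + integral {a..t} (\<lambda>s. g s (x s))" by (simp add: x_def)
  qed
qed

section \<open>Measurable selections\<close>

text \<open>On a compact set a continuous nonnegative function attains its infimum, so it has a zero
  exactly when its values on a countable dense subset come arbitrarily close to 0. That condition
  involves only countably many measurable functions.\<close>

lemma compact_zero_set_measurable:
  fixes \<Phi> :: "'t \<Rightarrow> 'u::euclidean_space \<Rightarrow> real"
  assumes "compact K"
    and cont: "\<And>t. t \<in> space M \<Longrightarrow> continuous_on K (\<Phi> t)"
    and meas: "\<And>u. u \<in> K \<Longrightarrow> (\<lambda>t. \<Phi> t u) \<in> borel_measurable M"
    and nonneg: "\<And>t u. t \<in> space M \<Longrightarrow> u \<in> K \<Longrightarrow> \<Phi> t u \<ge> 0"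
  shows "{t\<in>space M. \<exists>u\<in>K. \<Phi> t u = 0} \<in> sets M"
proof -
  obtain D where D: "countable D" "D \<subseteq> K" "K \<subseteq> closure D"
    using separable by blast
  have "{t\<in>space M. \<exists>u\<in>K. \<Phi> t u = 0}
      = (\<Inter>n::nat. \<Union>d\<in>D. {t\<in>space M. \<Phi> t d < 1 / real (Suc n)})"
  proof (intro set_eqI iffI)
    fix t assume "t \<in> {t\<in>space M. \<exists>u\<in>K. \<Phi> t u = 0}"
    then obtain u where u: "t \<in> space M" "u \<in> K" "\<Phi> t u = 0" by blast
    have "\<exists>d\<in>D. \<Phi> t d < 1 / real (Suc n)" for n
    proof -
      have "1 / real (Suc n) > 0" by simp
      then obtain \<delta> where "\<delta> > 0" and \<delta>: "\<And>v. v \<in> K \<Longrightarrow> dist v u < \<delta> \<Longrightarrow> dist (\<Phi> t v) (\<Phi> t u) < 1 / real (Suc n)"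
        using cont[OF u(1)] u(2) unfolding continuous_on_iff by metis
      obtain d where "d \<in> D" "dist d u < \<delta>"
        using D(3) u(2) \<open>\<delta> > 0\<close> by (meson closure_approachable subsetD)
      then have "\<Phi> t d < 1 / real (Suc n)" using \<delta>[of d] D(2) u(3) by (auto simp: dist_real_def)
      then show ?thesis using \<open>d \<in> D\<close> by blast
    qed
    then show "t \<in> (\<Inter>n::nat. \<Union>d\<in>D. {t\<in>space M. \<Phi> t d < 1 / real (Suc n)})" using u(1) by auto
  next
    fix t assume t: "t \<in> (\<Inter>n::nat. \<Union>d\<in>D. {t\<in>space M. \<Phi> t d < 1 / real (Suc n)})"
    then have ts: "t \<in> space M" and "K \<noteq> {}" using D(2) by auto
    then obtain u where u: "u \<in> K" "\<And>v. v \<in> K \<Longrightarrow> \<Phi> t u \<le> \<Phi> t v"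
      using continuous_attains_inf[OF \<open>compact K\<close> _ cont[OF ts]] by blast
    have "\<Phi> t u \<le> 0"
    proof (rule ccontr)
      assume "\<not> \<Phi> t u \<le> 0"
      then obtain n where "1 / real (Suc n) < \<Phi> t u" using nat_approx_posE[of "\<Phi> t u"] by auto
      moreover obtain d where "d \<in> D" "\<Phi> t d < 1 / real (Suc n)" using t by blast
      ultimately show False using u(2)[of d] D(2) by auto
    qed
    then have "\<Phi> t u = 0" using nonneg[OF ts u(1)] by simp
    then show "t \<in> {t\<in>space M. \<exists>u\<in>K. \<Phi> t u = 0}" using ts u(1) by blast
  qed
  also have "\<dots> \<in> sets M"
  proof (rule sets.countable_INT')
    have "(\<Union>d\<in>D. {t\<in>space M. \<Phi> t d < 1 / real (Suc n)}) \<in> sets M" for n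
      using D by (intro sets.countable_UN') (auto intro!: borel_measurable_less meas)
    then show "range (\<lambda>n. \<Union>d\<in>D. {t\<in>space M. \<Phi> t d < 1 / real (Suc n)}) \<subseteq> sets M" by blast
  qed auto
  finally show ?thesis .
qed

text \<open>The zero set is intersected successively with the first ball of radius \<open>2\<^sup>-\<^sup>k\<close> that meets
  it; the centres of these balls are measurable in \<open>t\<close> and converge to a zero.\<close>

lemma measurable_zero_selection:
  fixes \<Phi> :: "'t \<Rightarrow> 'u::euclidean_space \<Rightarrow> real"
  assumes "closed U"
    and cont: "\<And>t. t \<in> space M \<Longrightarrow> continuous_on U (\<Phi> t)"
    and meas: "\<And>u. u \<in> U \<Longrightarrow> (\<lambda>t. \<Phi> t u) \<in> borel_measurable M"
    and nonneg: "\<And>t u. t \<in> space M \<Longrightarrow> u \<in> U \<Longrightarrow> \<Phi> t u \<ge> 0"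
    and ex: "\<And>t. t \<in> space M \<Longrightarrow> \<exists>u\<in>U. \<Phi> t u = 0"
  obtains u where "u \<in> borel_measurable M" "\<And>t. t \<in> space M \<Longrightarrow> u t \<in> U \<and> \<Phi> t (u t) = 0"
proof -
  obtain D :: "'u set" where D: "countable D" "closure D = UNIV"
    using separable[of "UNIV :: 'u set"] by (metis top.extremum_uniqueI)
  then have "D \<noteq> {}" by auto
  define q where "q = from_nat_into D"
  have q: "\<exists>i. dist x (q i) < e" if e: "e > 0" for x e
  proof -
    obtain y where "y \<in> D" "dist y x < e"
      using D(2) e closure_approachable[of x D] by (metis UNIV_I)
    then show ?thesis
      using from_nat_into_surj[OF D(1)] unfolding q_def by (metis dist_commute)
  qed
  define C where "C = (\<lambda>k i. cball (q i) ((1 / 2 :: real) ^ k))"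
  define W where "W = rec_nat (\<lambda>t. {u\<in>U. \<Phi> t u = 0})
    (\<lambda>k V t. V t \<inter> C k (LEAST i. V t \<inter> C k i \<noteq> {}))"
  define I where "I = (\<lambda>k t. LEAST i. W k t \<inter> C k i \<noteq> {})"
  have W0: "W 0 t = {u\<in>U. \<Phi> t u = 0}" for t by (simp add: W_def)
  have WS: "W (Suc k) t = W k t \<inter> C k (I k t)" for k t by (simp add: W_def I_def)
  have closed_W: "closed (W k t)" if "t \<in> space M" for k t
  proof (induction k)
    case 0
    have "W 0 t = U \<inter> \<Phi> t -` {0}" by (auto simp: W0)
    then show ?case using continuous_closed_preimage[OF cont[OF that] \<open>closed U\<close>, of "{0}"] by simp
  next
    case (Suc k) then show ?case by (auto simp: WS C_def)
  qed
  have meets: "\<exists>i. W k t \<inter> C k i \<noteq> {}" if W: "W k t \<noteq> {}" for k t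
  proof -
    obtain x where x: "x \<in> W k t" using W by blast
    obtain i where "dist x (q i) < (1 / 2) ^ k" using q[of "(1 / 2) ^ k" x] by auto
    then have "x \<in> C k i" by (simp add: C_def dist_commute)
    then show ?thesis using x by blast
  qed
  have ne: "W k t \<noteq> {}" if "t \<in> space M" for k t
  proof (induction k)
    case 0 then show ?case using ex[OF that] by (auto simp: W0)
  next
    case (Suc k)
    then show ?case using LeastI_ex[OF meets[OF Suc]] by (simp add: WS I_def)
  qed
  have I_iff: "I k t = j \<longleftrightarrow> W k t \<inter> C k j \<noteq> {} \<and> (\<forall>i<j. W k t \<inter> C k i = {})"
    if t: "t \<in> space M" for k t j
  proof
    assume j: "I k t = j"
    have "W k t \<inter> C k j \<noteq> {}"
      using LeastI_ex[OF meets[OF ne[OF t]]] unfolding j[symmetric] I_def .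
    moreover have "W k t \<inter> C k i = {}" if "i < j" for i
      using not_less_Least[of i "\<lambda>i. W k t \<inter> C k i \<noteq> {}"] that unfolding j[symmetric] I_def by blast
    ultimately show "W k t \<inter> C k j \<noteq> {} \<and> (\<forall>i<j. W k t \<inter> C k i = {})" by blast
  next
    assume "W k t \<inter> C k j \<noteq> {} \<and> (\<forall>i<j. W k t \<inter> C k i = {})"
    then show "I k t = j" unfolding I_def
      by (intro Least_equality) (auto simp only: not_less[symmetric])
  qed
  \<comment> \<open>The compact set has to be arbitrary: the induction step intersects it with one
    of the balls before appealing to the previous level.\<close>
  have meas_W: "{t\<in>space M. W k t \<inter> K \<noteq> {}} \<in> sets M" if "compact K" for k K
    using that
  proof (induction k arbitrary: K)
    case 0
    have "{t\<in>space M. W 0 t \<inter> K \<noteq> {}} = {t\<in>space M. \<exists>u\<in>U \<inter> K. \<Phi> t u = 0}"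
      by (auto simp: W0)
    also have "\<dots> \<in> sets M"
      using \<open>closed U\<close> \<open>compact K\<close> meas nonneg
      by (intro compact_zero_set_measurable closed_Int_compact) (auto intro: continuous_on_subset[OF cont])
    finally show ?case .
  next
    case (Suc k)
    have cC: "compact (C k j)" for j by (simp add: C_def)
    have "{t\<in>space M. W (Suc k) t \<inter> K \<noteq> {}} =
      (\<Union>j. {t\<in>space M. W k t \<inter> (C k j \<inter> K) \<noteq> {}} \<inter> {t\<in>space M. I k t = j})"
      by (auto simp: WS)
    \<comment> \<open>Selecting ball \<open>j\<close> means that \<open>j\<close> is hit and no
      earlier ball is. The first condition already follows from meeting
      \<open>C k j \<inter> K\<close>, so only hitting sets of the previous level remain.\<close>
    also have "\<dots> = (\<Union>j. {t\<in>space M. W k t \<inter> (C k j \<inter> K) \<noteq> {}} - (\<Union>i\<in>{..<j}. {t\<in>space M. W k t \<inter> C k i \<noteq> {}}))"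
      using I_iff[of _ k] by (intro SUP_cong refl) blast
    also have "\<dots> \<in> sets M"
      using Suc.IH cC Suc.prems by (intro sets.countable_UN sets.Diff sets.finite_UN image_subsetI) (auto simp: compact_Int)
    finally show ?case .
  qed
  have meas_I: "{t\<in>space M. I k t = j} \<in> sets M" for k j
  proof -
    have cC: "compact (C k j)" for j by (simp add: C_def)
    have "{t\<in>space M. I k t = j} = {t\<in>space M. W k t \<inter> C k j \<noteq> {}} - (\<Union>i\<in>{..<j}. {t\<in>space M. W k t \<inter> C k i \<noteq> {}})"
      using I_iff[of _ k j] by blast
    also have "\<dots> \<in> sets M"
      using meas_W cC by (intro sets.Diff sets.finite_UN) auto
    finally show ?thesis .
  qed
  have "\<exists>u. \<forall>k. u \<in> W k t" if t: "t \<in> space M" for t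
  proof -
    \<comment> \<open>\<open>W 0 t\<close> may be unbounded. From \<open>Suc 0\<close> on a ball has
      been intersected in, so the nested sets are compact.\<close>
    have "(\<Inter>k. W (Suc k) t) \<noteq> {}"
    proof (rule compact_nest)
      show "compact (W (Suc n) t)" for n
        using closed_W[OF t, of n] by (auto simp: WS C_def intro: closed_Int_compact)
      show "W (Suc n) t \<noteq> {}" for n by (rule ne[OF t])
      show "W (Suc n) t \<subseteq> W (Suc m) t" if "m \<le> n" for m n
        using that by (induction rule: dec_induct) (auto simp: WS)
    qed
    then obtain u where u: "\<And>k. u \<in> W (Suc k) t" by auto
    then have "u \<in> W k t" for k using u[of k] by (simp add: WS)
    then show ?thesis by blast
  qed
  then obtain u where u: "\<And>t k. t \<in> space M \<Longrightarrow> u t \<in> W k t" by metis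
  show thesis
  proof (rule that[of u])
    show "u t \<in> U \<and> \<Phi> t (u t) = 0" if "t \<in> space M" for t using u[OF that, of 0] by (simp add: W0)
    show "u \<in> borel_measurable M"
    proof (rule borel_measurable_LIMSEQ_metric)
      fix k
      have "I k \<in> measurable M (count_space UNIV)"
        by (rule measurable_count_space_eq2_countable[THEN iffD2])
          (auto simp: vimage_def Int_def conj_commute meas_I)
      then show "(\<lambda>t. q (I k t)) \<in> borel_measurable M" by (rule measurable_compose) simp
    next
      fix t assume t: "t \<in> space M"
      have "dist (q (I k t)) (u t) \<le> (1 / 2) ^ k" for k
        using u[OF t, of "Suc k"] by (simp add: WS C_def)
      then have "(\<lambda>k. dist (q (I k t)) (u t)) \<longlonglongrightarrow> 0"
        by (intro tendsto_sandwich[OF _ _ tendsto_const LIMSEQ_realpow_zero[of "1 / 2 :: real"]]) auto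
      then show "(\<lambda>k. q (I k t)) \<longlonglongrightarrow> u t" by (simp add: tendsto_dist_iff[of "\<lambda>k. q (I k t)"])
    qed
  qed
qed

section \<open>Absolute continuity against primitives, and gradients\<close>

lemma abs_continuous_on_subset:
  assumes "abs_continuous_on I x" "J \<subseteq> I"
  shows "abs_continuous_on J x"
  using assms unfolding abs_continuous_on_def by (meson order_trans)

lemma abs_continuous_on_imp_continuous_on:
  fixes x :: "real \<Rightarrow> 'a::real_normed_vector"
  assumes "abs_continuous_on {a..b} x"
  shows "continuous_on {a..b} x"
  unfolding continuous_on_iff
proof (intro ballI allI impI)
  fix t e :: real assume t: "t \<in> {a..b}" and "e > 0"
  from assms[unfolded abs_continuous_on_def, rule_format, OF \<open>e > 0\<close>]
  obtain \<delta> where "\<delta> > 0" and \<delta>: "\<forall>d. d division_of \<Union>d \<and> \<Union>d \<subseteq> {a..b} \<and>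
        (\<Sum>k\<in>d. Sup k - Inf k) < \<delta> \<longrightarrow> (\<Sum>k\<in>d. norm (x (Sup k) - x (Inf k))) < e"
    by (elim exE conjE)
  have *: "norm (x v - x u) < e" if "u \<in> {a..b}" "v \<in> {a..b}" "u \<le> v" "v - u < \<delta>" for u v
  proof -
    have "{{u..v}} division_of {u..v}" using division_of_self[of u v] that by simp
    then show ?thesis using \<delta>[rule_format, of "{{u..v}}"] that by (simp add: atLeastatMost_subset_iff)
  qed
  show "\<exists>d>0. \<forall>s\<in>{a..b}. dist s t < d \<longrightarrow> dist (x s) (x t) < e"
  proof (intro exI[of _ \<delta>] conjI ballI impI)
    fix s assume s: "s \<in> {a..b}" "dist s t < \<delta>"
    then show "dist (x s) (x t) < e"
      using *[of s t] *[of t s] t by (cases "s \<le> t") (auto simp: dist_norm norm_minus_commute)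
  qed (fact \<open>\<delta> > 0\<close>)
qed

lemma AE_lebesgue_on_subset:
  assumes "AE t in lebesgue_on S. P t" "R \<subseteq> S" "R \<in> sets lebesgue" "S \<in> sets lebesgue"
    and "\<And>t. t \<in> R \<Longrightarrow> P t \<Longrightarrow> Q t"
  shows "AE t in lebesgue_on R. Q t"
  using assms by (auto simp: AE_lebesgue_on_iff_negligible intro: negligible_subset)

lemma abs_continuous_on_has_integral_subinterval:
  fixes x g :: "real \<Rightarrow> 'a::euclidean_space"
  assumes ac: "abs_continuous_on {a..b} x"
    and deriv: "AE t in lebesgue_on {a..b}. (x has_vector_derivative g t) (at t within {a..b})"
    and "a \<le> s" "s \<le> t" "t \<le> b"
  shows "(g has_integral (x t - x s)) {s..t}"
proof (rule abs_continuous_on_has_integral)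
  have sub: "{s..t} \<subseteq> {a..b}" using assms by auto
  then show "abs_continuous_on {s..t} x" by (rule abs_continuous_on_subset[OF ac])
  show "AE r in lebesgue_on {s..t}. (x has_vector_derivative g r) (at r within {s..t})"
    by (rule AE_lebesgue_on_subset[OF deriv sub]) (auto intro: has_vector_derivative_within_subset[OF _ sub])
qed fact

lemma primitive_has_vector_derivative_AE:
  fixes g :: "real \<Rightarrow> 'a::euclidean_space"
  assumes g: "g integrable_on {a..b}" and x: "\<And>t. t \<in> {a..b} \<Longrightarrow> x t = x0 + integral {a..t} g"
  shows "AE t in lebesgue_on {a..b}. (x has_vector_derivative g t) (at t within {a..b})"
proof (rule AE_lebesgue_on_subset[OF integral_has_vector_derivative_AE[OF g]])
  fix t assume t: "t \<in> {a..b}"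
    and "((\<lambda>t. integral {a..t} g) has_vector_derivative g t) (at t within {a..b})"
  then have "((\<lambda>t. x0 + integral {a..t} g) has_vector_derivative g t) (at t within {a..b})"
    by (auto intro!: derivative_eq_intros)
  then show "(x has_vector_derivative g t) (at t within {a..b})"
    by (rule has_vector_derivative_transform[OF t, rotated]) (use x in auto)
qed auto

lemma integral_primitive:
  fixes g :: "real \<Rightarrow> 'a::euclidean_space"
  assumes g: "g \<in> borel_measurable (lebesgue_on {a..b})" "\<And>t. t \<in> {a..b} \<Longrightarrow> norm (g t) \<le> M"
    and x: "\<And>t. t \<in> {a..b} \<Longrightarrow> x t = x0 + integral {a..t} g"
  shows "\<And>s t. s \<in> {a..b} \<Longrightarrow> t \<in> {a..b} \<Longrightarrow> norm (x t - x s) \<le> M * \<bar>t - s\<bar>"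
    and "abs_continuous_on {a..b} x"
    and "AE t in lebesgue_on {a..b}. (x has_vector_derivative g t) (at t within {a..b})"
proof -
  have int: "g integrable_on {a..b}" by (rule bounded_measurable_integrable[OF g])
  have *: "norm (x t - x s) \<le> M * (t - s)" if "a \<le> s" "s \<le> t" "t \<le> b" for s t
  proof -
    have "x t - x s = integral {s..t} g"
      using integral_unique[OF has_integral_primitive_diff[OF int that]] x[of s] x[of t] that by simp
    moreover have "norm (integral {s..t} g) \<le> integral {s..t} (\<lambda>_. M)"
      using that g(2) by (intro integral_norm_bound_integral integrable_on_subinterval[OF int]) auto
    ultimately show ?thesis using that by (simp add: mult.commute)
  qed
  show lip: "norm (x t - x s) \<le> M * \<bar>t - s\<bar>" if "s \<in> {a..b}" "t \<in> {a..b}" for s t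
    using *[of s t] *[of t s] that by (cases "s \<le> t") (auto simp: norm_minus_commute)
  show "abs_continuous_on {a..b} x" by (rule abs_continuous_on_lipschitz[OF lip])
  show "AE t in lebesgue_on {a..b}. (x has_vector_derivative g t) (at t within {a..b})"
    by (rule primitive_has_vector_derivative_AE[OF int x])
qed

text \<open>The vector of the values of \<open>D\<close> on the basis represents \<open>D\<close>,
  and uniqueness of derivatives identifies it with the definite description in
  \<open>gradient\<close>.\<close>

lemma has_derivative_gradient:
  fixes g :: "'a::euclidean_space \<Rightarrow> real"
  assumes "(g has_derivative D) (at x)"
  shows "D h = inner h (gradient g x)" "GDERIV g x :> gradient g x"
proof -
  have lin: "linear D" using assms by (simp add: has_derivative_linear)
  define d where "d = (\<Sum>i\<in>Basis. D i *\<^sub>R i)"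
  have D: "D h = inner h d" for h
  proof -
    have "D h = (\<Sum>i\<in>Basis. (h \<bullet> i) *\<^sub>R D i)"
      using linear_sum[OF lin, of "\<lambda>i. (h \<bullet> i) *\<^sub>R i" Basis] by (simp add: euclidean_representation linear_scale[OF lin])
    then show ?thesis by (simp add: d_def inner_sum_right mult.commute)
  qed
  then have "D = (\<lambda>h. inner h d)" by blast
  then have G: "GDERIV g x :> d" using assms by (simp add: gderiv_def)
  have "gradient g x = d" unfolding gradient_def
  proof (rule the_equality)
    show "GDERIV g x :> d" by (fact G)
    fix e assume "GDERIV g x :> e"
    then have "(\<lambda>h. inner h e) = (\<lambda>h. inner h d)"
      using G unfolding gderiv_def by (rule has_derivative_unique)
    then show "e = d" by (metis vector_eq_ldot)
  qed
  then show "D h = inner h (gradient g x)" "GDERIV g x :> gradient g x" using D G by auto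
qed

lemma nondecreasing_derivative_nonneg:
  fixes \<psi> :: "real \<Rightarrow> real"
  assumes deriv: "(\<psi> has_vector_derivative d) (at t within {a..b})" and "a < b" and t: "t \<in> {a..b}"
    and mono: "\<And>r s. a \<le> r \<Longrightarrow> r \<le> s \<Longrightarrow> s \<le> b \<Longrightarrow> \<psi> r \<le> \<psi> s"
  shows "d \<ge> 0"
proof (rule tendsto_lowerbound)
  show "((\<lambda>s. (\<psi> s - \<psi> t) / (s - t)) \<longlongrightarrow> d) (at t within {a..b})"
    using deriv by (simp add: has_real_derivative_iff_has_vector_derivative[symmetric] has_field_derivative_iff)
  show "\<forall>\<^sub>F s in at t within {a..b}. 0 \<le> (\<psi> s - \<psi> t) / (s - t)"
    unfolding eventually_at_filter
  proof (intro always_eventually allI impI)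
    fix s assume "s \<noteq> t" "s \<in> {a..b}"
    then show "0 \<le> (\<psi> s - \<psi> t) / (s - t)"
      using mono[of s t] mono[of t s] t by (cases "s \<le> t") (auto simp: zero_le_divide_iff)
  qed
  show "at t within {a..b} \<noteq> bot" using t \<open>a < b\<close> by (simp add: trivial_limit_within islimpt_Icc)
qed

section \<open>Existence of an optimal process\<close>

text \<open>The two cases for \<open>U\<close> are merged here. For equal controls a modulus of
  continuity is evaluated at 0, where it vanishes, so both cases give Lipschitz estimates in the
  state that are uniform in the control, for \<open>\<eta>\<close> on compact sets.\<close>

locale control_problem =
  fixes T :: real
    and U :: "(real^'m) set"
    and G G1 :: "(real^'n) set"
    and f :: "real \<Rightarrow> real^'n \<Rightarrow> real^'m \<Rightarrow> real^'n"
    and \<eta> :: "real \<Rightarrow> real^'n \<Rightarrow> real^'m \<Rightarrow> real"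
    and \<sigma> :: "real^'n \<Rightarrow> real"
    and a :: "real^'n" and A1 A2 C :: real
  assumes closed_U: "closed U"
    and open_G: "open G" and open_G1: "open G1" and closure_G: "closure G \<subseteq> G1"
    and cont_f: "continuous_on ({0..T} \<times> G1 \<times> U) (\<lambda>(t, x, u). f t x u)"
    and cont_\<eta>: "continuous_on ({0..T} \<times> G1 \<times> U) (\<lambda>(t, x, u). \<eta> t x u)"
    and cont_\<sigma>: "continuous_on G1 \<sigma>"
    and invariant: "strongly_invariant T U G G1 f"
    and a_in: "a \<in> G"
    and A1: "\<And>t u. t \<in> {0..T} \<Longrightarrow> u \<in> U \<Longrightarrow> norm (f t a u) \<le> A1"
    and A2: "\<And>t u. t \<in> {0..T} \<Longrightarrow> u \<in> U \<Longrightarrow> \<bar>\<eta> t a u\<bar> \<le> A2"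
    and A1_pos: "A1 > 0" and A2_pos: "A2 > 0" and C_pos: "C > 0"
    and lip_f: "\<And>t x y u. t \<in> {0..T} \<Longrightarrow> x \<in> closure G \<Longrightarrow> y \<in> closure G \<Longrightarrow> u \<in> U \<Longrightarrow>
        norm (f t x u - f t y u) \<le> C * norm (x - y)"
    and lip_\<eta>: "\<And>K. compact K \<Longrightarrow> K \<subseteq> closure G \<Longrightarrow>
        \<exists>c>0. \<forall>t\<in>{0..T}. \<forall>x\<in>K. \<forall>y\<in>K. \<forall>u\<in>U. \<bar>\<eta> t x u - \<eta> t y u\<bar> \<le> c * norm (x - y)"
    and convex_velocities: "\<And>t x. t \<in> {0..T} \<Longrightarrow> x \<in> G1 \<Longrightarrow> convex ((\<lambda>u. (f t x u, \<eta> t x u)) ` U)"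
    and closed_velocities: "\<And>t x. t \<in> {0..T} \<Longrightarrow> x \<in> G1 \<Longrightarrow> closed ((\<lambda>u. (f t x u, \<eta> t x u)) ` U)"
    and finite_value: "\<And>t0 x0. t0 \<in> {0..<T} \<Longrightarrow> x0 \<in> G \<Longrightarrow> \<bar>value_function T U G1 f \<eta> \<sigma> t0 x0\<bar> \<noteq> \<infinity>"
    and diff_f: "\<And>t x u. t \<in> {0..T} \<Longrightarrow> x \<in> G1 \<Longrightarrow> u \<in> U \<Longrightarrow> (\<lambda>y. f t y u) differentiable (at x)"
    and diff_\<eta>: "\<And>t x u. t \<in> {0..T} \<Longrightarrow> x \<in> G1 \<Longrightarrow> u \<in> U \<Longrightarrow> (\<lambda>y. \<eta> t y u) differentiable (at x)"
    and diff_\<sigma>: "\<And>x. x \<in> G1 \<Longrightarrow> \<sigma> differentiable (at x)"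

lemma control_problem_of_assumptions:
  assumes B1: "assumption_B1 T U G G1 f \<eta> \<sigma>" and B2: "assumption_B2 T U G G1 f \<eta> \<sigma>"
  obtains a A1 A2 C where "control_problem T U G G1 f \<eta> \<sigma> a A1 A2 C"
proof -
  have "\<exists>a\<in>G. \<exists>A1>0. \<exists>A2>0. \<forall>t\<in>{0..T}. \<forall>u\<in>U. norm (f t a u) \<le> A1 \<and> \<bar>\<eta> t a u\<bar> \<le> A2"
    using B1 unfolding assumption_B1_def by (elim conjE)
  then obtain a A1 A2 where a: "a \<in> G" "A1 > 0" "A2 > 0"
    "\<forall>t\<in>{0..T}. \<forall>u\<in>U. norm (f t a u) \<le> A1 \<and> \<bar>\<eta> t a u\<bar> \<le> A2"
    by (elim bexE exE conjE)
  have "\<exists>C>0. \<forall>t\<in>{0..T}. \<forall>x\<in>closure G. \<forall>y\<in>closure G. \<forall>u\<in>U. norm (f t x u - f t y u) \<le> C * norm (x - y)"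
  proof (cases "bounded U")
    case True
    have "bounded U \<longrightarrow>
        (\<exists>C1>0. \<forall>t\<in>{0..T}. \<forall>x'\<in>closure G. \<forall>x''\<in>closure G. \<forall>u\<in>U.
             norm (f t x' u - f t x'' u) \<le> C1 * norm (x' - x''))"
      using B1 unfolding assumption_B1_def by (elim conjE)
    then show ?thesis using True by (rule mp)
  next
    case False
    have "\<not> bounded U \<longrightarrow>
        (\<exists>C1>0. \<exists>\<omega>1. modulus_of_continuity \<omega>1 \<and>
          (\<forall>t\<in>{0..T}. \<forall>x'\<in>closure G. \<forall>x''\<in>closure G. \<forall>u'\<in>U. \<forall>u''\<in>U.
             norm (f t x' u' - f t x'' u'') \<le> C1 * norm (x' - x'') + \<omega>1 (norm (u' - u''))))"
      using B1 unfolding assumption_B1_def by (elim conjE)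
    then obtain C \<omega> where C: "C > 0" "modulus_of_continuity \<omega>"
      "\<forall>t\<in>{0..T}. \<forall>x'\<in>closure G. \<forall>x''\<in>closure G. \<forall>u'\<in>U. \<forall>u''\<in>U.
             norm (f t x' u' - f t x'' u'') \<le> C * norm (x' - x'') + \<omega> (norm (u' - u''))"
      using False by (elim impE exE conjE)
    have "norm (f t x u - f t y u) \<le> C * norm (x - y)"
      if "t \<in> {0..T}" "x \<in> closure G" "y \<in> closure G" "u \<in> U" for t x y u
      using C(3)[rule_format, OF that that(4)] C(2) by (simp add: modulus_of_continuity_def)
    then show ?thesis using C(1) by (intro exI[of _ C]) simp
  qed
  then obtain C where C: "C > 0" "\<forall>t\<in>{0..T}. \<forall>x\<in>closure G. \<forall>y\<in>closure G. \<forall>u\<in>U.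
      norm (f t x u - f t y u) \<le> C * norm (x - y)"
    by (elim exE conjE)
  have lip: "\<exists>c>0. \<forall>t\<in>{0..T}. \<forall>x\<in>K. \<forall>y\<in>K. \<forall>u\<in>U. \<bar>\<eta> t x u - \<eta> t y u\<bar> \<le> c * norm (x - y)"
    if K: "compact K" "K \<subseteq> closure G" for K
  proof (cases "bounded U")
    case True
    have *: "bounded U \<longrightarrow> (\<forall>K. compact K \<and> K \<subseteq> closure G \<longrightarrow>
          (\<exists>C2>0. \<exists>C3>0. \<forall>t\<in>{0..T}. \<forall>x'\<in>K. \<forall>x''\<in>K. \<forall>u\<in>U.
             \<bar>\<eta> t x' u - \<eta> t x'' u\<bar> \<le> C2 * norm (x' - x'') \<and>
             \<bar>\<sigma> x' - \<sigma> x''\<bar> \<le> C3 * norm (x' - x'')))"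
      using B1 unfolding assumption_B1_def by (elim conjE)
    obtain C2 C3 where C2: "C2 > 0" "\<forall>t\<in>{0..T}. \<forall>x'\<in>K. \<forall>x''\<in>K. \<forall>u\<in>U.
             \<bar>\<eta> t x' u - \<eta> t x'' u\<bar> \<le> C2 * norm (x' - x'') \<and>
             \<bar>\<sigma> x' - \<sigma> x''\<bar> \<le> C3 * norm (x' - x'')"
      using *[THEN mp, OF True, THEN spec[of _ K], THEN mp, OF conjI[OF K]] by (elim exE conjE)
    then show ?thesis by (intro exI[of _ C2]) simp
  next
    case False
    have "\<not> bounded U \<longrightarrow>
        (\<exists>C2>0. \<exists>C3>0. \<exists>\<omega>2. modulus_of_continuity \<omega>2 \<and>
          (\<forall>t\<in>{0..T}. \<forall>x'\<in>closure G. \<forall>x''\<in>closure G. \<forall>u'\<in>U. \<forall>u''\<in>U.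
             \<bar>\<eta> t x' u' - \<eta> t x'' u''\<bar> \<le> C2 * norm (x' - x'') + \<omega>2 (norm (u' - u'')) \<and>
             \<bar>\<sigma> x' - \<sigma> x''\<bar> \<le> C3 * norm (x' - x'')))"
      using B1 unfolding assumption_B1_def by (elim conjE)
    then obtain c c3 \<omega> where c: "c > 0" "modulus_of_continuity \<omega>"
      "\<forall>t\<in>{0..T}. \<forall>x'\<in>closure G. \<forall>x''\<in>closure G. \<forall>u'\<in>U. \<forall>u''\<in>U.
             \<bar>\<eta> t x' u' - \<eta> t x'' u''\<bar> \<le> c * norm (x' - x'') + \<omega> (norm (u' - u'')) \<and>
             \<bar>\<sigma> x' - \<sigma> x''\<bar> \<le> c3 * norm (x' - x'')"
      using False by (elim impE exE conjE)
    have "\<bar>\<eta> t x u - \<eta> t y u\<bar> \<le> c * norm (x - y)"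
      if "t \<in> {0..T}" "x \<in> K" "y \<in> K" "u \<in> U" for t x y u
      using c(3)[rule_format, of t x y u u] that subsetD[OF K(2)] c(2) by (simp add: modulus_of_continuity_def)
    then show ?thesis using c(1) by (intro exI[of _ c]) simp
  qed
  have "control_problem T U G G1 f \<eta> \<sigma> a A1 A2 C"
  proof (unfold_locales, goal_cases)
    case (10 t u) then show ?case using a(4) by blast
  next
    case (11 t u) then show ?case using a(4) by blast
  next
    case (15 t x y u) then show ?case using C(2) by blast
  next
    case (16 K) then show ?case by (rule lip)
  qed (use B1 B2 a(1-3) C(1) in \<open>simp_all add: assumption_B1_def assumption_B2_def open_domain_def
        continuously_differentiable_on_def\<close>)
  then show thesis by (rule that)
qed

section \<open>Growth bounds, measurability and Filippov's selection\<close>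

context control_problem
begin

lemma G_subset: "x \<in> G \<Longrightarrow> x \<in> G1" "x \<in> G \<Longrightarrow> x \<in> closure G" "x \<in> closure G \<Longrightarrow> x \<in> G1"
  using closure_G closure_subset[of G] by auto

text \<open>Linear growth is uniform in the control because the bound at \<open>a\<close>
  is.\<close>

lemma f_bound:
  assumes "t \<in> {0..T}" "x \<in> closure G" "u \<in> U"
  shows "norm (f t x u) \<le> A1 + C * norm (x - a)"
proof -
  have "norm (f t x u) \<le> norm (f t a u) + norm (f t x u - f t a u)"
    by (metis add.commute diff_add_cancel norm_triangle_ineq)
  also have "\<dots> \<le> A1 + C * norm (x - a)"
    using assms a_in G_subset(2) by (intro add_mono A1 lip_f)
  finally show ?thesis .
qed

lemma \<eta>_bound:
  assumes "compact K" "K \<subseteq> closure G"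
  obtains B where "B > 0" "\<And>t x u. t \<in> {0..T} \<Longrightarrow> x \<in> K \<Longrightarrow> u \<in> U \<Longrightarrow> \<bar>\<eta> t x u\<bar> \<le> B"
proof -
  \<comment> \<open>The Lipschitz constant of \<open>\<eta>\<close> depends on the compact set,
    which must therefore also contain the reference point \<open>a\<close>.\<close>
  have K: "compact (insert a K)" "insert a K \<subseteq> closure G"
    using assms a_in G_subset(2) by auto
  obtain c where c: "c > 0" "\<And>t x u. t \<in> {0..T} \<Longrightarrow> x \<in> K \<Longrightarrow> u \<in> U \<Longrightarrow> \<bar>\<eta> t x u - \<eta> t a u\<bar> \<le> c * norm (x - a)"
    using lip_\<eta>[OF K] by blast
  obtain R where R: "R > 0" "\<And>x. x \<in> K \<Longrightarrow> norm x \<le> R"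
    using compact_imp_bounded[OF assms(1)] bounded_pos[of K] by blast
  show thesis
  proof (rule that[of "A2 + c * (R + norm a)"])
    show "A2 + c * (R + norm a) > 0" using A2_pos c(1) R(1) by (simp add: add_pos_nonneg)
    fix t x u assume *: "t \<in> {0..T}" "x \<in> K" "u \<in> U"
    have "\<bar>\<eta> t x u\<bar> \<le> A2 + c * norm (x - a)"
      using c(2)[OF *] A2[OF *(1,3)] by linarith
    also have "\<dots> \<le> A2 + c * (R + norm a)"
      using R(2)[OF *(2)] norm_triangle_ineq4[of x a] c(1) by auto
    finally show "\<bar>\<eta> t x u\<bar> \<le> A2 + c * (R + norm a)" .
  qed
qed

lemma compact_bounds:
  assumes K: "compact K" "K \<subseteq> closure G"
  obtains M B c where "M > 0" "B > 0" "c > 0"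
    "\<And>t y v. t \<in> {0..T} \<Longrightarrow> y \<in> K \<Longrightarrow> v \<in> U \<Longrightarrow> norm (f t y v) \<le> M"
    "\<And>t y v. t \<in> {0..T} \<Longrightarrow> y \<in> K \<Longrightarrow> v \<in> U \<Longrightarrow> \<bar>\<eta> t y v\<bar> \<le> B"
    "\<And>t y z v. t \<in> {0..T} \<Longrightarrow> y \<in> K \<Longrightarrow> z \<in> K \<Longrightarrow> v \<in> U \<Longrightarrow> \<bar>\<eta> t y v - \<eta> t z v\<bar> \<le> c * norm (y - z)"
proof -
  obtain R where R: "R > 0" "\<And>y. y \<in> K \<Longrightarrow> norm y \<le> R"
    using compact_imp_bounded[OF K(1)] bounded_pos[of K] by blast
  obtain B where B: "B > 0" "\<And>t y v. t \<in> {0..T} \<Longrightarrow> y \<in> K \<Longrightarrow> v \<in> U \<Longrightarrow> \<bar>\<eta> t y v\<bar> \<le> B"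
    using \<eta>_bound[OF K] by blast
  obtain c where c: "c > 0" "\<And>t y y' v. t \<in> {0..T} \<Longrightarrow> y \<in> K \<Longrightarrow> y' \<in> K \<Longrightarrow> v \<in> U \<Longrightarrow>
      \<bar>\<eta> t y v - \<eta> t y' v\<bar> \<le> c * norm (y - y')"
    using lip_\<eta>[OF K] by blast
  show thesis
  proof (rule that[of "A1 + C * (R + norm a)" B c])
    show "A1 + C * (R + norm a) > 0" using A1_pos C_pos R(1) by (simp add: add_pos_nonneg)
    fix t y v assume *: "t \<in> {0..T}" "y \<in> K" "v \<in> U"
    have "norm (f t y v) \<le> A1 + C * norm (y - a)" using * K(2) by (intro f_bound) auto
    also have "\<dots> \<le> A1 + C * (R + norm a)"
      using R(2)[OF *(2)] norm_triangle_ineq4[of y a] C_pos by auto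
    finally show "norm (f t y v) \<le> A1 + C * (R + norm a)" .
  qed (use B c in auto)
qed

lemma measurable_velocity:
  assumes "{s..t} \<subseteq> {0..T}" "x \<in> borel_measurable (lebesgue_on {s..t})" "u \<in> borel_measurable (lebesgue_on {s..t})"
    and "\<And>r. r \<in> {s..t} \<Longrightarrow> x r \<in> G1" "\<And>r. r \<in> {s..t} \<Longrightarrow> u r \<in> U"
  shows "(\<lambda>r. f r (x r) (u r)) \<in> borel_measurable (lebesgue_on {s..t})"
    and "(\<lambda>r. \<eta> r (x r) (u r)) \<in> borel_measurable (lebesgue_on {s..t})"
proof -
  have id: "(\<lambda>r. r) \<in> borel_measurable (lebesgue_on {s..t})"
    by (intro continuous_imp_measurable_on_sets_lebesgue continuous_intros) auto
  have h: "(\<lambda>r. (r, x r, u r)) \<in> borel_measurable (lebesgue_on {s..t})"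
    by (intro borel_measurable_Pair id assms)
  have S: "{0..T} \<times> G1 \<times> U \<in> sets borel"
    using open_G1 closed_U by (intro borel_Times) auto
  have *: "(r, x r, u r) \<in> {0..T} \<times> G1 \<times> U" if "r \<in> space (lebesgue_on {s..t})" for r
    using assms that by (auto simp: subset_eq)
  show "(\<lambda>r. f r (x r) (u r)) \<in> borel_measurable (lebesgue_on {s..t})"
    using measurable_compose_continuous_on[OF cont_f S h *] by simp
  show "(\<lambda>r. \<eta> r (x r) (u r)) \<in> borel_measurable (lebesgue_on {s..t})"
    using measurable_compose_continuous_on[OF cont_\<eta> S h *] by simp
qed

lemma continuous_velocity:
  assumes "t \<in> {0..T}" "x \<in> G1"
  shows "continuous_on U (\<lambda>u. f t x u)" "continuous_on U (\<lambda>u. \<eta> t x u)"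
proof -
  have p: "continuous_on U (\<lambda>u. (t, x, u))" by (intro continuous_intros)
  have im: "(\<lambda>u. (t, x, u)) ` U \<subseteq> {0..T} \<times> G1 \<times> U" using assms by auto
  show "continuous_on U (\<lambda>u. f t x u)"
    using continuous_on_compose2[OF cont_f p im] by simp
  show "continuous_on U (\<lambda>u. \<eta> t x u)"
    using continuous_on_compose2[OF cont_\<eta> p im] by simp
qed

lemma hamiltonian_has_derivative:
  assumes "t \<in> {0..T}" "y \<in> G1" "v \<in> U"
  shows "((\<lambda>y. hamiltonian f \<eta> t y v p) has_derivative
    (\<lambda>h. inner h (gradient (\<lambda>y. hamiltonian f \<eta> t y v p) y))) (at y)"
proof -
  have "(\<lambda>y. inner p (f t y v) + \<eta> t y v) differentiable (at y)"
    using diff_f[OF assms] diff_\<eta>[OF assms] by (intro differentiable_add differentiable_inner) auto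
  then obtain D where D: "((\<lambda>y. hamiltonian f \<eta> t y v p) has_derivative D) (at y)"
    unfolding hamiltonian_def differentiable_def by blast
  then show ?thesis using has_derivative_gradient(2)[OF D] by (simp add: gderiv_def)
qed

lemma controlsD:
  assumes "u \<in> controls U t0 T"
  shows "u \<in> borel_measurable (lebesgue_on {t0..T})" "t \<in> {t0..T} \<Longrightarrow> u t \<in> U"
  using assms by (auto simp: controls_def)

text \<open>Filippov's lemma: a realising control is a measurable choice of zeros of the distance
  between \<open>w t\<close> and the velocity of \<open>u\<close>, which is continuous in
  \<open>u\<close> and measurable in \<open>t\<close>.\<close>

lemma velocity_selection:
  assumes t0: "t0 \<in> {0..<T}" and u0: "u0 \<in> U"
    and x: "x \<in> borel_measurable (lebesgue_on {t0..T})" "\<And>t. t \<in> {t0..T} \<Longrightarrow> x t \<in> G1"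
    and w: "w \<in> borel_measurable (lebesgue_on {t0..T})"
    and AE: "AE t in lebesgue_on {t0..T}. w t \<in> (\<lambda>u. (f t (x t) u, \<eta> t (x t) u)) ` U"
  obtains u where "u \<in> controls U t0 T"
    "AE t in lebesgue_on {t0..T}. w t = (f t (x t) (u t), \<eta> t (x t) (u t))"
proof -
  let ?M = "lebesgue_on {t0..T}"
  let ?F = "\<lambda>t u. (f t (x t) u, \<eta> t (x t) u)"
  have sub: "{t0..T} \<subseteq> {0..T}" using t0 by auto
  define N where "N = {t\<in>{t0..T}. w t \<notin> ?F t ` U}"
  have negN: "negligible N" using AE by (simp add: N_def AE_lebesgue_on_iff_negligible)
  \<comment> \<open>Zeros must exist at every time, so on the null set \<open>N\<close> the
    prescribed velocity is replaced by that of \<open>u0\<close>.\<close>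
  define w' where "w' = (\<lambda>t. if t \<in> N then ?F t u0 else w t)"
  have F: "(\<lambda>t. ?F t v) \<in> borel_measurable ?M" if "v \<in> U" for v
    by (intro borel_measurable_Pair measurable_velocity sub x) (use that in auto)
  have "N \<in> sets ?M"
    using negligible_imp_sets[OF negN] by (subst sets_restrict_space_iff) (auto simp: N_def)
  then have w': "w' \<in> borel_measurable ?M"
    unfolding w'_def by (intro measurable_If_set[OF F[OF u0] w]) (auto simp: sets.Int_space_eq1)
  have w'_in: "w' t \<in> ?F t ` U" if "t \<in> {t0..T}" for t
    using that u0 by (auto simp: w'_def N_def)
  obtain u where u: "u \<in> borel_measurable ?M"
    "\<And>t. t \<in> space ?M \<Longrightarrow> u t \<in> U \<and> norm (?F t (u t) - w' t) = 0"
  proof (rule measurable_zero_selection[OF closed_U, of ?M "\<lambda>t u. norm (?F t u - w' t)"])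
    fix t assume "t \<in> space ?M"
    then have t: "t \<in> {t0..T}" by simp
    then show "continuous_on U (\<lambda>u. norm (?F t u - w' t))"
      using continuous_velocity[of t "x t"] x(2) sub by (intro continuous_intros) auto
    obtain v where "v \<in> U" "w' t = ?F t v" using w'_in[OF t] by blast
    then show "\<exists>u\<in>U. norm (?F t u - w' t) = 0" by (intro bexI[of _ v]) auto
  next
    fix v assume v: "v \<in> U"
    show "(\<lambda>t. norm (?F t v - w' t)) \<in> borel_measurable ?M"
      by (rule measurable_compose[OF borel_measurable_diff[OF F[OF v] w'] borel_measurable_norm])
  qed auto
  show thesis
  proof (rule that[of u])
    show "u \<in> controls U t0 T" using u by (auto simp: controls_def)
    have "{t\<in>{t0..T}. \<not> w t = ?F t (u t)} \<subseteq> N"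
      using u(2) by (auto simp: w'_def split: if_splits)
    then show "AE t in ?M. w t = ?F t (u t)"
      using negN by (auto simp: AE_lebesgue_on_iff_negligible intro: negligible_subset)
  qed
qed

text \<open>Competing trajectories are only required to stay in \<open>G1\<close>; strong invariance
  on the full interval brings them into \<open>G\<close>, where the Lipschitz bounds are
  available.\<close>

lemma trajectory:
  assumes t0: "t0 \<in> {0..<T}" and x0: "x0 \<in> G" and u: "u \<in> controls U t0 T"
    and x: "state_trajectory f G1 t0 T x0 u x"
  shows "t \<in> {t0..T} \<Longrightarrow> x t \<in> G"
    and "continuous_on {t0..T} x"
    and "t0 \<le> s \<Longrightarrow> s \<le> t \<Longrightarrow> t \<le> T \<Longrightarrow> ((\<lambda>r. f r (x r) (u r)) has_integral (x t - x s)) {s..t}"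
proof -
  show "t \<in> {t0..T} \<Longrightarrow> x t \<in> G"
    using invariant[unfolded strongly_invariant_def, rule_format, OF t0 x0 u _ x, of t] t0 by auto
  show "continuous_on {t0..T} x"
    using x unfolding state_trajectory_def by (blast intro: abs_continuous_on_imp_continuous_on)
  show "((\<lambda>r. f r (x r) (u r)) has_integral (x t - x s)) {s..t}" if "t0 \<le> s" "s \<le> t" "t \<le> T"
    using x that unfolding state_trajectory_def by (blast intro: abs_continuous_on_has_integral_subinterval)
qed

lemma trajectory_measurable:
  assumes t0: "t0 \<in> {0..<T}" and x0: "x0 \<in> G" and u: "u \<in> controls U t0 T"
    and x: "state_trajectory f G1 t0 T x0 u x"
  shows "x \<in> borel_measurable (lebesgue_on {t0..T})"
    and "(\<lambda>r. f r (x r) (u r)) \<in> borel_measurable (lebesgue_on {t0..T})"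
    and "(\<lambda>r. \<eta> r (x r) (u r)) \<in> borel_measurable (lebesgue_on {t0..T})"
proof -
  show xm: "x \<in> borel_measurable (lebesgue_on {t0..T})"
    by (intro continuous_imp_measurable_on_sets_lebesgue trajectory(2)[OF assms]) auto
  show "(\<lambda>r. f r (x r) (u r)) \<in> borel_measurable (lebesgue_on {t0..T})"
    "(\<lambda>r. \<eta> r (x r) (u r)) \<in> borel_measurable (lebesgue_on {t0..T})"
    using t0 trajectory(1)[OF assms] G_subset controlsD[OF u] by (intro measurable_velocity xm; auto)+
qed

text \<open>The bound does not depend on the control, so it confines a whole minimising sequence to
  one compact set.\<close>

lemma trajectory_bound:
  assumes t0: "t0 \<in> {0..<T}" and x0: "x0 \<in> G" and u: "u \<in> controls U t0 T"
    and x: "state_trajectory f G1 t0 T x0 u x" and t: "t \<in> {t0..T}"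
  shows "norm (x t - a) \<le> 2 * (norm (x0 - a) + A1 * (T - t0)) * exp (2 * C * (T - t0))"
proof -
  note tr = trajectory[OF assms(1-4)]
  have "norm (x t - a) \<le> 2 * (norm (x t0 - a) + A1 * (T - t0)) * exp (2 * C * (T - t0))"
  proof (rule gronwall_norm[where h = "\<lambda>s. f s (x s) (u s)"])
    fix s assume s: "s \<in> {t0..T}"
    show "((\<lambda>s. f s (x s) (u s)) has_integral (x s - a - (x t0 - a))) {t0..s}"
      using tr(3)[of t0 s] s by simp
    show "norm (f s (x s) (u s)) \<le> A1 + C * norm (x s - a)"
      using t0 s tr(1)[OF s] G_subset(2) controlsD(2)[OF u s] by (intro f_bound) auto
  qed (use A1_pos C_pos t in \<open>auto intro!: continuous_intros tr(2)\<close>)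
  then show ?thesis using x by (simp add: state_trajectory_def)
qed

end

text \<open>Closed convex sets are cut out by countably many half spaces, which allows one null set to
  be discarded for all directions at once.\<close>

lemma mem_closed_convex_dense:
  fixes S :: "'a::euclidean_space set"
  assumes "closed S" "convex S" and bound: "\<And>v. v \<in> S \<Longrightarrow> norm v \<le> M"
    and "closure Q = UNIV"
    and le: "\<And>q c. q \<in> Q \<Longrightarrow> (\<And>v. v \<in> S \<Longrightarrow> inner q v \<le> c) \<Longrightarrow> inner q w \<le> c"
  shows "w \<in> S"
proof (rule ccontr)
  assume "w \<notin> S"
  obtain p b where p: "inner p w < b" "\<And>v. v \<in> S \<Longrightarrow> inner p v > b"
    using separating_hyperplane_closed_point[OF assms(2,1) \<open>w \<notin> S\<close>] by blast
  define d where "d = b - inner p w"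
  define N where "N = \<bar>M\<bar> + norm w + 1"
  have "d > 0" "N > 0" using p(1) by (auto simp: d_def N_def add_pos_nonneg add_nonneg_pos)
  then have "d / N > 0" by simp
  then obtain q where q: "q \<in> Q" "dist q (- p) < d / N"
    using \<open>closure Q = UNIV\<close> closure_approachable[of "- p" Q] by (metis UNIV_I)
  have close: "\<bar>inner q v + inner p v\<bar> \<le> (d / N) * norm v" for v
  proof -
    have "\<bar>inner q v + inner p v\<bar> = \<bar>inner (q - (- p)) v\<bar>" by (simp add: inner_add_left inner_diff_left)
    also have "\<dots> \<le> dist q (- p) * norm v" unfolding dist_norm by (rule Cauchy_Schwarz_ineq2)
    also have "\<dots> \<le> (d / N) * norm v" using q(2) by (intro mult_right_mono) auto
    finally show ?thesis .
  qed
  have "inner q w \<le> - b + (d / N) * \<bar>M\<bar>"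
  proof (rule le[OF q(1)])
    fix v assume v: "v \<in> S"
    have "(d / N) * norm v \<le> (d / N) * \<bar>M\<bar>"
      using bound[OF v] \<open>d / N > 0\<close> by (intro mult_left_mono) auto
    then show "inner q v \<le> - b + (d / N) * \<bar>M\<bar>" using close[of v] p(2)[OF v] by linarith
  qed
  moreover have "inner q w \<ge> - inner p w - (d / N) * norm w" using close[of w] by linarith
  ultimately have "d \<le> (d / N) * \<bar>M\<bar> + (d / N) * norm w" by (simp add: d_def)
  also have "\<dots> = d * ((\<bar>M\<bar> + norm w) / N)" by (simp add: field_simps add_divide_distrib)
  also have "\<dots> < d * 1"
    using \<open>d > 0\<close> by (intro mult_strict_left_mono) (auto simp: N_def add_nonneg_pos divide_less_eq)
  finally show False by simp
qed

section \<open>Closure of trajectories under uniform limits\<close>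

context control_problem
begin

text \<open>Without controls the value would be an empty infimum, hence infinite.\<close>

lemma U_nonempty:
  assumes "0 < T" shows "U \<noteq> {}"
proof
  assume "U = {}"
  then have "controls U 0 T = {}" using assms by (auto simp: controls_def)
  then have "value_function T U G1 f \<eta> \<sigma> 0 a = \<infinity>"
    by (simp add: value_function_def top_ereal_def)
  then show False using finite_value[of 0 a] assms a_in by auto
qed

text \<open>No weak limit of the velocities is taken. Every increment of \<open>zs\<close> in a
  direction \<open>q\<close> is at most the integral of the support function plus a small error;
  these inequalities survive uniform convergence of the primitives and differentiate back to a
  pointwise bound on \<open>w\<close>.\<close>

lemma velocity_derivative_in_closure:
  assumes t0: "t0 \<in> {0..<T}"
    and K: "compact K" "K \<subseteq> closure G"
    and u: "\<And>k. u k \<in> controls U t0 T"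
    and xm: "\<And>k. xs k \<in> borel_measurable (lebesgue_on {t0..T})"
    and xK: "\<And>k t. t \<in> {t0..T} \<Longrightarrow> xs k t \<in> K"
    and zs: "\<And>k s t. t0 \<le> s \<Longrightarrow> s \<le> t \<Longrightarrow> t \<le> T \<Longrightarrow>
       ((\<lambda>r. (f r (xs k r) (u k r), \<eta> r (xs k r) (u k r))) has_integral (zs k t - zs k s)) {s..t}"
    and x: "x \<in> borel_measurable (lebesgue_on {t0..T})" "\<And>t. t \<in> {t0..T} \<Longrightarrow> x t \<in> K"
    and unif: "\<And>e. e > 0 \<Longrightarrow> \<exists>k. \<forall>t\<in>{t0..T}. norm (xs k t - x t) < e \<and> norm (zs k t - z t) < e"
    and z: "\<And>t. t \<in> {t0..T} \<Longrightarrow> (w has_integral (z t - z t0)) {t0..t}"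
  shows "AE t in lebesgue_on {t0..T}. w t \<in> (\<lambda>v. (f t (x t) v, \<eta> t (x t) v)) ` U"
proof -
  have "U \<noteq> {}" using U_nonempty t0 by auto
  have sub: "{t0..T} \<subseteq> {0..T}" using t0 by auto
  have KG1: "y \<in> G1" if "y \<in> K" for y using K(2) G_subset(3) that by auto
  obtain Mf B c where c: "c > 0"
    and Mf: "\<And>t y v. t \<in> {0..T} \<Longrightarrow> y \<in> K \<Longrightarrow> v \<in> U \<Longrightarrow> norm (f t y v) \<le> Mf"
    and B: "\<And>t y v. t \<in> {0..T} \<Longrightarrow> y \<in> K \<Longrightarrow> v \<in> U \<Longrightarrow> \<bar>\<eta> t y v\<bar> \<le> B"
    and \<eta>_lip: "\<And>t y z v. t \<in> {0..T} \<Longrightarrow> y \<in> K \<Longrightarrow> z \<in> K \<Longrightarrow> v \<in> U \<Longrightarrow> \<bar>\<eta> t y v - \<eta> t z v\<bar> \<le> c * norm (y - z)"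
    by (rule compact_bounds[OF K]) blast
  define F where "F = (\<lambda>t y v. (f t y v, \<eta> t y v))"
  define M where "M = Mf + B"
  have F_bound: "norm (F t y v) \<le> M" if "t \<in> {0..T}" "y \<in> K" "v \<in> U" for t y v
    using Mf[OF that] B[OF that] norm_Pair_le[of "f t y v" "\<eta> t y v"] by (simp add: F_def M_def)
  have F_lip: "norm (F t y v - F t y' v) \<le> (C + c) * norm (y - y')"
    if "t \<in> {0..T}" "y \<in> K" "y' \<in> K" "v \<in> U" for t y y' v
  proof -
    have "norm (f t y v - f t y' v) \<le> C * norm (y - y')" 
      using that K(2) by (intro lip_f) auto
    then show ?thesis
      using \<eta>_lip[OF that] norm_Pair_le[of "f t y v - f t y' v" "\<eta> t y v - \<eta> t y' v"]
      by (simp add: F_def algebra_simps)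
  qed
  have F_meas: "(\<lambda>t. F t (x t) v) \<in> borel_measurable (lebesgue_on {t0..T})" if "v \<in> U" for v
    unfolding F_def using that by (intro borel_measurable_Pair measurable_velocity sub x KG1) auto
  obtain D where D: "countable D" "D \<subseteq> U" "U \<subseteq> closure D" using separable by blast
  have "D \<noteq> {}" using D(3) \<open>U \<noteq> {}\<close> by auto
  obtain Q :: "((real^'n) \<times> real) set" where Q: "countable Q" "closure Q = UNIV"
    using separable[of "UNIV :: ((real^'n) \<times> real) set"] by (metis top.extremum_uniqueI)
  \<comment> \<open>The support function of the velocity set at the limit state. A countable
    supremum keeps it measurable, and continuity in the control makes it bound all of
    \<open>U\<close>.\<close>
  define h where "h = (\<lambda>q t. SUP v\<in>D. inner q (F t (x t) v))"
  have bound_q: "inner q (F t (x t) v) \<le> norm q * M" if "t \<in> {t0..T}" "v \<in> U" for q t v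
  proof -
    have "inner q (F t (x t) v) \<le> norm q * norm (F t (x t) v)" by (rule norm_cauchy_schwarz)
    also have "\<dots> \<le> norm q * M" using F_bound that x(2) sub by (intro mult_left_mono) auto
    finally show ?thesis .
  qed
  have bdd: "bdd_above ((\<lambda>v. inner q (F t (x t) v)) ` D)" if "t \<in> {t0..T}" for q t
  proof (rule bdd_aboveI2)
    fix v assume "v \<in> D"
    then show "inner q (F t (x t) v) \<le> norm q * M" using bound_q[OF that] D(2) by blast
  qed
  have h_ge: "inner q (F t (x t) v) \<le> h q t" if t: "t \<in> {t0..T}" and v: "v \<in> U" for q t v
  proof -
    have "continuous_on U (\<lambda>v. inner q (F t (x t) v))"
      unfolding F_def using continuous_velocity[of t "x t"] KG1 x(2) t sub by (intro continuous_intros) auto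
    then have cont: "continuous (at v within U) (\<lambda>v. inner q (F t (x t) v))"
      using v by (simp add: continuous_on_eq_continuous_within)
    obtain r where r: "\<And>n. r n \<in> D" "r \<longlonglongrightarrow> v"
      using D(3) v closure_sequential[of v D] by auto
    have "(\<lambda>n. inner q (F t (x t) (r n))) \<longlonglongrightarrow> inner q (F t (x t) v)"
      using continuous_within_tendsto_compose'[OF cont, of r sequentially] r D(2) by auto
    then show ?thesis
    proof (rule LIMSEQ_le_const2)
      show "\<exists>N. \<forall>n\<ge>N. inner q (F t (x t) (r n)) \<le> h q t"
        unfolding h_def using cSUP_upper[OF r(1) bdd[OF t]] by auto
    qed
  qed
  have h_le: "h q t \<le> b" if "\<And>v. v \<in> U \<Longrightarrow> inner q (F t (x t) v) \<le> b" for q t b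
    unfolding h_def using \<open>D \<noteq> {}\<close> D(2) that by (intro cSUP_least) auto
  have h_meas: "h q \<in> borel_measurable (lebesgue_on {t0..T})" for q
    unfolding h_def
  proof (rule borel_measurable_cSUP[OF D(1)])
    show "(\<lambda>t. inner q (F t (x t) v)) \<in> borel_measurable (lebesgue_on {t0..T})" if "v \<in> D" for v
      using F_meas D(2) that by (intro borel_measurable_inner) auto
  qed (use bdd in auto)
  have h_bound: "norm (h q t) \<le> norm q * M" if t: "t \<in> {t0..T}" for q t
  proof -
    obtain v where v: "v \<in> U" using \<open>U \<noteq> {}\<close> by blast
    have "\<bar>inner q (F t (x t) v)\<bar> \<le> norm q * norm (F t (x t) v)" by (rule Cauchy_Schwarz_ineq2)
    also have "\<dots> \<le> norm q * M" using F_bound t v x(2) sub by (intro mult_left_mono) auto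
    finally have "h q t \<ge> - (norm q * M)" using h_ge[OF t v, of q] by linarith
    moreover have "h q t \<le> norm q * M" by (rule h_le[OF bound_q[OF t]])
    ultimately show ?thesis by simp
  qed
  have h_int: "h q integrable_on {s..t}" if "t0 \<le> s" "t \<le> T" for q s t
    by (rule integrable_on_subinterval[OF bounded_measurable_integrable(2)[OF h_meas h_bound]])
      (use that in auto)
  have w_int: "w integrable_on {t0..T}" using z[of T] t0 by auto
  have w_sub: "(w has_integral (z t - z s)) {s..t}" if "t0 \<le> s" "s \<le> t" "t \<le> T" for s t
    using has_integral_primitive_diff[OF w_int that] integral_unique[OF z[of s]] integral_unique[OF z[of t]] that
    by simp
  have support: "inner q (z t - z s) \<le> integral {s..t} (h q)" if st: "t0 \<le> s" "s \<le> t" "t \<le> T" for q s t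
  proof (rule field_le_epsilon)
    fix e :: real assume "e > 0"
    \<comment> \<open>Replacing \<open>xs k\<close> by \<open>x\<close> costs
      \<open>norm q * (C + c) * d\<close> per unit time, over a time of at most \<open>T\<close>.
      Replacing \<open>zs k\<close> by \<open>z\<close> at two endpoints costs
      \<open>2 * d * norm q\<close>. The 1 keeps \<open>E\<close> positive when
      \<open>q = 0\<close>.\<close>
    define E where "E = norm q * ((C + c) * T + 2) + 1"
    have "E > 0" unfolding E_def using C_pos c t0
      by (intro add_nonneg_pos mult_nonneg_nonneg add_nonneg_nonneg) auto
    define d where "d = e / E"
    have "d > 0" using \<open>e > 0\<close> \<open>E > 0\<close> by (simp add: d_def)
    then obtain k where k: "\<And>t. t \<in> {t0..T} \<Longrightarrow> norm (xs k t - x t) < d"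
        "\<And>t. t \<in> {t0..T} \<Longrightarrow> norm (zs k t - z t) < d"
      using unif by blast
    have hi: "((\<lambda>r. inner q (F r (xs k r) (u k r))) has_integral inner q (zs k t - zs k s)) {s..t}"
      using has_integral_linear[OF zs[OF st, of k] bounded_linear_inner_right[of q]]
      by (simp add: comp_def F_def)
    have "inner q (zs k t - zs k s) = integral {s..t} (\<lambda>r. inner q (F r (xs k r) (u k r)))"
      using hi by (simp add: integral_unique)
    also have "\<dots> \<le> integral {s..t} (\<lambda>r. h q r + norm q * ((C + c) * d))"
    proof (rule integral_le)
      show "(\<lambda>r. inner q (F r (xs k r) (u k r))) integrable_on {s..t}"
        using hi by blast
      show "(\<lambda>r. h q r + norm q * ((C + c) * d)) integrable_on {s..t}"
        using st by (intro integrable_add h_int) auto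
      fix r assume "r \<in> {s..t}"
      then have r: "r \<in> {t0..T}" "r \<in> {0..T}" using st t0 by auto
      have v: "u k r \<in> U" using controlsD(2)[OF u r(1)] .
      have "inner q (F r (xs k r) (u k r)) = inner q (F r (x r) (u k r)) + inner q (F r (xs k r) (u k r) - F r (x r) (u k r))"
        by (simp add: inner_diff_right)
      also have "\<dots> \<le> h q r + norm q * norm (F r (xs k r) (u k r) - F r (x r) (u k r))"
        by (intro add_mono h_ge r v norm_cauchy_schwarz)
      also have "\<dots> \<le> h q r + norm q * ((C + c) * norm (xs k r - x r))"
        using F_lip[OF r(2) xK[OF r(1)] x(2)[OF r(1)] v] by (simp add: mult_left_mono)
      also have "\<dots> \<le> h q r + norm q * ((C + c) * d)"
        using k(1)[OF r(1)] C_pos c by (intro add_left_mono mult_left_mono) auto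
      finally show "inner q (F r (xs k r) (u k r)) \<le> h q r + norm q * ((C + c) * d)" .
    qed
    also have "\<dots> = integral {s..t} (h q) + norm q * ((C + c) * d) * (t - s)"
      using st by (subst Henstock_Kurzweil_Integration.integral_add) (auto intro!: h_int)
    also have "\<dots> \<le> integral {s..t} (h q) + norm q * ((C + c) * d) * T"
      using st t0 C_pos c \<open>d > 0\<close>
      by (intro add_left_mono mult_left_mono mult_nonneg_nonneg add_nonneg_nonneg) auto
    finally have 1: "inner q (zs k t - zs k s) \<le> integral {s..t} (h q) + norm q * ((C + c) * d) * T" .
    have "inner q ((z t - z s) - (zs k t - zs k s)) \<le> norm q * norm ((zs k s - z s) - (zs k t - z t))"
      using norm_cauchy_schwarz[of q "(z t - z s) - (zs k t - zs k s)"] by (simp add: algebra_simps)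
    also have "\<dots> \<le> norm q * (d + d)"
    proof (rule mult_left_mono)
      have "norm ((zs k s - z s) - (zs k t - z t)) \<le> norm (zs k s - z s) + norm (zs k t - z t)"
        by (rule norm_triangle_ineq4)
      also have "\<dots> \<le> d + d"
        using k(2)[of s] k(2)[of t] st by (intro add_mono) auto
      finally show "norm ((zs k s - z s) - (zs k t - z t)) \<le> d + d" .
    qed simp
    finally have "inner q (z t - z s) \<le> integral {s..t} (h q) + d * (norm q * ((C + c) * T + 2))"
      using 1 by (simp add: inner_diff_right algebra_simps)
    also have "d * (norm q * ((C + c) * T + 2)) \<le> d * E"
      using \<open>d > 0\<close> by (intro mult_left_mono) (auto simp: E_def)
    also have "d * E = e" using \<open>E > 0\<close> by (simp add: d_def)
    finally show "inner q (z t - z s) \<le> integral {s..t} (h q) + e" by simp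
  qed
  have AE_q: "AE t in lebesgue_on {t0..T}. inner q (w t) \<le> h q t" for q
  proof -
    \<comment> \<open>By \<open>support\<close> the increments of \<open>\<psi>\<close> are
      nonnegative, so its derivative \<open>h q t - inner q (w t)\<close> is nonnegative wherever it
      exists.\<close>
    define \<psi> where "\<psi> = (\<lambda>t. integral {t0..t} (\<lambda>r. h q r - inner q (w r)))"
    have hw: "(\<lambda>r. h q r - inner q (w r)) integrable_on {t0..T}"
      using w_int by (intro integrable_diff h_int integrable_linear[OF _ bounded_linear_inner_right, unfolded comp_def]) auto
    have mono: "\<psi> s \<le> \<psi> t" if st: "t0 \<le> s" "s \<le> t" "t \<le> T" for s t
    proof -
      have "\<psi> s + integral {s..t} (\<lambda>r. h q r - inner q (w r)) = \<psi> t"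
        unfolding \<psi>_def using st
        by (intro Henstock_Kurzweil_Integration.integral_combine integrable_on_subinterval[OF hw]) auto
      moreover have "((\<lambda>r. h q r - inner q (w r)) has_integral (integral {s..t} (h q) - inner q (z t - z s))) {s..t}"
        using st by (intro has_integral_diff integrable_integral h_int w_sub
            has_integral_linear[OF _ bounded_linear_inner_right, unfolded comp_def]) auto
      ultimately show ?thesis using support[OF st, of q] by (simp add: integral_unique)
    qed
    show ?thesis
    proof (rule AE_lebesgue_on_subset[OF integral_has_vector_derivative_AE[OF hw]])
      fix t assume t: "t \<in> {t0..T}"
        "((\<lambda>t. integral {t0..t} (\<lambda>r. h q r - inner q (w r))) has_vector_derivative h q t - inner q (w t)) (at t within {t0..T})"
      have "h q t - inner q (w t) \<ge> 0"
        by (rule nondecreasing_derivative_nonneg[OF t(2) _ t(1)]) (use t0 mono in \<open>auto simp: \<psi>_def\<close>)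
      then show "inner q (w t) \<le> h q t" by simp
    qed auto
  qed
  have "AE t in lebesgue_on {t0..T}. \<forall>q\<in>Q. inner q (w t) \<le> h q t"
    using AE_q Q(1) by (simp add: AE_ball_countable)
  then show ?thesis
  proof (rule AE_lebesgue_on_subset)
    fix t assume t: "t \<in> {t0..T}" and le: "\<forall>q\<in>Q. inner q (w t) \<le> h q t"
    then have tT: "t \<in> {0..T}" and xG: "x t \<in> G1" using sub KG1 x(2) by auto
    have "w t \<in> F t (x t) ` U"
    proof (rule mem_closed_convex_dense[OF _ _ _ Q(2)])
      show "closed (F t (x t) ` U)" "convex (F t (x t) ` U)"
        unfolding F_def by (rule closed_velocities[OF tT xG], rule convex_velocities[OF tT xG])
      show "norm v \<le> M" if "v \<in> F t (x t) ` U" for v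
        using that F_bound[OF tT x(2)[OF t]] by blast
      fix q b assume "q \<in> Q" "\<And>v. v \<in> F t (x t) ` U \<Longrightarrow> inner q v \<le> b"
      then show "inner q (w t) \<le> b" using le h_le[of q t b] by (meson image_eqI order_trans)
    qed
    then show "w t \<in> (\<lambda>v. (f t (x t) v, \<eta> t (x t) v)) ` U" by (simp add: F_def)
  qed auto
qed

end

section \<open>Passage to the limit along a minimising sequence\<close>

lemma has_integral_Pair:
  fixes g :: "'a::euclidean_space \<Rightarrow> 'b::euclidean_space" and h :: "'a \<Rightarrow> 'c::euclidean_space"
  assumes "(g has_integral i) S" "(h has_integral j) S"
  shows "((\<lambda>t. (g t, h t)) has_integral (i, j)) S"
proof -
  have "bounded_linear (\<lambda>x::'b. (x, 0::'c))" "bounded_linear (\<lambda>x::'c. (0::'b, x))"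
    by (intro bounded_linear_Pair bounded_linear_ident bounded_linear_zero)+
  from has_integral_add[OF has_integral_linear[OF assms(1) this(1)] has_integral_linear[OF assms(2) this(2)]]
  show ?thesis by (simp add: comp_def)
qed

context control_problem
begin

lemma optimal_exists:
  assumes t0: "t0 \<in> {0..<T}" and x0: "x0 \<in> G"
  obtains u x where "u \<in> controls U t0 T" "state_trajectory f G1 t0 T x0 u x"
    "value_function T U G1 f \<eta> \<sigma> t0 x0 = ereal (cost T \<eta> \<sigma> t0 u x)"
proof -
  obtain V where V: "value_function T U G1 f \<eta> \<sigma> t0 x0 = ereal V"
    using finite_value[OF t0 x0] by (cases "value_function T U G1 f \<eta> \<sigma> t0 x0") auto
  have V_le: "V \<le> cost T \<eta> \<sigma> t0 u x"
    if "u \<in> controls U t0 T" "state_trajectory f G1 t0 T x0 u x" for u x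
  proof -
    have "value_function T U G1 f \<eta> \<sigma> t0 x0 \<le> ereal (cost T \<eta> \<sigma> t0 u x)"
      unfolding value_function_def using that by (intro Inf_lower) blast
    then show ?thesis by (simp add: V)
  qed
  have "\<exists>u x. u \<in> controls U t0 T \<and> state_trajectory f G1 t0 T x0 u x \<and> cost T \<eta> \<sigma> t0 u x < V + 1 / real (Suc k)" for k
  proof -
    have "value_function T U G1 f \<eta> \<sigma> t0 x0 < ereal (V + 1 / real (Suc k))"
      by (simp add: V)
    then show ?thesis unfolding value_function_def Inf_less_iff by fastforce
  qed
  then obtain us xs where us: "\<And>k. us k \<in> controls U t0 T"
    and xs: "\<And>k. state_trajectory f G1 t0 T x0 (us k) (xs k)"
    and cost_less: "\<And>k. cost T \<eta> \<sigma> t0 (us k) (xs k) < V + 1 / real (Suc k)"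
    by metis
  define R where "R = 2 * (norm (x0 - a) + A1 * (T - t0)) * exp (2 * C * (T - t0))"
  define K where "K = closure G \<inter> cball a R"
  have K: "compact K" "K \<subseteq> closure G" by (auto simp: K_def intro: closed_Int_compact)
  have xK: "xs k t \<in> K" if "t \<in> {t0..T}" for k t
    using trajectory_bound[OF t0 x0 us xs that] trajectory(1)[OF t0 x0 us xs that] G_subset(2)
    by (auto simp: K_def R_def dist_norm norm_minus_commute)
  obtain Mf B where Mf: "Mf > 0" "\<And>t x u. t \<in> {0..T} \<Longrightarrow> x \<in> K \<Longrightarrow> u \<in> U \<Longrightarrow> norm (f t x u) \<le> Mf"
    and B: "B > 0" "\<And>t x u. t \<in> {0..T} \<Longrightarrow> x \<in> K \<Longrightarrow> u \<in> U \<Longrightarrow> \<bar>\<eta> t x u\<bar> \<le> B"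
    by (rule compact_bounds[OF K]) blast
  define F where "F = (\<lambda>k r. (f r (xs k r) (us k r), \<eta> r (xs k r) (us k r)))"
  define ys where "ys = (\<lambda>k t. integral {t0..t} (\<lambda>r. \<eta> r (xs k r) (us k r)))"
  define zs where "zs = (\<lambda>k t. (xs k t, ys k t))"
  define M where "M = Mf + B"
  have F_meas: "F k \<in> borel_measurable (lebesgue_on {t0..T})" for k
    unfolding F_def by (intro borel_measurable_Pair trajectory_measurable[OF t0 x0 us xs])
  have F_bound: "norm (F k t) \<le> M" if t: "t \<in> {t0..T}" for k t
  proof -
    have "t \<in> {0..T}" using t t0 by auto
    note * = this xK[OF t, of k] controlsD(2)[OF us[of k] t]
    show ?thesis
      using Mf(2)[OF *] B(2)[OF *]
        norm_Pair_le[of "f t (xs k t) (us k t)" "\<eta> t (xs k t) (us k t)"]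
      by (simp add: F_def M_def)
  qed
  have \<eta>_int: "(\<lambda>r. \<eta> r (xs k r) (us k r)) integrable_on {t0..T}"
    "integrable (lebesgue_on {t0..T}) (\<lambda>r. \<eta> r (xs k r) (us k r))" for k
  proof -
    have "norm (\<eta> t (xs k t) (us k t)) \<le> B" if t: "t \<in> {t0..T}" for t
      using B(2)[OF _ xK[OF t] controlsD(2)[OF us t]] t t0 by auto
    note bounded_measurable_integrable[OF trajectory_measurable(3)[OF t0 x0 us xs] this]
    then show "(\<lambda>r. \<eta> r (xs k r) (us k r)) integrable_on {t0..T}"
      "integrable (lebesgue_on {t0..T}) (\<lambda>r. \<eta> r (xs k r) (us k r))" by auto
  qed
  have cost_eq: "cost T \<eta> \<sigma> t0 (us k) (xs k) = \<sigma> (fst (zs k T)) + snd (zs k T)" for k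
    by (simp add: cost_def zs_def ys_def lebesgue_integral_eq_integral[OF \<eta>_int(2)])
  have zs_t0: "zs k t0 = (x0, 0)" for k
    using xs[of k] by (simp add: zs_def ys_def state_trajectory_def)
  have F_has: "(F k has_integral (zs k t - zs k s)) {s..t}" if st: "t0 \<le> s" "s \<le> t" "t \<le> T" for k s t
  proof -
    have "((\<lambda>r. \<eta> r (xs k r) (us k r)) has_integral (ys k t - ys k s)) {s..t}"
      unfolding ys_def by (rule has_integral_primitive_diff[OF \<eta>_int(1) st])
    then show ?thesis
      using has_integral_Pair[OF trajectory(3)[OF t0 x0 us xs st, of k]] by (simp add: F_def zs_def)
  qed
  have zs_eq: "zs k t = (x0, 0) + integral {t0..t} (F k)" if "t \<in> {t0..T}" for k t
    using integral_unique[OF F_has[of t0 t k]] that by (simp add: zs_t0)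
  have zs_lip: "norm (zs k t - zs k s) \<le> M * \<bar>t - s\<bar>" if "s \<in> {t0..T}" "t \<in> {t0..T}" for k s t
    by (rule integral_primitive(1)[OF F_meas F_bound zs_eq that])
  have "M > 0" using Mf(1) B(1) by (simp add: M_def)
  obtain z r where z: "continuous_on {t0..T} z" "strict_mono (r :: nat \<Rightarrow> nat)"
    and unif: "\<And>e. 0 < e \<Longrightarrow> \<exists>N. \<forall>n t. n \<ge> N \<and> t \<in> {t0..T} \<longrightarrow> norm (zs (r n) t - z t) < e"
  proof (rule Arzela_Ascoli[of "{t0..T}" zs "norm x0 + M * T"])
    fix k t assume t: "t \<in> {t0..T}"
    have "norm (zs k t) \<le> norm (zs k t0) + norm (zs k t - zs k t0)"
      by (metis add.commute diff_add_cancel norm_triangle_ineq)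
    also have "\<dots> \<le> norm x0 + M * (t - t0)"
      using zs_lip[of t0 t k] t by (simp add: zs_t0 norm_Pair)
    also have "\<dots> \<le> norm x0 + M * T" using t t0 \<open>M > 0\<close> by auto
    finally show "norm (zs k t) \<le> norm x0 + M * T" .
  next
    fix t e :: real assume t: "t \<in> {t0..T}" and "e > 0"
    show "\<exists>d>0. \<forall>n s. s \<in> {t0..T} \<and> norm (t - s) < d \<longrightarrow> norm (zs n t - zs n s) < e"
    proof (intro exI[of _ "e / M"] conjI allI impI)
      fix n s assume s: "s \<in> {t0..T} \<and> norm (t - s) < e / M"
      then have "M * \<bar>t - s\<bar> < e" using \<open>M > 0\<close> by (simp add: pos_less_divide_eq mult.commute)
      then show "norm (zs n t - zs n s) < e" using zs_lip[of s t n] s t by linarith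
    qed (use \<open>e > 0\<close> \<open>M > 0\<close> in simp)
  qed auto
  have lim: "(\<lambda>n. zs (r n) t) \<longlonglongrightarrow> z t" if t: "t \<in> {t0..T}" for t
  proof (rule LIMSEQ_I)
    fix e :: real assume "e > 0"
    then show "\<exists>N. \<forall>n\<ge>N. norm (zs (r n) t - z t) < e" using unif t by blast
  qed
  define x where "x = (\<lambda>t. fst (z t))"
  have z_lip: "norm (z t - z s) \<le> M * \<bar>t - s\<bar>" if "s \<in> {t0..T}" "t \<in> {t0..T}" for s t
    by (rule LIMSEQ_le_const2[OF tendsto_norm[OF tendsto_diff[OF lim lim]]]) (use that zs_lip in auto)
  have x_cont: "continuous_on {t0..T} x" unfolding x_def by (intro continuous_intros z)
  then have x_meas: "x \<in> borel_measurable (lebesgue_on {t0..T})"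
    by (rule continuous_imp_measurable_on_sets_lebesgue) auto
  have x_in: "x t \<in> K" if t: "t \<in> {t0..T}" for t
  proof (rule closed_sequentially[OF compact_imp_closed[OF K(1)]])
    show "(\<lambda>n. xs (r n) t) \<longlonglongrightarrow> x t"
      using tendsto_fst[OF lim[OF t]] by (simp add: zs_def x_def)
  qed (use xK[OF t] in auto)
  then have x_G1: "x t \<in> G1" if "t \<in> {t0..T}" for t using that K(2) G_subset(3) by blast
  have z_t0: "z t0 = (x0, 0)"
    using LIMSEQ_unique[OF lim[of t0]] zs_t0 t0 by auto
  \<comment> \<open>The uniform limit inherits the Lipschitz constant and hence has an integrable
    density, which at this point has no relation to \<open>f\<close> and
    \<open>\<eta>\<close>.\<close>
  obtain w where w: "\<And>t. t \<in> {t0..T} \<Longrightarrow> (w has_integral (z t - z t0)) {t0..t}"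
    using lipschitz_eq_integral[of t0 T z M] z_lip t0 by auto
  have w_int: "w integrable_on {t0..T}" using w[of T] t0 by auto
  have w_meas: "w \<in> borel_measurable (lebesgue_on {t0..T})"
    by (rule integrable_imp_measurable[OF w_int])
  have fst_le: "norm (fst v) \<le> norm v" for v :: "(real^'n) \<times> real"
    by (metis norm_fst_le prod.collapse)
  have w_in: "AE t in lebesgue_on {t0..T}. w t \<in> (\<lambda>v. (f t (x t) v, \<eta> t (x t) v)) ` U"
  proof (rule velocity_derivative_in_closure[OF t0 K, where u = "\<lambda>n. us (r n)" and xs = "\<lambda>n. xs (r n)"
          and zs = "\<lambda>n. zs (r n)" and z = z])
    fix e :: real assume "e > 0"
    then obtain N where N: "\<And>t. t \<in> {t0..T} \<Longrightarrow> norm (zs (r N) t - z t) < e" using unif by blast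
    have "norm (xs (r N) t - x t) \<le> norm (zs (r N) t - z t)" for t
      using fst_le[of "zs (r N) t - z t"] by (simp add: zs_def x_def)
    then show "\<exists>k. \<forall>t\<in>{t0..T}. norm (xs (r k) t - x t) < e \<and> norm (zs (r k) t - z t) < e"
      using N by (meson order_le_less_trans)
  qed (use us xK F_has x_meas x_in w trajectory_measurable(1)[OF t0 x0 us xs] in \<open>auto simp: F_def\<close>)
  obtain u0 where "u0 \<in> U" using U_nonempty t0 by auto
  obtain u where u: "u \<in> controls U t0 T"
    and wu: "AE t in lebesgue_on {t0..T}. w t = (f t (x t) (u t), \<eta> t (x t) (u t))"
    using velocity_selection[OF t0 \<open>u0 \<in> U\<close> x_meas x_G1 w_meas w_in] by blast
  have z_deriv: "AE t in lebesgue_on {t0..T}. (z has_vector_derivative (f t (x t) (u t), \<eta> t (x t) (u t))) (at t within {t0..T})"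
  proof -
    have "AE t in lebesgue_on {t0..T}. (z has_vector_derivative w t) (at t within {t0..T})"
      by (rule primitive_has_vector_derivative_AE[OF w_int, of z "z t0"]) (simp add: integral_unique[OF w])
    then show ?thesis using wu by eventually_elim simp
  qed
  have x_traj: "state_trajectory f G1 t0 T x0 u x"
    unfolding state_trajectory_def
  proof (intro conjI ballI)
    have "norm (x t - x s) \<le> M * \<bar>t - s\<bar>" if "s \<in> {t0..T}" "t \<in> {t0..T}" for s t
      using z_lip[OF that] fst_le[of "z t - z s"] by (simp add: x_def)
    then show "abs_continuous_on {t0..T} x" by (rule abs_continuous_on_lipschitz)
    show "x t0 = x0" by (simp add: x_def z_t0)
    show "AE t in lebesgue_on {t0..T}. (x has_vector_derivative f t (x t) (u t)) (at t within {t0..T})"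
      using z_deriv
    proof eventually_elim
      case (elim t)
      from bounded_linear.has_vector_derivative[OF bounded_linear_fst elim] show ?case
        by (simp add: x_def[symmetric])
    qed
  qed (fact x_G1)
  have ac: "abs_continuous_on {t0..T} z" by (rule abs_continuous_on_lipschitz[OF z_lip])
  \<comment> \<open>One control realises both components of \<open>w\<close>, so the limit
    \<open>snd (z T)\<close> of the running costs is the running cost of \<open>u\<close>, not
    merely an upper bound for it.\<close>
  have "((\<lambda>t. (f t (x t) (u t), \<eta> t (x t) (u t))) has_integral (z T - z t0)) {t0..T}"
    by (rule abs_continuous_on_has_integral[OF _ ac z_deriv]) (use t0 in auto)
  from has_integral_linear[OF this bounded_linear_snd]
  have int_\<eta>: "((\<lambda>t. \<eta> t (x t) (u t)) has_integral snd (z T)) {t0..T}"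
    by (simp add: comp_def z_t0)
  have "norm (\<eta> t (x t) (u t)) \<le> B" if t: "t \<in> {t0..T}" for t
    using B(2)[OF _ x_in[OF t] controlsD(2)[OF u t]] t t0 by auto
  from bounded_measurable_integrable(3)[OF trajectory_measurable(3)[OF t0 x0 u x_traj] this]
  have "(\<integral>t. \<eta> t (x t) (u t) \<partial>lebesgue_on {t0..T}) = snd (z T)"
    using integral_unique[OF int_\<eta>] by (subst lebesgue_integral_eq_integral) auto
  then have cost: "cost T \<eta> \<sigma> t0 u x = \<sigma> (x T) + snd (z T)" by (simp add: cost_def)
  have TT: "T \<in> {t0..T}" using t0 by auto
  have "(\<lambda>n. \<sigma> (fst (zs (r n) T)) + snd (zs (r n) T)) \<longlonglongrightarrow> \<sigma> (x T) + snd (z T)"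
  proof (intro tendsto_add)
    have "isCont \<sigma> (x T)" using cont_\<sigma> open_G1 x_G1[OF TT] by (simp add: continuous_on_eq_continuous_at)
    then show "(\<lambda>n. \<sigma> (fst (zs (r n) T))) \<longlonglongrightarrow> \<sigma> (x T)"
      by (rule isCont_tendsto_compose) (simp add: x_def tendsto_fst[OF lim[OF TT]])
  qed (rule tendsto_snd[OF lim[OF TT]])
  then have lim_cost: "(\<lambda>n. cost T \<eta> \<sigma> t0 (us (r n)) (xs (r n))) \<longlonglongrightarrow> cost T \<eta> \<sigma> t0 u x"
    by (simp add: cost_eq cost)
  have "(\<lambda>n. V + 1 / real (Suc (r n))) \<longlonglongrightarrow> V + 0"
    using LIMSEQ_subseq_LIMSEQ[OF LIMSEQ_inverse_real_of_nat z(2)]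
    by (intro tendsto_add tendsto_const) (simp add: comp_def inverse_eq_divide)
  then have "cost T \<eta> \<sigma> t0 u x \<le> V + 0"
    by (rule LIMSEQ_le[OF lim_cost]) (use cost_less less_imp_le in blast)
  then have "V = cost T \<eta> \<sigma> t0 u x" using V_le[OF u x_traj] by simp
  then show thesis using that[OF u x_traj] V by simp
qed

end

section \<open>Pontryagin's minimum principle\<close>

lemma has_derivative_directional_limit:
  fixes g :: "'a::euclidean_space \<Rightarrow> real"
  assumes "(g has_derivative (\<lambda>h. inner h d)) (at y)"
  shows "((\<lambda>s. (g (y + s *\<^sub>R h) - g y) / s) \<longlongrightarrow> inner h d) (at 0)"
proof -
  have "((\<lambda>s. y + s *\<^sub>R h) has_derivative (\<lambda>s. s *\<^sub>R h)) (at 0)"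
    by (auto intro!: derivative_eq_intros)
  moreover have "(g has_derivative (\<lambda>h. inner h d)) (at (y + 0 *\<^sub>R h))" using assms by simp
  ultimately have "((\<lambda>s. g (y + s *\<^sub>R h)) has_derivative (\<lambda>s. inner (s *\<^sub>R h) d)) (at 0)"
    by (rule has_derivative_compose)
  then have "((\<lambda>s. g (y + s *\<^sub>R h)) has_real_derivative inner h d) (at 0)"
    by (rule has_derivative_imp_has_field_derivative) (simp add: mult.commute)
  then show ?thesis by (simp add: DERIV_def)
qed

text \<open>In the direction \<open>d\<close> itself the difference quotients tend to
  \<open>inner d d\<close> and are at most \<open>c * norm d\<close>. If \<open>d = 0\<close>, what
  remains is \<open>c \<ge> 0\<close>, which the Lipschitz estimate at one other point
  provides.\<close>

lemma gradient_norm_le: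
  fixes g :: "'a::euclidean_space \<Rightarrow> real"
  assumes deriv: "(g has_derivative (\<lambda>h. inner h d)) (at y)" and S: "open S" "y \<in> S"
    and lip: "\<And>z. z \<in> S \<Longrightarrow> \<bar>g z - g y\<bar> \<le> c * norm (z - y)"
  shows "norm d \<le> c"
proof (cases "d = 0")
  case True
  obtain e where e: "e > 0" "ball y e \<subseteq> S" using S openE by blast
  obtain b :: 'a where b: "norm b = 1" using vector_choose_size[of 1] by auto
  have "y + (e / 2) *\<^sub>R b \<in> S" using e b by (intro subsetD[OF e(2)]) (simp add: dist_norm)
  from order_trans[OF abs_ge_zero lip[OF this]] have "0 \<le> c * (e / 2)" using e b by simp
  then show ?thesis using e True by (simp add: zero_le_mult_iff)
next
  case False
  have "((\<lambda>s. y + s *\<^sub>R d) \<longlongrightarrow> y + 0 *\<^sub>R d) (at 0)" by (intro tendsto_intros)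
  then have ev: "eventually (\<lambda>s. y + s *\<^sub>R d \<in> S) (at 0)" using S topological_tendstoD by fastforce
  have "inner d d \<le> c * norm d"
  proof (rule tendsto_upperbound[OF has_derivative_directional_limit[OF deriv]])
    show "eventually (\<lambda>s. (g (y + s *\<^sub>R d) - g y) / s \<le> c * norm d) (at 0)"
      using ev eventually_neq_at_within[of 0 "0::real" UNIV]
    proof eventually_elim
      case (elim s)
      have "(g (y + s *\<^sub>R d) - g y) / s \<le> \<bar>g (y + s *\<^sub>R d) - g y\<bar> / \<bar>s\<bar>"
        by (metis abs_divide abs_ge_self)
      also have "\<dots> \<le> (c * norm (s *\<^sub>R d)) / \<bar>s\<bar>"
        using lip[OF elim(1)] by (intro divide_right_mono) auto
      also have "\<dots> = c * norm d" using elim(2) by simp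
      finally show ?case .
    qed
  qed simp
  then have "norm d * norm d \<le> c * norm d" by (simp add: dot_square_norm power2_eq_square)
  then show ?thesis using False by simp
qed

text \<open>Differentiability in the form needed for perturbations: \<open>X n\<close> need not
  approach \<open>y\<close> along a line, only at the rate \<open>l n\<close>, and the remainder is
  then negligible against \<open>l n\<close>.\<close>

lemma first_order_remainder:
  fixes g :: "'a::euclidean_space \<Rightarrow> real"
  assumes deriv: "(g has_derivative (\<lambda>h. inner h d)) (at y)"
    and l: "\<And>n. l n > 0" "l \<longlonglongrightarrow> 0" and X: "\<And>n. norm (X n - y) \<le> k * l n"
  shows "(\<lambda>n. (g (X n) - g y - inner (X n - y) d) / l n) \<longlonglongrightarrow> 0"
proof (rule LIMSEQ_I)
  fix e :: real assume "e > 0"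
  have "k \<ge> 0" using order_trans[OF norm_ge_zero X[of 0]] l(1)[of 0] by (simp add: zero_le_mult_iff)
  define e' where "e' = e / (2 * (k + 1))"
  have "e' > 0" using \<open>e > 0\<close> \<open>k \<ge> 0\<close> by (simp add: e'_def)
  then obtain \<delta> where \<delta>: "\<delta> > 0" "\<And>z. norm (z - y) < \<delta> \<Longrightarrow> norm (g z - g y - inner (z - y) d) \<le> e' * norm (z - y)"
    using deriv unfolding has_derivative_at_alt by blast
  have "(\<lambda>n. k * l n) \<longlonglongrightarrow> k * 0" by (intro tendsto_intros l)
  then obtain N where N: "\<And>n. n \<ge> N \<Longrightarrow> \<bar>k * l n\<bar> < \<delta>"
    using \<delta>(1) LIMSEQ_D by fastforce
  show "\<exists>N. \<forall>n\<ge>N. norm ((g (X n) - g y - inner (X n - y) d) / l n - 0) < e"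
  proof (intro exI[of _ N] allI impI)
    fix n assume "N \<le> n"
    then have "norm (X n - y) < \<delta>" using N[of n] X[of n] by linarith
    then have "norm (g (X n) - g y - inner (X n - y) d) \<le> e' * norm (X n - y)" by (rule \<delta>(2))
    also have "\<dots> \<le> e' * (k * l n)" using X \<open>e' > 0\<close> by (intro mult_left_mono) auto
    finally have "norm ((g (X n) - g y - inner (X n - y) d) / l n) \<le> e' * k"
      using l(1)[of n] by (simp add: divide_le_eq mult.assoc)
    also have "e' * k < e" using \<open>e > 0\<close> \<open>k \<ge> 0\<close>
      by (simp add: e'_def field_simps add_nonneg_pos)
    finally show "norm ((g (X n) - g y - inner (X n - y) d) / l n - 0) < e" by simp
  qed
qed

text \<open>This reverses time in the adjoint equation, whose value is prescribed at
  \<open>T\<close>.\<close>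

lemma has_integral_reflect_shift:
  fixes g :: "real \<Rightarrow> 'a::euclidean_space"
  assumes "(g has_integral i) {s..t}"
  shows "((\<lambda>r. g (c - r)) has_integral i) {c - t..c - s}"
proof -
  have "((\<lambda>r. g (- r)) has_integral i) {-t..-s}"
    using assms by (subst has_integral_reflect_real) simp_all
  from has_integral_affinity'[of "\<lambda>r. g (- r)" i "-t" "-s" 1 "-c"] this
  show ?thesis by (simp add: algebra_simps)
qed

section \<open>The tube around an optimal process and the adjoint equation\<close>

text \<open>The radius \<open>r\<close> leaves room to move the state in every direction, both for
  perturbed trajectories and for difference quotients, without leaving a compact subset of
  \<open>G\<close>.\<close>

locale optimal_process = control_problem T U G G1 f \<eta> \<sigma> a A1 A2 C
  for T :: real
    and U :: "(real^'m) set"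
    and G G1 :: "(real^'n) set"
    and f :: "real \<Rightarrow> real^'n \<Rightarrow> real^'m \<Rightarrow> real^'n"
    and \<eta> :: "real \<Rightarrow> real^'n \<Rightarrow> real^'m \<Rightarrow> real"
    and \<sigma> :: "real^'n \<Rightarrow> real"
    and a :: "real^'n" and A1 A2 C :: real +
  fixes t0 :: real and x0 :: "real^'n" and u :: "real \<Rightarrow> real^'m" and x :: "real \<Rightarrow> real^'n" and r :: real
  assumes t0: "t0 \<in> {0..<T}" and x0: "x0 \<in> G"
    and u: "u \<in> controls U t0 T" and x: "state_trajectory f G1 t0 T x0 u x"
    and optimal: "\<And>v y. v \<in> controls U t0 T \<Longrightarrow> state_trajectory f G1 t0 T x0 v y \<Longrightarrow>
       cost T \<eta> \<sigma> t0 u x \<le> cost T \<eta> \<sigma> t0 v y"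
    and r_pos: "r > 0" and tube: "\<And>t. t \<in> {t0..T} \<Longrightarrow> cball (x t) r \<subseteq> G"
begin

lemmas x_cont = trajectory(2)[OF t0 x0 u x]
lemmas x_meas = trajectory_measurable(1)[OF t0 x0 u x]
lemmas x_in_G = trajectory(1)[OF t0 x0 u x]

lemma time: "t \<in> {t0..T} \<Longrightarrow> t \<in> {0..T}" using t0 by auto

text \<open>The union of the closed \<open>r\<close>-balls around the trajectory, written as a
  Minkowski sum of two compact sets, whose compactness is standard.\<close>

definition K where "K = {y + z | y z. y \<in> x ` {t0..T} \<and> z \<in> cball 0 r}"

lemma K_iff: "y \<in> K \<longleftrightarrow> (\<exists>t\<in>{t0..T}. y \<in> cball (x t) r)"
proof
  assume "y \<in> K"
  then show "\<exists>t\<in>{t0..T}. y \<in> cball (x t) r" unfolding K_def by (force simp: dist_norm)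
next
  assume "\<exists>t\<in>{t0..T}. y \<in> cball (x t) r"
  then obtain t where "t \<in> {t0..T}" "y \<in> cball (x t) r" by blast
  then show "y \<in> K" unfolding K_def
    by (intro CollectI exI[of _ "x t"] exI[of _ "y - x t"]) (auto simp: dist_norm norm_minus_commute)
qed

lemma K: "compact K" "K \<subseteq> G" "K \<subseteq> closure G"
proof -
  show "compact K" unfolding K_def
    by (rule compact_sums[OF compact_continuous_image[OF x_cont] compact_cball]) simp
  show "K \<subseteq> G" using K_iff tube by blast
  then show "K \<subseteq> closure G" using closure_subset by blast
qed

lemma x_in_K: "t \<in> {t0..T} \<Longrightarrow> x t \<in> K"
  using K_iff r_pos by force

lemma K_G1: "y \<in> K \<Longrightarrow> y \<in> G1" using K G_subset by blast

lemmas K_bounds = compact_bounds[OF K(1,3)]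

abbreviation ham where "ham t y v p \<equiv> hamiltonian f \<eta> t y v p"

definition gradH where "gradH t p = gradient (\<lambda>y. ham t y (u t) p) (x t)"

lemma ham_has_derivative:
  assumes t: "t \<in> {t0..T}"
  shows "((\<lambda>y. ham t y (u t) p) has_derivative (\<lambda>h. inner h (gradH t p))) (at (x t))"
  unfolding gradH_def
  by (rule hamiltonian_has_derivative[OF time[OF t] K_G1[OF x_in_K[OF t]] controlsD(2)[OF u t]])

text \<open>In the difference of the Hamiltonians for \<open>p\<close> and \<open>q\<close> the
  running cost cancels. What is left is Lipschitz in the state with constant
  \<open>C * norm (p - q)\<close>, and this bounds the difference of the gradients.\<close>

lemma gradH_lipschitz:
  assumes t: "t \<in> {t0..T}"
  shows "norm (gradH t p - gradH t q) \<le> C * norm (p - q)"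
proof (rule gradient_norm_le[OF _ open_G x_in_G[OF t]])
  show "((\<lambda>y. ham t y (u t) p - ham t y (u t) q) has_derivative (\<lambda>h. inner h (gradH t p - gradH t q))) (at (x t))"
    unfolding inner_diff_right by (intro has_derivative_diff ham_has_derivative t)
  fix z assume z: "z \<in> G"
  have "(ham t z (u t) p - ham t z (u t) q) - (ham t (x t) (u t) p - ham t (x t) (u t) q)
      = inner (p - q) (f t z (u t) - f t (x t) (u t))"
    by (simp add: hamiltonian_def inner_diff_left inner_diff_right)
  also have "\<bar>\<dots>\<bar> \<le> norm (p - q) * norm (f t z (u t) - f t (x t) (u t))" by (rule Cauchy_Schwarz_ineq2)
  also have "\<dots> \<le> norm (p - q) * (C * norm (z - x t))"
    using time[OF t] z x_in_G[OF t] G_subset controlsD(2)[OF u t] by (intro mult_left_mono lip_f) auto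
  finally show "\<bar>(ham t z (u t) p - ham t z (u t) q) - (ham t (x t) (u t) p - ham t (x t) (u t) q)\<bar> \<le> C * norm (p - q) * norm (z - x t)"
    by (simp add: ac_simps)
qed

text \<open>The Hamiltonian is Lipschitz on \<open>K\<close> uniformly in the control, and its
  gradient inherits the constant. Together these bounds later dominate the linearisation
  error.\<close>

lemma gradH_bound:
  obtains c where "c > 0" "\<And>t p. t \<in> {t0..T} \<Longrightarrow> norm (gradH t p) \<le> C * norm p + c"
    "\<And>t y z v p. t \<in> {t0..T} \<Longrightarrow> y \<in> K \<Longrightarrow> z \<in> K \<Longrightarrow> v \<in> U \<Longrightarrow>
      \<bar>ham t y v p - ham t z v p\<bar> \<le> (C * norm p + c) * norm (y - z)"
proof -
  obtain c where c: "c > 0"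
    "\<And>t y z v. t \<in> {0..T} \<Longrightarrow> y \<in> K \<Longrightarrow> z \<in> K \<Longrightarrow> v \<in> U \<Longrightarrow> \<bar>\<eta> t y v - \<eta> t z v\<bar> \<le> c * norm (y - z)"
    by (rule K_bounds) blast
  have lip: "\<bar>ham t y v p - ham t z v p\<bar> \<le> (C * norm p + c) * norm (y - z)"
    if "t \<in> {t0..T}" "y \<in> K" "z \<in> K" "v \<in> U" for t y z v p
  proof -
    have "\<bar>inner p (f t y v - f t z v)\<bar> \<le> norm p * norm (f t y v - f t z v)" by (rule Cauchy_Schwarz_ineq2)
    also have "\<dots> \<le> norm p * (C * norm (y - z))"
      using that K(3) time by (intro mult_left_mono lip_f) auto
    finally have "\<bar>inner p (f t y v - f t z v)\<bar> \<le> (C * norm p) * norm (y - z)" by (simp add: ac_simps)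
    moreover have "ham t y v p - ham t z v p = inner p (f t y v - f t z v) + (\<eta> t y v - \<eta> t z v)"
      by (simp add: hamiltonian_def inner_diff_right)
    ultimately show ?thesis using c(2)[OF time[OF that(1)] that(2-4)] by (simp add: distrib_right)
  qed
  show thesis
  proof (rule that[OF c(1) _ lip])
    fix t p assume t: "t \<in> {t0..T}"
    show "norm (gradH t p) \<le> C * norm p + c"
    proof (rule gradient_norm_le[OF ham_has_derivative[OF t], of "ball (x t) r"])
      fix z assume "z \<in> ball (x t) r"
      then have "z \<in> K" using K_iff t by (meson ball_subset_cball subsetD)
      then show "\<bar>ham t z (u t) p - ham t (x t) (u t) p\<bar> \<le> (C * norm p + c) * norm (z - x t)"
        using lip[OF t _ x_in_K[OF t] controlsD(2)[OF u t]] by blast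
    qed (use r_pos in auto)
  qed
qed

lemma ham_bound:
  assumes p: "continuous_on {t0..T} p"
  obtains B where "\<And>t y w. t \<in> {t0..T} \<Longrightarrow> y \<in> K \<Longrightarrow> w \<in> U \<Longrightarrow> \<bar>ham t y w (p t)\<bar> \<le> B"
proof -
  obtain M B where M: "\<And>t y v. t \<in> {0..T} \<Longrightarrow> y \<in> K \<Longrightarrow> v \<in> U \<Longrightarrow> norm (f t y v) \<le> M"
    and B: "\<And>t y v. t \<in> {0..T} \<Longrightarrow> y \<in> K \<Longrightarrow> v \<in> U \<Longrightarrow> \<bar>\<eta> t y v\<bar> \<le> B"
    by (rule K_bounds) blast
  obtain P where P: "\<And>t. t \<in> {t0..T} \<Longrightarrow> norm (p t) \<le> P"
    by (rule continuous_on_Icc_bounded[OF p]) blast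
  show thesis
  proof (rule that[of "P * M + B"])
    fix t y w assume t: "t \<in> {t0..T}" and yw: "y \<in> K" "w \<in> U"
    have "\<bar>inner (p t) (f t y w)\<bar> \<le> norm (p t) * norm (f t y w)" by (rule Cauchy_Schwarz_ineq2)
    also have "\<dots> \<le> P * M"
      using P[OF t] M[OF time[OF t] yw] order_trans[OF norm_ge_zero P[OF t]] by (intro mult_mono) auto
    finally show "\<bar>ham t y w (p t)\<bar> \<le> P * M + B"
      using B[OF time[OF t] yw] by (simp add: hamiltonian_def)
  qed
qed

lemma ham_measurable:
  assumes "y \<in> borel_measurable (lebesgue_on {t0..T})" "\<And>t. t \<in> {t0..T} \<Longrightarrow> y t \<in> G1"
    and "v \<in> controls U t0 T" and "p \<in> borel_measurable (lebesgue_on {t0..T})"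
  shows "(\<lambda>t. ham t (y t) (v t) (p t)) \<in> borel_measurable (lebesgue_on {t0..T})"
  unfolding hamiltonian_def
  using assms t0 controlsD[OF assms(3)]
  by (intro borel_measurable_add borel_measurable_inner measurable_velocity) auto

text \<open>Each component is a limit of difference quotients of the Hamiltonian at shifted states,
  and these are measurable in time although \<open>u\<close> is only measurable.\<close>

lemma gradH_measurable:
  assumes p: "p \<in> borel_measurable (lebesgue_on {t0..T})"
  shows "(\<lambda>t. gradH t (p t)) \<in> borel_measurable (lebesgue_on {t0..T})"
  unfolding borel_measurable_euclidean_space[of "\<lambda>t. gradH t (p t)"]
proof
  fix i :: "real^'n" assume i: "i \<in> Basis"
  \<comment> \<open>Starting the steps beyond \<open>N\<close> keeps every shifted state inside the
    tube.\<close>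
  obtain N where N: "1 / real (Suc N) < r" using nat_approx_posE[OF r_pos] .
  define s where "s = (\<lambda>n. 1 / real (Suc (n + N)))"
  have s: "s n > 0" "s n < r" for n
  proof -
    show "s n > 0" by (simp add: s_def)
    have "s n \<le> 1 / real (Suc N)" unfolding s_def by (intro divide_left_mono) auto
    then show "s n < r" using N by simp
  qed
  have s_lim: "filterlim s (at 0) sequentially"
    unfolding filterlim_at
  proof
    show "s \<longlonglongrightarrow> 0"
      using LIMSEQ_ignore_initial_segment[OF LIMSEQ_inverse_real_of_nat, of N]
      by (simp add: s_def inverse_eq_divide)
  qed (use s in \<open>auto simp: less_imp_neq[symmetric] intro!: always_eventually\<close>)
  show "(\<lambda>t. inner (gradH t (p t)) i) \<in> borel_measurable (lebesgue_on {t0..T})"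
  proof (rule borel_measurable_LIMSEQ_real)
    fix n
    have in_G1: "x t + s n *\<^sub>R i \<in> G1" if t: "t \<in> {t0..T}" for t
    proof -
      have "x t + s n *\<^sub>R i \<in> cball (x t) r"
        using s[of n] i by (simp add: dist_norm)
      then show ?thesis using K_iff K_G1 t by blast
    qed
    have "(\<lambda>t. x t + s n *\<^sub>R i) \<in> borel_measurable (lebesgue_on {t0..T})"
      by (intro borel_measurable_add x_meas) auto
    then show "(\<lambda>t. (ham t (x t + s n *\<^sub>R i) (u t) (p t) - ham t (x t) (u t) (p t)) / s n) \<in> borel_measurable (lebesgue_on {t0..T})"
      using in_G1 K_G1 x_in_K
      by (intro borel_measurable_divide borel_measurable_diff ham_measurable u p x_meas) auto
  next
    fix t assume "t \<in> space (lebesgue_on {t0..T})"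
    then have t: "t \<in> {t0..T}" by simp
    show "(\<lambda>n. (ham t (x t + s n *\<^sub>R i) (u t) (p t) - ham t (x t) (u t) (p t)) / s n) \<longlonglongrightarrow> inner (gradH t (p t)) i"
      using filterlim_compose[OF has_derivative_directional_limit[OF ham_has_derivative[OF t]] s_lim]
      by (simp add: inner_commute)
  qed
qed

text \<open>The existence result for integral equations starts at the left end. Reflecting time by
  \<open>\<rho>\<close> turns the terminal condition into an initial one, and \<open>gradH\<close>
  is globally Lipschitz and of linear growth in \<open>p\<close>.\<close>

lemma adjoint_exists:
  obtains p where "continuous_on {t0..T} p" "p T = pT"
    "\<And>t. t \<in> {t0..T} \<Longrightarrow> p t = p t0 + integral {t0..t} (\<lambda>s. - gradH s (p s))"
proof -
  obtain c where c: "c > 0" "\<And>t p. t \<in> {t0..T} \<Longrightarrow> norm (gradH t p) \<le> C * norm p + c"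
    by (rule gradH_bound) blast
  have refl: "t0 + T - s \<in> {t0..T}" if "s \<in> {t0..T}" for s using that by auto
  have int: "(\<lambda>t. gradH t (p t)) integrable_on {t0..T}" if p: "continuous_on {t0..T} p" for p
  proof -
    obtain B where B: "\<And>t. t \<in> {t0..T} \<Longrightarrow> norm (p t) \<le> B"
      by (rule continuous_on_Icc_bounded[OF p]) blast
    show ?thesis
    proof (rule bounded_measurable_integrable(2))
      show "(\<lambda>t. gradH t (p t)) \<in> borel_measurable (lebesgue_on {t0..T})"
        by (intro gradH_measurable continuous_imp_measurable_on_sets_lebesgue p) auto
      show "norm (gradH t (p t)) \<le> C * B + c" if "t \<in> {t0..T}" for t
        using c(2)[OF that, of "p t"] mult_left_mono[OF B[OF that], of C] C_pos by linarith
    qed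
  qed
  define \<rho> where "\<rho> = (\<lambda>s. t0 + T - s)"
  have \<rho>: "\<rho> s \<in> {t0..T}" if "s \<in> {t0..T}" for s using that by (auto simp: \<rho>_def)
  have reflect: "continuous_on {t0..T} (\<lambda>s. y (\<rho> s))" if "continuous_on {t0..T} y" for y :: "real \<Rightarrow> real^'n"
    by (rule continuous_on_compose2[OF that]) (auto simp: \<rho>_def intro!: continuous_intros)
  obtain P where P: "continuous_on {t0..T} P"
    "\<And>s. s \<in> {t0..T} \<Longrightarrow> P s = pT + integral {t0..s} (\<lambda>s. gradH (\<rho> s) (P s))"
  proof (rule caratheodory_existence[of t0 T C "\<lambda>s. gradH (\<rho> s)" c pT])
    fix y :: "real \<Rightarrow> real^'n" assume y: "continuous_on {t0..T} y"
    \<comment> \<open>Measurability of the reflected right-hand side is obtained through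
      integrability, which reflection preserves.\<close>
    have "(\<lambda>s. gradH s (y (\<rho> s))) integrable_on {t0..T}" by (rule int[OF reflect[OF y]])
    then obtain i where "((\<lambda>s. gradH s (y (\<rho> s))) has_integral i) {t0..T}" by blast
    from has_integral_reflect_shift[OF this, of "t0 + T"]
    have "((\<lambda>s. gradH (\<rho> s) (y s)) has_integral i) {t0..T}" by (simp add: \<rho>_def)
    then show "(\<lambda>s. gradH (\<rho> s) (y s)) \<in> borel_measurable (lebesgue_on {t0..T})"
      by (intro integrable_imp_measurable) blast
  next
    fix s y z assume "s \<in> {t0..T}"
    then show "norm (gradH (\<rho> s) y - gradH (\<rho> s) z) \<le> C * norm (y - z)"
      by (intro gradH_lipschitz \<rho>)
  next
    fix s assume "s \<in> {t0..T}"
    then show "norm (gradH (\<rho> s) 0) \<le> c" using c(2)[OF \<rho>, of s 0] by simp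
  qed (use t0 C_pos in auto)
  define p where "p = (\<lambda>t. P (\<rho> t))"
  have p_cont: "continuous_on {t0..T} p" unfolding p_def by (rule reflect[OF P(1)])
  have p_eq: "p t = pT + integral {t..T} (\<lambda>s. gradH s (p s))" if t: "t \<in> {t0..T}" for t
  proof -
    have "(\<lambda>s. gradH s (p s)) integrable_on {t..T}"
      using t by (intro integrable_on_subinterval[OF int[OF p_cont]]) auto
    then have "((\<lambda>s. gradH s (p s)) has_integral integral {t..T} (\<lambda>s. gradH s (p s))) {t..T}" by blast
    from has_integral_reflect_shift[OF this, of "t0 + T"]
    have "integral {t0..\<rho> t} (\<lambda>s. gradH (\<rho> s) (P s)) = integral {t..T} (\<lambda>s. gradH s (p s))"
      by (intro integral_unique) (simp add: \<rho>_def p_def)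
    then show ?thesis using P(2)[OF \<rho>[OF t]] by (simp add: p_def)
  qed
  show thesis
  proof (rule that[OF p_cont])
    show "p T = pT" using p_eq[of T] t0 by simp
    fix t assume t: "t \<in> {t0..T}"
    have "integral {t0..t} (\<lambda>s. gradH s (p s)) + integral {t..T} (\<lambda>s. gradH s (p s)) = integral {t0..T} (\<lambda>s. gradH s (p s))"
      using t by (intro Henstock_Kurzweil_Integration.integral_combine int[OF p_cont]) auto
    then show "p t = p t0 + integral {t0..t} (\<lambda>s. - gradH s (p s))"
      using p_eq[OF t] p_eq[of t0] t0 by (simp add: algebra_simps)
  qed
qed

lemma x_lipschitz:
  obtains M where "M > 0" "\<And>s t. s \<in> {t0..T} \<Longrightarrow> t \<in> {t0..T} \<Longrightarrow> norm (x t - x s) \<le> M * \<bar>t - s\<bar>"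
proof -
  obtain M where M: "M > 0" "\<And>t y v. t \<in> {0..T} \<Longrightarrow> y \<in> K \<Longrightarrow> v \<in> U \<Longrightarrow> norm (f t y v) \<le> M"
    by (rule K_bounds) blast
  show thesis
  proof (rule that[OF M(1)])
    show "norm (x t - x s) \<le> M * \<bar>t - s\<bar>" if "s \<in> {t0..T}" "t \<in> {t0..T}" for s t
    proof (rule integral_primitive(1)[OF trajectory_measurable(2)[OF t0 x0 u x] _ _ that])
      show "norm (f t (x t) (u t)) \<le> M" if "t \<in> {t0..T}" for t
        using M(2)[OF time[OF that] x_in_K[OF that] controlsD(2)[OF u that]] .
      show "x t = x t0 + integral {t0..t} (\<lambda>r. f r (x r) (u r))" if "t \<in> {t0..T}" for t
        using integral_unique[OF trajectory(3)[OF t0 x0 u x, of t0 t]] that by simp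
    qed
  qed
qed

section \<open>Convexified perturbations and the first variation\<close>

text \<open>The mixed velocity is prescribed instead of a control, because the control that realises
  it depends on the state \<open>X\<close> and can only be selected once \<open>X\<close> is
  known.\<close>

definition convex_perturbation where
  "convex_perturbation v l X \<longleftrightarrow> X t0 = x0 \<and>
    (AE t in lebesgue_on {t0..T}. (X has_vector_derivative
      ((1 - l) *\<^sub>R f t (X t) (u t) + l *\<^sub>R f t (X t) (v t))) (at t within {t0..T}))"

text \<open>The velocity is a convex combination of those of \<open>u\<close> and \<open>v\<close> at the perturbed state, hence
  it is realised by a control.\<close>

lemma convex_perturbation_cost:
  assumes v: "v \<in> controls U t0 T" and l: "0 < l" "l \<le> 1"
    and X: "convex_perturbation v l X" "abs_continuous_on {t0..T} X" "\<And>t. t \<in> {t0..T} \<Longrightarrow> X t \<in> K"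
  shows "cost T \<eta> \<sigma> t0 u x \<le> \<sigma> (X T) + integral {t0..T} (\<lambda>t. (1 - l) * \<eta> t (X t) (u t) + l * \<eta> t (X t) (v t))"
proof -
  let ?F = "\<lambda>t w. (f t (X t) w, \<eta> t (X t) w)"
  have X_meas: "X \<in> borel_measurable (lebesgue_on {t0..T})"
    by (intro continuous_imp_measurable_on_sets_lebesgue abs_continuous_on_imp_continuous_on X) auto
  have X_G1: "X t \<in> G1" if "t \<in> {t0..T}" for t using X(3) K_G1 that by blast
  have sub: "{t0..T} \<subseteq> {0..T}" using t0 by auto
  define w where "w = (\<lambda>t. (1 - l) *\<^sub>R ?F t (u t) + l *\<^sub>R ?F t (v t))"
  have F_meas: "(\<lambda>t. ?F t (c t)) \<in> borel_measurable (lebesgue_on {t0..T})" if "c \<in> controls U t0 T" for c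
    by (intro borel_measurable_Pair measurable_velocity sub X_meas) (use that X_G1 controlsD[OF that] in auto)
  have w_meas: "w \<in> borel_measurable (lebesgue_on {t0..T})"
    unfolding w_def by (intro borel_measurable_add borel_measurable_scaleR F_meas u v) auto
  have "w t \<in> ?F t ` U" if t: "t \<in> {t0..T}" for t
    unfolding w_def using l controlsD(2)[OF u t] controlsD(2)[OF v t]
    by (intro convexD_alt[OF convex_velocities[OF time[OF t] X_G1[OF t]]]) auto
  then have "AE t in lebesgue_on {t0..T}. w t \<in> ?F t ` U" by (intro AE_I2) auto
  then obtain q where q: "q \<in> controls U t0 T" and wq: "AE t in lebesgue_on {t0..T}. w t = ?F t (q t)"
    using velocity_selection[OF t0 _ X_meas X_G1 w_meas] controlsD(2)[OF u, of t0] t0 by force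
  have traj: "state_trajectory f G1 t0 T x0 q X"
    unfolding state_trajectory_def
  proof (intro conjI ballI)
    show "AE t in lebesgue_on {t0..T}. (X has_vector_derivative f t (X t) (q t)) (at t within {t0..T})"
      using wq X(1)[unfolded convex_perturbation_def, THEN conjunct2]
      by eventually_elim (auto simp: w_def)
  qed (use X X_G1 in \<open>auto simp: convex_perturbation_def\<close>)
  obtain B where B: "\<And>t y v. t \<in> {0..T} \<Longrightarrow> y \<in> K \<Longrightarrow> v \<in> U \<Longrightarrow> \<bar>\<eta> t y v\<bar> \<le> B"
    by (rule K_bounds) blast
  have int: "integrable (lebesgue_on {t0..T}) (\<lambda>t. \<eta> t (X t) (q t))"
    by (rule bounded_measurable_integrable(3)[OF trajectory_measurable(3)[OF t0 x0 q traj], of B])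
      (use B time X(3) controlsD(2)[OF q] in auto)
  have "(\<integral>t. \<eta> t (X t) (q t) \<partial>lebesgue_on {t0..T}) = integral {t0..T} (\<lambda>t. \<eta> t (X t) (q t))"
    by (rule lebesgue_integral_eq_integral[OF int]) auto
  also have "\<dots> = integral {t0..T} (\<lambda>t. (1 - l) * \<eta> t (X t) (u t) + l * \<eta> t (X t) (v t))"
  proof (rule integral_spike)
    show "negligible {t\<in>{t0..T}. \<not> w t = ?F t (q t)}" using wq by (simp add: AE_lebesgue_on_iff_negligible)
  qed (auto simp: w_def)
  finally show ?thesis using optimal[OF q traj] by (simp add: cost_def)
qed

text \<open>Composed with the projection onto the tube, the mixed velocity is bounded and globally
  Lipschitz, so a solution exists on the whole interval. Gronwall keeps it within
  \<open>k * l \<le> r\<close> of \<open>x\<close>, where the projection is the identity, so it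
  solves the unprojected equation as well.\<close>

lemma convex_perturbation_exists:
  assumes v: "v \<in> controls U t0 T"
  obtains k M where "k > 0"
    "\<And>l. 0 < l \<Longrightarrow> l \<le> 1 \<Longrightarrow> k * l \<le> r \<Longrightarrow> \<exists>X. convex_perturbation v l X \<and>
      (\<forall>t\<in>{t0..T}. X t \<in> K \<and> norm (X t - x t) \<le> k * l) \<and>
      (\<forall>s\<in>{t0..T}. \<forall>t\<in>{t0..T}. norm (X t - X s) \<le> M * \<bar>t - s\<bar>)"
proof -
  obtain M where M: "M > 0" "\<And>t y v. t \<in> {0..T} \<Longrightarrow> y \<in> K \<Longrightarrow> v \<in> U \<Longrightarrow> norm (f t y v) \<le> M"
    by (rule K_bounds) blast
  have sub: "{t0..T} \<subseteq> {0..T}" using t0 by auto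
  \<comment> \<open>At the state \<open>x s\<close> the mixed velocity differs from that of
    \<open>u\<close> by at most \<open>2 * M * l\<close>; \<open>k * l\<close> is Gronwall's bound
    for this inhomogeneity and zero initial difference.\<close>
  define k where "k = 2 * (2 * M * (T - t0)) * exp (2 * C * (T - t0))"
  have "k > 0" using M(1) t0 by (simp add: k_def)
  define \<pi> where "\<pi> = (\<lambda>t y. x t + closest_point (cball 0 r) (y - x t))"
  have \<pi>_in: "\<pi> t y \<in> K" if t: "t \<in> {t0..T}" for t y
  proof -
    have "closest_point (cball 0 r) (y - x t) \<in> cball 0 r"
      using r_pos by (intro closest_point_in_set) auto
    then have "\<pi> t y \<in> cball (x t) r" by (simp add: \<pi>_def dist_norm)
    then show ?thesis using K_iff t by blast
  qed
  have \<pi>_lip: "norm (\<pi> t y - \<pi> t z) \<le> norm (y - z)" for t y z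
    using closest_point_lipschitz[of "cball 0 r" "y - x t" "z - x t"] r_pos by (simp add: \<pi>_def dist_norm)
  have \<pi>_id: "\<pi> t y = y" if "norm (y - x t) \<le> r" for t y
    using closest_point_self[of "y - x t" "cball 0 r"] that by (simp add: \<pi>_def)
  have \<pi>_x: "\<pi> t (x t) = x t" for t using \<pi>_id[of "x t" t] r_pos by simp
  show thesis
  proof (rule that[OF \<open>k > 0\<close>, of M])
    fix l :: real assume l: "0 < l" "l \<le> 1" "k * l \<le> r"
    define g where "g = (\<lambda>t y. (1 - l) *\<^sub>R f t (\<pi> t y) (u t) + l *\<^sub>R f t (\<pi> t y) (v t))"
    have norm_conv: "norm ((1 - l) *\<^sub>R y + l *\<^sub>R z) \<le> b" if "norm y \<le> b" "norm z \<le> b" for y z :: "real^'n" and b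
    proof -
      have "norm ((1 - l) *\<^sub>R y + l *\<^sub>R z) \<le> (1 - l) * norm y + l * norm z"
        using norm_triangle_ineq[of "(1 - l) *\<^sub>R y" "l *\<^sub>R z"] l by simp
      also have "\<dots> \<le> (1 - l) * b + l * b" using l that by (intro add_mono mult_left_mono) auto
      finally show ?thesis by (simp add: algebra_simps)
    qed
    have g_bound: "norm (g t y) \<le> M" if t: "t \<in> {t0..T}" for t y
      unfolding g_def by (intro norm_conv M(2) time t \<pi>_in controlsD(2)[OF u] controlsD(2)[OF v])
    have g_lip: "norm (g t y - g t z) \<le> C * norm (y - z)" if t: "t \<in> {t0..T}" for t y z
    proof -
      have fl: "norm (f t (\<pi> t y) c - f t (\<pi> t z) c) \<le> C * norm (y - z)" if "c \<in> U" for c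
      proof -
        have "norm (f t (\<pi> t y) c - f t (\<pi> t z) c) \<le> C * norm (\<pi> t y - \<pi> t z)"
          using \<pi>_in[OF t] K(3) that by (intro lip_f time t) auto
        also have "\<dots> \<le> C * norm (y - z)" using \<pi>_lip C_pos by simp
        finally show ?thesis .
      qed
      have "g t y - g t z = (1 - l) *\<^sub>R (f t (\<pi> t y) (u t) - f t (\<pi> t z) (u t)) + l *\<^sub>R (f t (\<pi> t y) (v t) - f t (\<pi> t z) (v t))"
        by (simp add: g_def algebra_simps)
      then show ?thesis
        using norm_conv[OF fl[OF controlsD(2)[OF u t]] fl[OF controlsD(2)[OF v t]]] by simp
    qed
    have g_meas: "(\<lambda>t. g t (y t)) \<in> borel_measurable (lebesgue_on {t0..T})" if y: "continuous_on {t0..T} y" for y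
    proof -
      have "continuous_on {t0..T} (\<lambda>t. \<pi> t (y t))"
        unfolding \<pi>_def using r_pos
        by (intro continuous_intros x_cont y continuous_on_compose2[OF continuous_on_closest_point[of "cball 0 r" UNIV]]) auto
      then have m: "(\<lambda>t. \<pi> t (y t)) \<in> borel_measurable (lebesgue_on {t0..T})"
        by (rule continuous_imp_measurable_on_sets_lebesgue) auto
      show ?thesis unfolding g_def
        by (intro borel_measurable_add borel_measurable_scaleR borel_measurable_const measurable_velocity(1) sub m)
          (use \<pi>_in K_G1 controlsD[OF u] controlsD[OF v] in auto)
    qed
    obtain X where X: "continuous_on {t0..T} X"
      "\<And>t. t \<in> {t0..T} \<Longrightarrow> X t = x0 + integral {t0..t} (\<lambda>s. g s (X s))"
      using caratheodory_existence[of t0 T C g M x0] t0 C_pos g_meas g_lip g_bound by auto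
    note prim = integral_primitive[OF g_meas[OF X(1)] g_bound X(2)]
    have g_int: "(\<lambda>s. g s (X s)) integrable_on {t0..T}"
      by (rule bounded_measurable_integrable(2)[OF g_meas[OF X(1)] g_bound])
    have close: "norm (X t - x t) \<le> k * l" if t: "t \<in> {t0..T}" for t
    proof -
      have x_t0: "x t0 = x0" "X t0 = x0" using x X(2)[of t0] t0 by (auto simp: state_trajectory_def)
      have "norm (X t - x t) \<le> 2 * (norm (X t0 - x t0) + (2 * M * l) * (T - t0)) * exp (2 * C * (T - t0))"
      proof (rule gronwall_norm[where h = "\<lambda>s. g s (X s) - f s (x s) (u s)"])
        fix s assume s: "s \<in> {t0..T}"
        have "((\<lambda>s. g s (X s)) has_integral (X s - x0)) {t0..s}"
          using X(2)[OF s] integrable_on_subinterval[OF g_int, of t0 s] s by (auto simp: has_integral_integral)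
        from has_integral_diff[OF this trajectory(3)[OF t0 x0 u x, of t0 s]]
        show "((\<lambda>s. g s (X s) - f s (x s) (u s)) has_integral (X s - x s - (X t0 - x t0))) {t0..s}"
          using s by (simp add: x_t0)
        have us: "u s \<in> U" and vs: "v s \<in> U" using controlsD(2)[OF u s] controlsD(2)[OF v s] .
        have "g s (x s) - f s (x s) (u s) = l *\<^sub>R (f s (x s) (v s) - f s (x s) (u s))"
          by (simp add: g_def \<pi>_x algebra_simps)
        moreover have "norm (f s (x s) (v s) - f s (x s) (u s)) \<le> M + M"
          using M(2)[OF time[OF s] x_in_K[OF s] us] M(2)[OF time[OF s] x_in_K[OF s] vs]
          by (intro norm_triangle_le_diff add_mono) auto
        ultimately have "norm (g s (x s) - f s (x s) (u s)) \<le> l * (2 * M)" using l by simp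
        moreover have "norm (g s (X s) - f s (x s) (u s)) \<le> norm (g s (X s) - g s (x s)) + norm (g s (x s) - f s (x s) (u s))"
          by (metis diff_add_cancel diff_diff_eq2 norm_triangle_ineq add_diff_eq)
        ultimately show "norm (g s (X s) - f s (x s) (u s)) \<le> 2 * M * l + C * norm (X s - x s)"
          using g_lip[OF s, of "X s" "x s"] by (simp add: ac_simps)
      qed (use C_pos M(1) l t in \<open>auto intro!: continuous_intros X(1) x_cont\<close>)
      then show ?thesis by (simp add: k_def x_t0 ac_simps)
    qed
    have X_id: "\<pi> t (X t) = X t" if "t \<in> {t0..T}" for t
      using close[OF that] l by (intro \<pi>_id) linarith
    show "\<exists>X. convex_perturbation v l X \<and>
      (\<forall>t\<in>{t0..T}. X t \<in> K \<and> norm (X t - x t) \<le> k * l) \<and>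
      (\<forall>s\<in>{t0..T}. \<forall>t\<in>{t0..T}. norm (X t - X s) \<le> M * \<bar>t - s\<bar>)"
    proof (intro exI[of _ X] conjI ballI)
      have "AE t in lebesgue_on {t0..T}. (X has_vector_derivative
        ((1 - l) *\<^sub>R f t (X t) (u t) + l *\<^sub>R f t (X t) (v t))) (at t within {t0..T})"
        by (rule AE_lebesgue_on_subset[OF prim(3)]) (auto simp: g_def X_id)
      then show "convex_perturbation v l X"
        using X(2)[of t0] t0 by (simp add: convex_perturbation_def)
      show "X t \<in> K" if "t \<in> {t0..T}" for t using \<pi>_in[OF that, of "X t"] X_id[OF that] by simp
    qed (use X close prim in auto)
  qed
qed

text \<open>Because \<open>p T\<close> is the gradient of \<open>\<sigma>\<close>, the cost
  difference between perturbed and optimal process is the integral of \<open>E n\<close> plus the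
  Taylor remainder of \<open>\<sigma>\<close>. It is nonnegative; after division by
  \<open>l n\<close> the remainders vanish in the limit and only the effect of exchanging the
  controls is left.\<close>

lemma first_variation:
  assumes v: "v \<in> controls U t0 T"
    and p: "continuous_on {t0..T} p" "p T = gradient \<sigma> (x T)"
      "\<And>t. t \<in> {t0..T} \<Longrightarrow> p t = p t0 + integral {t0..t} (\<lambda>s. - gradH s (p s))"
  shows "0 \<le> integral {t0..T} (\<lambda>t. ham t (x t) (v t) (p t) - ham t (x t) (u t) (p t))"
proof -
  let ?I = "{t0..T}"
  have TT: "T \<in> ?I" using t0 by auto
  obtain k M where k: "k > 0" and ex: "\<And>l. 0 < l \<Longrightarrow> l \<le> 1 \<Longrightarrow> k * l \<le> r \<Longrightarrow>
      \<exists>X. convex_perturbation v l X \<and>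
      (\<forall>t\<in>{t0..T}. X t \<in> K \<and> norm (X t - x t) \<le> k * l) \<and>
      (\<forall>s\<in>{t0..T}. \<forall>t\<in>{t0..T}. norm (X t - X s) \<le> M * \<bar>t - s\<bar>)"
    using convex_perturbation_exists[OF v] by blast
  have "r / k > 0" using r_pos k by simp
  then obtain N where N: "1 / real (Suc N) < r / k" by (rule nat_approx_posE)
  \<comment> \<open>The shift by \<open>N\<close> makes all members small enough for the perturbed
    states to stay in the tube.\<close>
  define l where "l = (\<lambda>n. 1 / real (Suc (n + N)))"
  have l: "0 < l n" "l n \<le> 1" "k * l n \<le> r" for n
  proof -
    have "l n \<le> 1 / real (Suc N)" unfolding l_def by (intro divide_left_mono) auto
    then have "l n \<le> r / k" using N by linarith
    then show "k * l n \<le> r" using k by (simp add: pos_le_divide_eq mult.commute)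
  qed (auto simp: l_def)
  have l_lim: "l \<longlonglongrightarrow> 0"
    using LIMSEQ_ignore_initial_segment[OF LIMSEQ_inverse_real_of_nat, of N]
    by (simp add: l_def inverse_eq_divide)
  have "\<exists>X. \<forall>n. convex_perturbation v (l n) (X n) \<and>
      (\<forall>t\<in>?I. X n t \<in> K \<and> norm (X n t - x t) \<le> k * l n) \<and>
      (\<forall>s\<in>?I. \<forall>t\<in>?I. norm (X n t - X n s) \<le> M * \<bar>t - s\<bar>)"
    by (intro choice allI ex l)
  then obtain X where X_pert: "\<And>n. convex_perturbation v (l n) (X n)"
    and X_in: "\<And>n t. t \<in> ?I \<Longrightarrow> X n t \<in> K" and X_close: "\<And>n t. t \<in> ?I \<Longrightarrow> norm (X n t - x t) \<le> k * l n"
    and X_lip: "\<And>n s t. s \<in> ?I \<Longrightarrow> t \<in> ?I \<Longrightarrow> norm (X n t - X n s) \<le> M * \<bar>t - s\<bar>"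
    by blast
  have X_t0: "X n t0 = x0" and X_deriv: "AE t in lebesgue_on ?I. (X n has_vector_derivative
        ((1 - l n) *\<^sub>R f t (X n t) (u t) + l n *\<^sub>R f t (X n t) (v t))) (at t within ?I)" for n
    using X_pert[of n] by (simp_all add: convex_perturbation_def)
  have X_ac: "abs_continuous_on ?I (X n)" for n by (rule abs_continuous_on_lipschitz[OF X_lip])
  note X_cont = abs_continuous_on_imp_continuous_on[OF X_ac]
  obtain P where P: "\<And>t. t \<in> ?I \<Longrightarrow> norm (p t) \<le> P"
    by (rule continuous_on_Icc_bounded[OF p(1)]) blast
  obtain c where c: "c > 0" "\<And>t p. t \<in> {t0..T} \<Longrightarrow> norm (gradH t p) \<le> C * norm p + c"
    "\<And>t y z v p. t \<in> {t0..T} \<Longrightarrow> y \<in> K \<Longrightarrow> z \<in> K \<Longrightarrow> v \<in> U \<Longrightarrow>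
      \<bar>ham t y v p - ham t z v p\<bar> \<le> (C * norm p + c) * norm (y - z)"
    by (rule gradH_bound) blast
  define L where "L = C * P + c"
  have CPL: "C * norm (p t) + c \<le> L" if "t \<in> ?I" for t
    using P[OF that] C_pos by (simp add: L_def)
  have gradH_L: "norm (gradH t (p t)) \<le> L" if "t \<in> ?I" for t
    using c(2)[OF that, of "p t"] CPL[OF that] by linarith
  have ham_L: "\<bar>ham t y w (p t) - ham t z w (p t)\<bar> \<le> L * norm (y - z)"
    if "t \<in> ?I" "y \<in> K" "z \<in> K" "w \<in> U" for t y z w
    using order_trans[OF c(3)[OF that] mult_right_mono[OF CPL[OF that(1)] norm_ge_zero]] .
  have "P \<ge> 0" using order_trans[OF norm_ge_zero P[OF TT]] .
  then have "L > 0" using C_pos c(1) by (simp add: L_def add_nonneg_pos)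
  obtain B where B: "\<And>t y v. t \<in> {0..T} \<Longrightarrow> y \<in> K \<Longrightarrow> v \<in> U \<Longrightarrow> \<bar>\<eta> t y v\<bar> \<le> B"
    by (rule K_bounds) blast
  obtain Bh where Bh: "\<And>t y w. t \<in> ?I \<Longrightarrow> y \<in> K \<Longrightarrow> w \<in> U \<Longrightarrow> \<bar>ham t y w (p t)\<bar> \<le> Bh"
    by (rule ham_bound[OF p(1)]) blast
  have p_meas: "p \<in> borel_measurable (lebesgue_on ?I)"
    by (intro continuous_imp_measurable_on_sets_lebesgue p) auto
  have gp_meas: "(\<lambda>s. - gradH s (p s)) \<in> borel_measurable (lebesgue_on ?I)"
    by (intro borel_measurable_uminus gradH_measurable p_meas)
  have gp_bound: "norm (- gradH s (p s)) \<le> L" if "s \<in> ?I" for s using gradH_L[OF that] by simp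
  note p_prim = integral_primitive[OF gp_meas gp_bound p(3)]
  have p_deriv: "AE t in lebesgue_on ?I. (p has_vector_derivative - gradH t (p t)) (at t within ?I)"
    by (rule p_prim(3))
  obtain Mx where Mx: "\<And>s t. s \<in> ?I \<Longrightarrow> t \<in> ?I \<Longrightarrow> norm (x t - x s) \<le> Mx * \<bar>t - s\<bar>"
    by (rule x_lipschitz) blast
  have x_deriv: "AE t in lebesgue_on ?I. (x has_vector_derivative f t (x t) (u t)) (at t within ?I)"
    and x_t0: "x t0 = x0" using x by (auto simp: state_trajectory_def)
  define D where "D = (\<lambda>n t. X n t - x t)"
  \<comment> \<open>This is the derivative of \<open>inner (p t) (D n t)\<close> by the product rule
    and the adjoint equation. Its integral is the boundary term at \<open>T\<close>, since
    \<open>D n\<close> vanishes at \<open>t0\<close>.\<close>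
  define d where "d = (\<lambda>n t. inner (p t) ((1 - l n) *\<^sub>R f t (X n t) (u t) + l n *\<^sub>R f t (X n t) (v t) - f t (x t) (u t))
      + inner (- gradH t (p t)) (D n t))"
  have d_int: "(d n has_integral inner (p T) (D n T)) ?I" for n
  proof -
    define \<phi> where "\<phi> = (\<lambda>t. inner (p t) (D n t))"
    have "norm (\<phi> t - \<phi> s) \<le> (P * (M + Mx) + L * r) * \<bar>t - s\<bar>" if st: "s \<in> ?I" "t \<in> ?I" for s t
    proof -
      have "\<phi> t - \<phi> s = inner (p t) (D n t - D n s) + inner (p t - p s) (D n s)"
        by (simp add: \<phi>_def inner_diff_left inner_diff_right)
      also have "norm \<dots> \<le> norm (p t) * norm (D n t - D n s) + norm (p t - p s) * norm (D n s)"
        by (intro norm_triangle_le add_mono) (auto intro: Cauchy_Schwarz_ineq2)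
      also have "\<dots> \<le> P * ((M + Mx) * \<bar>t - s\<bar>) + (L * \<bar>t - s\<bar>) * r"
      proof (intro add_mono mult_mono P st p_prim(1))
        have "D n t - D n s = (X n t - X n s) - (x t - x s)" by (simp add: D_def)
        then have "norm (D n t - D n s) \<le> norm (X n t - X n s) + norm (x t - x s)"
          by (simp only: norm_triangle_ineq4)
        then show "norm (D n t - D n s) \<le> (M + Mx) * \<bar>t - s\<bar>"
          using X_lip[OF st, of n] Mx[OF st] by (simp add: distrib_right)
        show "norm (D n s) \<le> r" using X_close[OF st(1), of n] l(3)[of n] by (simp add: D_def)
      qed (use \<open>P \<ge> 0\<close> \<open>L > 0\<close> in auto)
      finally show ?thesis by (simp add: algebra_simps)
    qed
    then have ac: "abs_continuous_on ?I \<phi>" by (rule abs_continuous_on_lipschitz)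
    have "AE t in lebesgue_on ?I. (\<phi> has_vector_derivative d n t) (at t within ?I)"
      using X_deriv[of n] x_deriv p_deriv
    proof eventually_elim
      case (elim t)
      have "(D n has_vector_derivative ((1 - l n) *\<^sub>R f t (X n t) (u t) + l n *\<^sub>R f t (X n t) (v t) - f t (x t) (u t))) (at t within ?I)"
        unfolding D_def by (intro has_vector_derivative_diff elim)
      from bounded_bilinear.has_vector_derivative[OF bounded_bilinear_inner elim(3) this]
      show ?case unfolding \<phi>_def d_def .
    qed
    from abs_continuous_on_has_integral[OF _ ac this] t0
    have "(d n has_integral (\<phi> T - \<phi> t0)) ?I" by auto
    then show ?thesis by (simp add: \<phi>_def D_def X_t0 x_t0)
  qed
  have \<eta>_meas: "(\<lambda>t. \<eta> t (y t) (w t)) integrable_on ?I"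
    "integrable (lebesgue_on ?I) (\<lambda>t. \<eta> t (y t) (w t))"
    if "w \<in> controls U t0 T" "continuous_on ?I y" "\<And>t. t \<in> ?I \<Longrightarrow> y t \<in> K" for w and y :: "real \<Rightarrow> real^'n"
  proof -
    have "(\<lambda>t. \<eta> t (y t) (w t)) \<in> borel_measurable (lebesgue_on ?I)"
      using t0 that K_G1 controlsD(2)[OF that(1)]
      by (intro measurable_velocity(2) controlsD(1)[OF that(1)] continuous_imp_measurable_on_sets_lebesgue[OF that(2)]) auto
    moreover have "norm (\<eta> t (y t) (w t)) \<le> B" if "t \<in> ?I" for t
      using B[OF time[OF that]] \<open>t \<in> ?I\<close> \<open>\<And>t. t \<in> ?I \<Longrightarrow> y t \<in> K\<close> controlsD(2)[OF \<open>w \<in> controls U t0 T\<close>] by simp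
    ultimately show "(\<lambda>t. \<eta> t (y t) (w t)) integrable_on ?I"
      "integrable (lebesgue_on ?I) (\<lambda>t. \<eta> t (y t) (w t))"
      using bounded_measurable_integrable by blast+
  qed
  define E where "E = (\<lambda>n t. ((1 - l n) * \<eta> t (X n t) (u t) + l n * \<eta> t (X n t) (v t) - \<eta> t (x t) (u t)) + d n t)"
  \<comment> \<open>\<open>R\<close> is the error of linearising the Hamiltonian in the state with
    \<open>u\<close> fixed, and \<open>S\<close> the effect of exchanging the controls at the
    perturbed state, which enters with weight \<open>l n\<close>. The adjoint equation supplies
    exactly the linear term that \<open>R\<close> subtracts.\<close>
  define R where "R = (\<lambda>n t. ham t (X n t) (u t) (p t) - ham t (x t) (u t) (p t) - inner (X n t - x t) (gradH t (p t)))"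
  define S where "S = (\<lambda>n t. ham t (X n t) (v t) (p t) - ham t (X n t) (u t) (p t))"
  have E_eq: "E n t = R n t + l n * S n t" for n t
    by (simp add: E_def d_def D_def R_def S_def hamiltonian_def inner_add_right inner_diff_right
        inner_diff_left inner_commute algebra_simps)
  have E_int: "E n integrable_on ?I"
    and E_ge: "- (\<sigma> (X n T) - \<sigma> (x T) - inner (X n T - x T) (p T)) \<le> integral ?I (E n)" for n
  proof -
    have i1: "(\<lambda>t. (1 - l n) * \<eta> t (X n t) (u t) + l n * \<eta> t (X n t) (v t)) integrable_on ?I"
      by (intro integrable_add integrable_on_mult_right \<eta>_meas u v X_cont X_in)
    have i2: "(\<lambda>t. \<eta> t (x t) (u t)) integrable_on ?I"
      by (intro \<eta>_meas u x_cont x_in_K)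
    have i3: "d n integrable_on ?I" using d_int by blast
    show "E n integrable_on ?I" unfolding E_def by (intro integrable_add integrable_diff i1 i2 i3)
    have "cost T \<eta> \<sigma> t0 u x = \<sigma> (x T) + integral ?I (\<lambda>t. \<eta> t (x t) (u t))"
      unfolding cost_def by (subst lebesgue_integral_eq_integral) (auto intro!: \<eta>_meas u x_cont x_in_K)
    then have "\<sigma> (x T) + integral ?I (\<lambda>t. \<eta> t (x t) (u t)) \<le> \<sigma> (X n T)
        + integral ?I (\<lambda>t. (1 - l n) * \<eta> t (X n t) (u t) + l n * \<eta> t (X n t) (v t))"
      using convex_perturbation_cost[OF v l(1,2) X_pert X_ac X_in] by simp
    moreover have "integral ?I (E n) = integral ?I (\<lambda>t. (1 - l n) * \<eta> t (X n t) (u t) + l n * \<eta> t (X n t) (v t))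
        - integral ?I (\<lambda>t. \<eta> t (x t) (u t)) + inner (p T) (D n T)"
      unfolding E_def
      by (simp add: Henstock_Kurzweil_Integration.integral_add[OF integrable_diff[OF i1 i2] i3]
          Henstock_Kurzweil_Integration.integral_diff[OF i1 i2] integral_unique[OF d_int])
    ultimately show "- (\<sigma> (X n T) - \<sigma> (x T) - inner (X n T - x T) (p T)) \<le> integral ?I (E n)"
      by (simp add: D_def inner_commute)
  qed
  have us: "u t \<in> U" and vs: "v t \<in> U" if "t \<in> ?I" for t
    using controlsD(2)[OF u that] controlsD(2)[OF v that] .
  have conv: "(\<lambda>n. integral ?I (\<lambda>t. E n t / l n)) \<longlonglongrightarrow> integral ?I (\<lambda>t. ham t (x t) (v t) (p t) - ham t (x t) (u t) (p t))"
  proof (rule dominated_convergence(2))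
    show "(\<lambda>t. E n t / l n) integrable_on ?I" for n by (intro integrable_on_divide E_int)
    show "(\<lambda>t. 2 * L * k + 2 * Bh) integrable_on ?I" by auto
    fix t assume t: "t \<in> ?I"
    \<comment> \<open>Differentiability gives no uniformity in \<open>t\<close>; the dominating
      constant comes from the Lipschitz bounds, and differentiability is used only for the pointwise
      limit.\<close>
    show "norm (E n t / l n) \<le> 2 * L * k + 2 * Bh" for n
    proof -
      have "\<bar>inner (X n t - x t) (gradH t (p t))\<bar> \<le> norm (X n t - x t) * norm (gradH t (p t))"
        by (rule Cauchy_Schwarz_ineq2)
      also have "\<dots> \<le> norm (X n t - x t) * L" using gradH_L[OF t] by (intro mult_left_mono) auto
      finally have "\<bar>R n t\<bar> \<le> 2 * L * norm (X n t - x t)"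
        using ham_L[OF t X_in[OF t, of n] x_in_K[OF t] us[OF t]] by (simp add: R_def mult.commute)
      also have "\<dots> \<le> 2 * L * (k * l n)" using X_close[OF t, of n] \<open>L > 0\<close> by (intro mult_left_mono) auto
      finally have "\<bar>R n t / l n\<bar> \<le> 2 * L * k"
        using l(1)[of n] by (simp add: divide_le_eq mult.assoc)
      moreover have "\<bar>S n t\<bar> \<le> Bh + Bh"
        unfolding S_def
        by (rule order_trans[OF abs_triangle_ineq4 add_mono[OF Bh[OF t X_in[OF t] vs[OF t]] Bh[OF t X_in[OF t] us[OF t]]]])
      moreover have "E n t / l n = R n t / l n + S n t" using l(1)[of n] by (simp add: E_eq add_divide_distrib)
      ultimately show ?thesis unfolding real_norm_def mult_2[of Bh]
        by (simp only: order_trans[OF abs_triangle_ineq add_mono])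
    qed
    have ham_lim: "(\<lambda>n. ham t (X n t) w (p t)) \<longlonglongrightarrow> ham t (x t) w (p t)" if w: "w \<in> U" for w
    proof (rule Lim_null_comparison[THEN LIM_zero_cancel])
      have "norm (ham t (X n t) w (p t) - ham t (x t) w (p t)) \<le> L * (k * l n)" for n
        unfolding real_norm_def using \<open>L > 0\<close>
        by (intro order_trans[OF ham_L[OF t X_in[OF t] x_in_K[OF t] w] mult_left_mono[OF X_close[OF t]]]) simp
      then show "\<forall>\<^sub>F n in sequentially. norm (ham t (X n t) w (p t) - ham t (x t) w (p t)) \<le> L * (k * l n)" by simp
      show "(\<lambda>n. L * (k * l n)) \<longlonglongrightarrow> 0" using tendsto_mult_left[OF tendsto_mult_left[OF l_lim, of k], of L] by simp
    qed
    have "(\<lambda>n. R n t / l n) \<longlonglongrightarrow> 0"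
      unfolding R_def by (rule first_order_remainder[OF ham_has_derivative[OF t] l(1) l_lim X_close[OF t]])
    moreover have "(\<lambda>n. S n t) \<longlonglongrightarrow> ham t (x t) (v t) (p t) - ham t (x t) (u t) (p t)"
      unfolding S_def by (intro tendsto_diff ham_lim us vs t)
    ultimately have "(\<lambda>n. R n t / l n + S n t) \<longlonglongrightarrow> 0 + (ham t (x t) (v t) (p t) - ham t (x t) (u t) (p t))"
      by (rule tendsto_add)
    moreover have "E n t / l n = R n t / l n + S n t" for n using l(1)[of n] by (simp add: E_eq add_divide_distrib)
    ultimately show "(\<lambda>n. E n t / l n) \<longlonglongrightarrow> ham t (x t) (v t) (p t) - ham t (x t) (u t) (p t)" by simp
  qed
  \<comment> \<open>This is where the terminal condition on \<open>p\<close> enters: the first-order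
    change of \<open>\<sigma>\<close> cancels against the boundary term.\<close>
  have "(\<lambda>n. (\<sigma> (X n T) - \<sigma> (x T) - inner (X n T - x T) (p T)) / l n) \<longlonglongrightarrow> 0"
  proof (rule first_order_remainder[OF _ l(1) l_lim X_close[OF TT]])
    obtain d where d: "(\<sigma> has_derivative d) (at (x T))"
      using diff_\<sigma>[OF K_G1[OF x_in_K[OF TT]]] unfolding differentiable_def by blast
    then show "(\<sigma> has_derivative (\<lambda>h. inner h (p T))) (at (x T))"
      using has_derivative_gradient(2)[OF d] by (simp add: p(2) gderiv_def)
  qed
  from tendsto_add[OF conv this]
  have "(\<lambda>n. integral ?I (\<lambda>t. E n t / l n) + (\<sigma> (X n T) - \<sigma> (x T) - inner (X n T - x T) (p T)) / l n)
      \<longlonglongrightarrow> integral ?I (\<lambda>t. ham t (x t) (v t) (p t) - ham t (x t) (u t) (p t))" by simp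
  then show ?thesis
  proof (rule LIMSEQ_le_const)
    have "0 \<le> integral ?I (\<lambda>t. E n t / l n) + (\<sigma> (X n T) - \<sigma> (x T) - inner (X n T - x T) (p T)) / l n" for n
    proof -
      have "0 \<le> (integral ?I (E n) + (\<sigma> (X n T) - \<sigma> (x T) - inner (X n T - x T) (p T))) / l n"
        using E_ge[of n] l(1)[of n] by simp
      then show ?thesis by (simp add: add_divide_distrib)
    qed
    then show "\<exists>N. \<forall>n\<ge>N. 0 \<le> integral ?I (\<lambda>t. E n t / l n) + (\<sigma> (X n T) - \<sigma> (x T) - inner (X n T - x T) (p T)) / l n"
      by blast
  qed
qed

section \<open>The pointwise minimum condition\<close>

lemma minimum_condition:
  assumes p: "continuous_on {t0..T} p" "p T = gradient \<sigma> (x T)"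
      "\<And>t. t \<in> {t0..T} \<Longrightarrow> p t = p t0 + integral {t0..t} (\<lambda>s. - gradH s (p s))"
  shows "AE t in lebesgue_on {t0..T}. u t \<in> minimizers U f \<eta> t (x t) (p t)"
proof -
  let ?M = "lebesgue_on {t0..T}"
  have p_meas: "p \<in> borel_measurable ?M"
    by (intro continuous_imp_measurable_on_sets_lebesgue p) auto
  have x_G1: "x t \<in> G1" if "t \<in> {t0..T}" for t using K_G1 x_in_K that by blast
  obtain D where D: "countable D" "D \<subseteq> U" "U \<subseteq> closure D" using separable by blast
  have AE_w: "AE t in ?M. ham t (x t) (u t) (p t) \<le> ham t (x t) w (p t)" if w: "w \<in> U" for w
  proof -
    have wc: "(\<lambda>_. w) \<in> controls U t0 T" using w by (simp add: controls_def)
    define v where "v = (\<lambda>t. if ham t (x t) w (p t) < ham t (x t) (u t) (p t) then w else u t)"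
    have m: "(\<lambda>t. ham t (x t) w (p t)) \<in> borel_measurable ?M" "(\<lambda>t. ham t (x t) (u t) (p t)) \<in> borel_measurable ?M"
      using ham_measurable[OF x_meas x_G1 wc p_meas] ham_measurable[OF x_meas x_G1 u p_meas] by auto
    have "v \<in> borel_measurable ?M"
      unfolding v_def using controlsD(1)[OF u] by (intro measurable_If borel_measurable_const borel_measurable_less m)
    then have v: "v \<in> controls U t0 T" using w controlsD(2)[OF u] by (auto simp: controls_def v_def)
    let ?g = "\<lambda>t. ham t (x t) (u t) (p t) - ham t (x t) (v t) (p t)"
    \<comment> \<open>The sign holds at every time, because \<open>v\<close> leaves \<open>u\<close>
      only where this lowers the Hamiltonian. As the integral of \<open>?g\<close> turns out to be
      nonpositive, \<open>?g\<close> vanishes almost everywhere.\<close>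
    have g_nonneg: "?g t \<ge> 0" for t by (simp add: v_def)
    obtain B where B: "\<And>t y w. t \<in> {t0..T} \<Longrightarrow> y \<in> K \<Longrightarrow> w \<in> U \<Longrightarrow> \<bar>ham t y w (p t)\<bar> \<le> B"
      by (rule ham_bound[OF p(1)]) blast
    have g_int: "integrable ?M ?g"
    proof (rule bounded_measurable_integrable(3))
      show "?g \<in> borel_measurable ?M"
        by (intro borel_measurable_diff m ham_measurable x_meas x_G1 v p_meas)
      show "norm (?g t) \<le> 2 * B" if t: "t \<in> {t0..T}" for t
        using B[OF t x_in_K[OF t] controlsD(2)[OF u t]] B[OF t x_in_K[OF t] controlsD(2)[OF v t]] by simp
    qed
    have "integral\<^sup>L ?M ?g = integral {t0..T} ?g" by (rule lebesgue_integral_eq_integral[OF g_int]) auto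
    also have "\<dots> = - integral {t0..T} (\<lambda>t. ham t (x t) (v t) (p t) - ham t (x t) (u t) (p t))"
      by (subst integral_neg[symmetric]) simp
    also have "\<dots> \<le> 0" using first_variation[OF v p] by simp
    finally have "integral\<^sup>L ?M ?g \<le> 0" .
    moreover have "integral\<^sup>L ?M ?g \<ge> 0" by (rule integral_nonneg_AE) (use g_nonneg in auto)
    ultimately have "integral\<^sup>L ?M ?g = 0" by simp
    then have "AE t in ?M. ?g t = 0"
      using integral_nonneg_eq_0_iff_AE[OF g_int] g_nonneg by auto
    then show ?thesis by eventually_elim (auto simp: v_def split: if_splits)
  qed
  \<comment> \<open>The exceptional null set depends on \<open>w\<close>, hence the restriction to
    countably many controls; continuity of the Hamiltonian in the control recovers all of
    \<open>U\<close>.\<close>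
  have "AE t in ?M. \<forall>w\<in>D. ham t (x t) (u t) (p t) \<le> ham t (x t) w (p t)"
    using AE_w D(1,2) by (subst AE_ball_countable) auto
  then show ?thesis
  proof (rule AE_lebesgue_on_subset)
    fix t assume t: "t \<in> {t0..T}" and le: "\<forall>w\<in>D. ham t (x t) (u t) (p t) \<le> ham t (x t) w (p t)"
    have cont: "continuous_on U (\<lambda>w. ham t (x t) w (p t))"
      unfolding hamiltonian_def using continuous_velocity[OF time[OF t] x_G1[OF t]]
      by (intro continuous_intros)
    have "ham t (x t) (u t) (p t) \<le> ham t (x t) w (p t)" if w: "w \<in> U" for w
    proof -
      obtain s where s: "\<And>n. s n \<in> D" "s \<longlonglongrightarrow> w"
        using D(3) w closure_sequential[of w D] by auto
      have "(\<lambda>n. ham t (x t) (s n) (p t)) \<longlonglongrightarrow> ham t (x t) w (p t)"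
      proof (rule continuous_on_tendsto_compose[OF cont s(2) w])
        show "\<forall>\<^sub>F n in sequentially. s n \<in> U" using s(1) D(2) by (intro always_eventually allI) blast
      qed
      then show ?thesis by (rule LIMSEQ_le_const) (use le s(1) in auto)
    qed
    then show "u t \<in> minimizers U f \<eta> t (x t) (p t)"
      using controlsD(2)[OF u t] by (auto simp: minimizers_def is_arg_min_def not_less)
  qed auto
qed

lemma characteristic_solution_exists:
  obtains p p0 where "characteristic_solution T U G f \<eta> t0 x0 p0 x p u"
proof -
  obtain p where p: "continuous_on {t0..T} p" "p T = gradient \<sigma> (x T)"
      "\<And>t. t \<in> {t0..T} \<Longrightarrow> p t = p t0 + integral {t0..t} (\<lambda>s. - gradH s (p s))"
    by (rule adjoint_exists[where pT = "gradient \<sigma> (x T)"]) blast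
  obtain P where P: "\<And>t. t \<in> {t0..T} \<Longrightarrow> norm (p t) \<le> P"
    by (rule continuous_on_Icc_bounded[OF p(1)]) blast
  obtain c where c: "\<And>t p. t \<in> {t0..T} \<Longrightarrow> norm (gradH t p) \<le> C * norm p + c"
    by (rule gradH_bound) blast
  have "p \<in> borel_measurable (lebesgue_on {t0..T})"
    by (intro continuous_imp_measurable_on_sets_lebesgue p) auto
  then have m: "(\<lambda>s. - gradH s (p s)) \<in> borel_measurable (lebesgue_on {t0..T})"
    by (intro borel_measurable_uminus gradH_measurable)
  have b: "norm (- gradH s (p s)) \<le> C * P + c" if "s \<in> {t0..T}" for s
  proof -
    have "C * norm (p s) \<le> C * P" using P[OF that] C_pos by simp
    then show ?thesis unfolding norm_minus_cancel using c[OF that, of "p s"] by linarith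
  qed
  note prim = integral_primitive[OF m b p(3)]
  have "state_trajectory f G t0 T x0 u x"
    using x x_in_G by (simp add: state_trajectory_def)
  then show thesis
    using that[of "p t0" p] u prim(2,3) minimum_condition[OF p]
    by (simp add: characteristic_solution_def gradH_def)
qed

end

section \<open>Characteristics that attain the value, and their rescaling\<close>

context control_problem
begin

text \<open>Every characteristic solution carries an admissible process, so the minimum principle is
  needed only for attainment.\<close>

lemma characteristic_cost_ge:
  assumes "characteristic_solution T U G f \<eta> t0 x0 p0 x p u"
  shows "value_function T U G1 f \<eta> \<sigma> t0 x0 \<le> ereal (cost T \<eta> \<sigma> t0 u x)"
proof -
  have "u \<in> controls U t0 T" "state_trajectory f G1 t0 T x0 u x"
    using assms G_subset by (auto simp: characteristic_solution_def state_trajectory_def)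
  then show ?thesis unfolding value_function_def by (intro Inf_lower) blast
qed

lemma optimal_characteristic_exists:
  assumes t0: "t0 \<in> {0..<T}" and x0: "x0 \<in> G"
  obtains x p u p0 where "characteristic_solution T U G f \<eta> t0 x0 p0 x p u"
    "value_function T U G1 f \<eta> \<sigma> t0 x0 = ereal (cost T \<eta> \<sigma> t0 u x)"
proof -
  obtain u x where u: "u \<in> controls U t0 T" and x: "state_trajectory f G1 t0 T x0 u x"
    and V: "value_function T U G1 f \<eta> \<sigma> t0 x0 = ereal (cost T \<eta> \<sigma> t0 u x)"
    by (rule optimal_exists[OF t0 x0])
  have opt: "cost T \<eta> \<sigma> t0 u x \<le> cost T \<eta> \<sigma> t0 v y"
    if "v \<in> controls U t0 T" "state_trajectory f G1 t0 T x0 v y" for v y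
  proof -
    have "value_function T U G1 f \<eta> \<sigma> t0 x0 \<le> ereal (cost T \<eta> \<sigma> t0 v y)"
      unfolding value_function_def using that by (intro Inf_lower) blast
    then show ?thesis by (simp add: V)
  qed
  \<comment> \<open>The tube radius is a distance from the compact trajectory within which the open
    set \<open>G\<close> is not left.\<close>
  have "compact (x ` {t0..T})" "x ` {t0..T} \<subseteq> G"
    using trajectory[OF t0 x0 u x] by (auto intro!: compact_continuous_image)
  then obtain r where r: "r > 0" "(\<Union>y\<in>x ` {t0..T}. cball y r) \<subseteq> G"
    using compact_subset_open_imp_cball_epsilon_subset[OF _ open_G] by metis
  have tube: "cball (x t) r \<subseteq> G" if "t \<in> {t0..T}" for t using r(2) that by blast
  interpret optimal_process T U G G1 f \<eta> \<sigma> a A1 A2 C t0 x0 u x r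
    by unfold_locales (fact t0 x0 u x opt r(1) tube)+
  obtain p p0 where "characteristic_solution T U G f \<eta> t0 x0 p0 x p u"
    by (rule characteristic_solution_exists)
  then show thesis using V by (rule that)
qed

text \<open>Without running cost the Hamiltonian is linear in \<open>p\<close>, so its gradient in
  the state scales with \<open>p\<close> and the adjoint equation is preserved; the state and the
  control stay the same.\<close>

lemma characteristic_solution_scale:
  assumes sol: "characteristic_solution T U G f \<eta> t0 x0 p0 x p u" and "t0 \<ge> 0" and "\<alpha> > 0"
    and \<eta>0: "\<forall>t\<in>{0..T}. \<forall>x\<in>G1. \<forall>u\<in>U. \<eta> t x u = 0"
    and hom: "\<forall>\<alpha>>0. \<forall>t\<in>{0..T}. \<forall>x\<in>G. \<forall>p. minimizers U f \<eta> t x p = minimizers U f \<eta> t x (\<alpha> *\<^sub>R p)"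
  shows "characteristic_solution T U G f \<eta> t0 x0 (\<alpha> *\<^sub>R p0) x (\<lambda>t. \<alpha> *\<^sub>R p t) u"
proof -
  have u: "u \<in> controls U t0 T" and x: "state_trajectory f G t0 T x0 u x"
    and p: "abs_continuous_on {t0..T} p" "p t0 = p0"
    and deriv: "AE t in lebesgue_on {t0..T}.
        (p has_vector_derivative - gradient (\<lambda>y. hamiltonian f \<eta> t y (u t) (p t)) (x t)) (at t within {t0..T})"
    and min: "AE t in lebesgue_on {t0..T}. u t \<in> minimizers U f \<eta> t (x t) (p t)"
    using sol by (auto simp: characteristic_solution_def)
  have xG: "x t \<in> G" if "t \<in> {t0..T}" for t using x that by (simp add: state_trajectory_def)
  have grad: "gradient (\<lambda>y. hamiltonian f \<eta> t y (u t) (\<alpha> *\<^sub>R q)) (x t) = \<alpha> *\<^sub>R gradient (\<lambda>y. hamiltonian f \<eta> t y (u t) q) (x t)"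
    if t: "t \<in> {t0..T}" for t q
  proof -
    have tT: "t \<in> {0..T}" using t \<open>t0 \<ge> 0\<close> by auto
    note D = hamiltonian_has_derivative[OF tT G_subset(1)[OF xG[OF t]] controlsD(2)[OF u t], of q]
    have "((\<lambda>y. hamiltonian f \<eta> t y (u t) (\<alpha> *\<^sub>R q)) has_derivative
        (\<lambda>h. \<alpha> *\<^sub>R inner h (gradient (\<lambda>y. hamiltonian f \<eta> t y (u t) q) (x t)))) (at (x t))"
      using has_derivative_scaleR_right[OF D, of \<alpha>]
    \<comment> \<open>\<open>\<eta>\<close> is known to vanish only for states in \<open>G1\<close>,
      so the two Hamiltonians are compared on the open set \<open>G\<close> around
      \<open>x t\<close> and not everywhere.\<close>
    proof (rule has_derivative_transform_within_open[OF _ open_G xG[OF t]])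
      fix y assume "y \<in> G"
      then show "\<alpha> *\<^sub>R hamiltonian f \<eta> t y (u t) q = hamiltonian f \<eta> t y (u t) (\<alpha> *\<^sub>R q)"
        using \<eta>0 tT G_subset(1) controlsD(2)[OF u t] by (simp add: hamiltonian_def)
    qed
    from has_derivative_gradient(1)[OF this]
    have "inner h (gradient (\<lambda>y. hamiltonian f \<eta> t y (u t) (\<alpha> *\<^sub>R q)) (x t))
      = inner h (\<alpha> *\<^sub>R gradient (\<lambda>y. hamiltonian f \<eta> t y (u t) q) (x t))" for h
      by simp
    then show ?thesis by (metis vector_eq_ldot)
  qed
  show ?thesis
    unfolding characteristic_solution_def
  proof (intro conjI)
    show "abs_continuous_on {t0..T} (\<lambda>t. \<alpha> *\<^sub>R p t)"
      unfolding abs_continuous_on_def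
    proof (intro allI impI)
      fix e :: real assume "e > 0"
      then have "e / \<alpha> > 0" using \<open>\<alpha> > 0\<close> by simp
      from p(1)[unfolded abs_continuous_on_def, rule_format, OF this]
      obtain \<delta> where \<delta>: "\<delta> > 0" "\<forall>d. d division_of \<Union>d \<and> \<Union>d \<subseteq> {t0..T} \<and>
        (\<Sum>k\<in>d. Sup k - Inf k) < \<delta> \<longrightarrow> (\<Sum>k\<in>d. norm (p (Sup k) - p (Inf k))) < e / \<alpha>"
        by (elim exE conjE)
      have "(\<Sum>k\<in>d. norm (\<alpha> *\<^sub>R p (Sup k) - \<alpha> *\<^sub>R p (Inf k))) = \<alpha> * (\<Sum>k\<in>d. norm (p (Sup k) - p (Inf k)))" for d
        using \<open>\<alpha> > 0\<close> by (simp add: scaleR_diff_right[symmetric] sum_distrib_left)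
      then show "\<exists>\<delta>>0. \<forall>d. d division_of \<Union> d \<and> \<Union> d \<subseteq> {t0..T} \<and> (\<Sum>k\<in>d. Sup k - Inf k) < \<delta>
        \<longrightarrow> (\<Sum>k\<in>d. norm (\<alpha> *\<^sub>R p (Sup k) - \<alpha> *\<^sub>R p (Inf k))) < e"
        using \<delta> \<open>\<alpha> > 0\<close> by (intro exI[of _ \<delta>]) (simp add: pos_less_divide_eq mult.commute)
    qed
    show "AE t in lebesgue_on {t0..T}. ((\<lambda>t. \<alpha> *\<^sub>R p t) has_vector_derivative
        - gradient (\<lambda>y. hamiltonian f \<eta> t y (u t) (\<alpha> *\<^sub>R p t)) (x t)) (at t within {t0..T})"
    proof (rule AE_lebesgue_on_subset[OF deriv])
      fix t assume t: "t \<in> {t0..T}" and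
        "(p has_vector_derivative - gradient (\<lambda>y. hamiltonian f \<eta> t y (u t) (p t)) (x t)) (at t within {t0..T})"
      from bounded_linear.has_vector_derivative[OF bounded_linear_scaleR_right this(2), of \<alpha>]
      show "((\<lambda>t. \<alpha> *\<^sub>R p t) has_vector_derivative
        - gradient (\<lambda>y. hamiltonian f \<eta> t y (u t) (\<alpha> *\<^sub>R p t)) (x t)) (at t within {t0..T})"
        by (simp add: grad[OF t])
    qed auto
    show "AE t in lebesgue_on {t0..T}. u t \<in> minimizers U f \<eta> t (x t) (\<alpha> *\<^sub>R p t)"
    proof (rule AE_lebesgue_on_subset[OF min])
      fix t assume t: "t \<in> {t0..T}" and ut: "u t \<in> minimizers U f \<eta> t (x t) (p t)"
      have tT: "t \<in> {0..T}" using t \<open>t0 \<ge> 0\<close> by simp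
      from ut show "u t \<in> minimizers U f \<eta> t (x t) (\<alpha> *\<^sub>R p t)"
        unfolding hom[rule_format, OF \<open>\<alpha> > 0\<close> tT xG[OF t], of "p t"] .
    qed auto
  qed (use u x p in auto)
qed

end

theorem theorem3p8:
  fixes T :: real
    and U :: "(real^'m) set"
    and G G1 :: "(real^'n) set"
    and f :: "real \<Rightarrow> real^'n \<Rightarrow> real^'m \<Rightarrow> real^'n"
    and \<eta> :: "real \<Rightarrow> real^'n \<Rightarrow> real^'m \<Rightarrow> real"
    and \<sigma> :: "real^'n \<Rightarrow> real"
  assumes "0 < T"
    and "assumption_B1 T U G G1 f \<eta> \<sigma>"
    and "assumption_B2 T U G G1 f \<eta> \<sigma>"
  shows "(\<forall>t0\<in>{0..<T}. \<forall>x0\<in>G.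
            is_minimum (value_function T U G1 f \<eta> \<sigma> t0 x0)
              {ereal (\<sigma> (x T) + (\<integral>t. \<eta> t (x t) (u t) \<partial>lebesgue_on {t0..T})) | x p u p0.
                 characteristic_solution T U G f \<eta> t0 x0 p0 x p u})
       \<and> ((\<forall>t\<in>{0..T}. \<forall>x\<in>G1. \<forall>u\<in>U. \<eta> t x u = 0) \<and>
          (\<forall>\<alpha>>0. \<forall>t\<in>{0..T}. \<forall>x\<in>G. \<forall>p. minimizers U f \<eta> t x p = minimizers U f \<eta> t x (\<alpha> *\<^sub>R p))
          \<longrightarrow> (\<forall>t0\<in>{0..<T}. \<forall>x0\<in>G.
                is_minimum (value_function T U G1 f \<eta> \<sigma> t0 x0)
                  {ereal (\<sigma> (x T)) | x p u p0.
                     p0 \<in> {p. norm p = 1 \<or> p = 0} \<and>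
                     characteristic_solution T U G f \<eta> t0 x0 p0 x p u}))"
proof -
  obtain a A1 A2 C where "control_problem T U G G1 f \<eta> \<sigma> a A1 A2 C"
    using control_problem_of_assumptions[OF assms(2,3)] .
  then interpret control_problem T U G G1 f \<eta> \<sigma> a A1 A2 C .
  show ?thesis
  proof (intro conjI impI ballI)
    fix t0 x0 assume t0: "t0 \<in> {0..<T}" and x0: "x0 \<in> G"
    obtain x p u p0 where "characteristic_solution T U G f \<eta> t0 x0 p0 x p u"
      "value_function T U G1 f \<eta> \<sigma> t0 x0 = ereal (cost T \<eta> \<sigma> t0 u x)"
      by (rule optimal_characteristic_exists[OF t0 x0])
    then show "is_minimum (value_function T U G1 f \<eta> \<sigma> t0 x0)
              {ereal (\<sigma> (x T) + (\<integral>t. \<eta> t (x t) (u t) \<partial>lebesgue_on {t0..T})) | x p u p0.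
                 characteristic_solution T U G f \<eta> t0 x0 p0 x p u}"
      using characteristic_cost_ge unfolding is_minimum_def cost_def by blast
  next
    fix t0 x0
    assume H: "(\<forall>t\<in>{0..T}. \<forall>x\<in>G1. \<forall>u\<in>U. \<eta> t x u = 0) \<and>
          (\<forall>\<alpha>>0. \<forall>t\<in>{0..T}. \<forall>x\<in>G. \<forall>p. minimizers U f \<eta> t x p = minimizers U f \<eta> t x (\<alpha> *\<^sub>R p))"
      and t0: "t0 \<in> {0..<T}" and x0: "x0 \<in> G"
    have cost_eq: "cost T \<eta> \<sigma> t0 u x = \<sigma> (x T)"
      if "characteristic_solution T U G f \<eta> t0 x0 p0 x p u" for x p u p0
    proof -
      have "\<eta> t (x t) (u t) = 0" if t: "t \<in> {t0..T}" for t
        using that \<open>characteristic_solution T U G f \<eta> t0 x0 p0 x p u\<close> H t0 G_subset(1)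
        by (auto simp: characteristic_solution_def state_trajectory_def controls_def)
      then have "(\<integral>t. \<eta> t (x t) (u t) \<partial>lebesgue_on {t0..T}) = (\<integral>t. 0 \<partial>lebesgue_on {t0..T})"
        by (intro Bochner_Integration.integral_cong) auto
      then show ?thesis by (simp add: cost_def)
    qed
    obtain x p u p0 where sol: "characteristic_solution T U G f \<eta> t0 x0 p0 x p u"
      and V: "value_function T U G1 f \<eta> \<sigma> t0 x0 = ereal (cost T \<eta> \<sigma> t0 u x)"
      by (rule optimal_characteristic_exists[OF t0 x0])
    have "\<exists>q q0. q0 \<in> {p. norm p = 1 \<or> p = 0} \<and> characteristic_solution T U G f \<eta> t0 x0 q0 x q u"
    \<comment> \<open>A zero initial value cannot be normalised, which is why 0 accompanies the unit
      sphere. Otherwise the factor \<open>1 / norm p0\<close> moves it to the sphere without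
      changing \<open>x\<close>, and hence without changing the cost.\<close>
    proof (cases "p0 = 0")
      case True
      then show ?thesis using sol by (intro exI[of _ p] exI[of _ p0]) auto
    next
      case False
      have "characteristic_solution T U G f \<eta> t0 x0 ((1 / norm p0) *\<^sub>R p0) x (\<lambda>t. (1 / norm p0) *\<^sub>R p t) u"
        by (rule characteristic_solution_scale[OF sol _ _ conjunct1[OF H] conjunct2[OF H]])
          (use t0 False in simp_all)
      moreover have "norm ((1 / norm p0) *\<^sub>R p0) = 1" using False by simp
      ultimately show ?thesis by blast
    qed
    then obtain q q0 where "q0 \<in> {p. norm p = 1 \<or> p = 0} \<and> characteristic_solution T U G f \<eta> t0 x0 q0 x q u"
      by (elim exE)
    then have mem: "ereal (\<sigma> (x T)) \<in> {ereal (\<sigma> (x T)) | x p u p0.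
                     p0 \<in> {p. norm p = 1 \<or> p = 0} \<and>
                     characteristic_solution T U G f \<eta> t0 x0 p0 x p u}"
      by (intro CollectI exI[of _ x] exI[of _ q] exI[of _ u] exI[of _ q0] conjI[OF refl])
    have lower: "value_function T U G1 f \<eta> \<sigma> t0 x0 \<le> ereal (\<sigma> (y T))"
      if "characteristic_solution T U G f \<eta> t0 x0 q0 y q w" for y q w q0
      using characteristic_cost_ge[OF that] cost_eq[OF that] by simp
    show "is_minimum (value_function T U G1 f \<eta> \<sigma> t0 x0)
                  {ereal (\<sigma> (x T)) | x p u p0.
                     p0 \<in> {p. norm p = 1 \<or> p = 0} \<and>
                     characteristic_solution T U G f \<eta> t0 x0 p0 x p u}"
      unfolding is_minimum_def
    proof (intro conjI ballI)
      show "value_function T U G1 f \<eta> \<sigma> t0 x0 \<in> {ereal (\<sigma> (x T)) | x p u p0.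
                     p0 \<in> {p. norm p = 1 \<or> p = 0} \<and>
                     characteristic_solution T U G f \<eta> t0 x0 p0 x p u}"
        unfolding V cost_eq[OF sol] by (rule mem)
    qed (use lower in blast)
  qed
qed

end
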